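(* Let $f\in\mathbb{C}[x_1,\ldots,x_n]$ be a homogeneous polynomial of degree $d\ge 3$ with $t$ monomial terms. Detecting whether $f$ is nondegenerate and, if it is degenerate, reducing it to a nondegenerate form in fewer variables requires $O(n^2t)$ arithmetic operations.
   Context: Complexity is counted in arithmetic operations over $\mathbb{C}$, in terms of the number of variables $n$, the degree $d$, and the number $t$ of monomial terms of $f$ (so $t\le\binom{n+d-1}{d}$). A homogeneous polynomial $f\in\mathbb{C}[x_1,\ldots,x_n]$ is nondegenerate if none of its variables can be removed by an invertible linear change of variables; otherwise it is degenerate. Equivalently, $f$ is nondegenerate if and only if its first-order partial derivatives $\frac{\partial f}{\partial x_1},\ldots,\frac{\partial f}{\partial x_n}$ are linearly independent over $\mathbb{C}$. If the span of the partial derivatives has dimension $r<n$, then reducing $f$ to a nondegenerate form means finding an invertible linear change of variables $x=Py$ and the polynomial $g=f(Py)$ such that $g$ involves only $y_1,\ldots,y_r$ and is nondegenerate as an $r$-variate polynomial. *)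

theory Defs
  imports Complex_Main "HOL-Library.Poly_Mapping" "Jordan_Normal_Form.Matrix"
begin

section \<open>Polynomials over the complex numbers\<close>

text \<open>
  A polynomial maps exponent vectors (finitely supported functions on variable indices) to
  coefficients.  The variables \<open>x\<^sub>1, \<dots>, x\<^sub>n\<close> have the indices \<open>0, \<dots>, n - 1\<close>.
\<close>

type_synonym cpoly = "(nat \<Rightarrow>\<^sub>0 nat) \<Rightarrow>\<^sub>0 complex"

definition const :: "complex \<Rightarrow> cpoly" where
  "const c = Poly_Mapping.single 0 c"

definition var :: "nat \<Rightarrow> cpoly" where
  "var i = Poly_Mapping.single (Poly_Mapping.single i 1) 1"

definition vars :: "cpoly \<Rightarrow> nat set" where
  "vars f = (\<Union>m\<in>Poly_Mapping.keys f. Poly_Mapping.keys m)"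

definition num_terms :: "cpoly \<Rightarrow> nat" where
  "num_terms f = card (Poly_Mapping.keys f)"

definition homogeneous :: "nat \<Rightarrow> cpoly \<Rightarrow> bool" where
  "homogeneous d f \<longleftrightarrow>
     (\<forall>m\<in>Poly_Mapping.keys f. (\<Sum>i\<in>Poly_Mapping.keys m. Poly_Mapping.lookup m i) = d)"

definition partial :: "nat \<Rightarrow> cpoly \<Rightarrow> cpoly" where
  "partial i f = (\<Sum>m\<in>Poly_Mapping.keys f.
     Poly_Mapping.single (m - Poly_Mapping.single i 1)
       (of_nat (Poly_Mapping.lookup m i) * Poly_Mapping.lookup f m))"

text \<open>The polynomial \<open>f(Py)\<close>, that is, \<open>x\<^sub>i\<close> is replaced by \<open>\<Sum>j. P\<^sub>i\<^sub>j y\<^sub>j\<close>.\<close>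

definition linear_subst :: "nat \<Rightarrow> complex mat \<Rightarrow> cpoly \<Rightarrow> cpoly" where
  "linear_subst n P f = (\<Sum>m\<in>Poly_Mapping.keys f. const (Poly_Mapping.lookup f m) *
     (\<Prod>i<n. (\<Sum>j<n. const (P $$ (i, j)) * var j) ^ Poly_Mapping.lookup m i))"

definition degenerate :: "nat \<Rightarrow> cpoly \<Rightarrow> bool" where
  "degenerate n f \<longleftrightarrow> (\<exists>P\<in>carrier_mat n n. invertible_mat P \<and>
     (\<exists>i<n. i \<notin> vars (linear_subst n P f)))"

abbreviation nondegenerate :: "nat \<Rightarrow> cpoly \<Rightarrow> bool" where
  "nondegenerate n f \<equiv> \<not> degenerate n f"

definition scale_poly :: "complex \<Rightarrow> cpoly \<Rightarrow> cpoly" where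
  "scale_poly c f = const c * f"

interpretation cpoly: vector_space scale_poly
  by unfold_locales
    (simp_all add: scale_poly_def const_def algebra_simps single_add mult_single
      flip: mult.assoc)

definition partials_dim :: "nat \<Rightarrow> cpoly \<Rightarrow> nat" where
  "partials_dim n f = cpoly.dim (cpoly.span ((\<lambda>i. partial i f) ` {..<n}))"

definition reduces_to :: "nat \<Rightarrow> cpoly \<Rightarrow> nat \<Rightarrow> complex mat \<Rightarrow> cpoly \<Rightarrow> bool" where
  "reduces_to n f r P g \<longleftrightarrow>
     r = partials_dim n f \<and> r < n \<and>
     P \<in> carrier_mat n n \<and> invertible_mat P \<and>
     g = linear_subst n P f \<and> vars g \<subseteq> {..<r} \<and> nondegenerate r g"


section \<open>A programming language that counts arithmetic operations\<close>

text \<open>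
  A state consists of named arrays, indexed by lists of natural numbers, of two kinds: \<open>ints\<close> hold
  the discrete data (indices, exponents, loop counters) and \<open>nums\<close> hold the complex numbers.
  A scalar is an array at the index \<open>[]\<close>.  Programs are finite pieces of syntax, so that one program
  has to handle all inputs, of all sizes.

  The cost counts every operation on complex numbers: each addition, subtraction, multiplication and
  division, each test for zero, and each conversion of a natural number to a complex number.
  Discrete control, the constants 0 and 1, and copying are free.  Complex numbers can influence the
  discrete data through zero tests only.
\<close>

record state =
  ints :: "string \<Rightarrow> nat list \<Rightarrow> nat"
  nums :: "string \<Rightarrow> nat list \<Rightarrow> complex"

datatype nexp =
    NLit nat
  | NAt string "nexp list"
  | NAdd nexp nexp
  | NSub nexp nexp
  | NMul nexp nexp

datatype bexp =
    BLess nexp nexp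
  | BNot bexp
  | BAnd bexp bexp

datatype arith = Plus | Minus | Times | Divide

type_synonym loc = "string \<times> nexp list"

datatype com =
    Skip
  | SetInt loc nexp
  | SetZero loc
  | SetOne loc
  | Copy loc loc
  | OfNat loc nexp
  | Arith loc arith loc loc
  | Seq com com
  | If bexp com com
  | IfZero loc com com
  | While bexp com

primrec nval :: "state \<Rightarrow> nexp \<Rightarrow> nat" where
  "nval s (NLit k) = k"
| "nval s (NAt x es) = ints s x (map (nval s) es)"
| "nval s (NAdd a b) = nval s a + nval s b"
| "nval s (NSub a b) = nval s a - nval s b"
| "nval s (NMul a b) = nval s a * nval s b"

primrec bval :: "state \<Rightarrow> bexp \<Rightarrow> bool" where
  "bval s (BLess a b) = (nval s a < nval s b)"
| "bval s (BNot b) = (\<not> bval s b)"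
| "bval s (BAnd a b) = (bval s a \<and> bval s b)"

primrec apply_arith :: "arith \<Rightarrow> complex \<Rightarrow> complex \<Rightarrow> complex" where
  "apply_arith Plus x y = x + y"
| "apply_arith Minus x y = x - y"
| "apply_arith Times x y = x * y"
| "apply_arith Divide x y = x / y"

definition get_num :: "state \<Rightarrow> loc \<Rightarrow> complex" where
  "get_num s l = nums s (fst l) (map (nval s) (snd l))"

definition set_num :: "state \<Rightarrow> loc \<Rightarrow> complex \<Rightarrow> state" where
  "set_num s l v = s\<lparr>nums := (nums s)(fst l := (nums s (fst l))(map (nval s) (snd l) := v))\<rparr>"

definition set_int :: "state \<Rightarrow> loc \<Rightarrow> nat \<Rightarrow> state" where
  "set_int s l v = s\<lparr>ints := (ints s)(fst l := (ints s (fst l))(map (nval s) (snd l) := v))\<rparr>"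

text \<open>
  \<open>exec c s k s'\<close>: started in \<open>s\<close>, the program \<open>c\<close> terminates in \<open>s'\<close> with cost \<open>k\<close>.
  A division by zero has no successor state.
\<close>

inductive exec :: "com \<Rightarrow> state \<Rightarrow> nat \<Rightarrow> state \<Rightarrow> bool" where
  Skip: "exec Skip s 0 s"
| SetInt: "exec (SetInt l e) s 0 (set_int s l (nval s e))"
| SetZero: "exec (SetZero l) s 0 (set_num s l 0)"
| SetOne: "exec (SetOne l) s 0 (set_num s l 1)"
| Copy: "exec (Copy l l') s 0 (set_num s l (get_num s l'))"
| OfNat: "exec (OfNat l e) s 1 (set_num s l (of_nat (nval s e)))"
| Arith: "(a = Divide \<Longrightarrow> get_num s l2 \<noteq> 0) \<Longrightarrow>
    exec (Arith l a l1 l2) s 1 (set_num s l (apply_arith a (get_num s l1) (get_num s l2)))"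
| Seq: "exec c1 s k1 s' \<Longrightarrow> exec c2 s' k2 s'' \<Longrightarrow> exec (Seq c1 c2) s (k1 + k2) s''"
| IfTrue: "bval s b \<Longrightarrow> exec c1 s k s' \<Longrightarrow> exec (If b c1 c2) s k s'"
| IfFalse: "\<not> bval s b \<Longrightarrow> exec c2 s k s' \<Longrightarrow> exec (If b c1 c2) s k s'"
| IfZeroTrue: "get_num s l = 0 \<Longrightarrow> exec c1 s k s' \<Longrightarrow> exec (IfZero l c1 c2) s (k + 1) s'"
| IfZeroFalse: "get_num s l \<noteq> 0 \<Longrightarrow> exec c2 s k s' \<Longrightarrow> exec (IfZero l c1 c2) s (k + 1) s'"
| WhileFalse: "\<not> bval s b \<Longrightarrow> exec (While b c) s 0 s"
| WhileTrue: "bval s b \<Longrightarrow> exec c s k1 s' \<Longrightarrow> exec (While b c) s' k2 s'' \<Longrightarrow>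
    exec (While b c) s (k1 + k2) s''"

lemma exec_deterministic:
  "exec c s k s' \<Longrightarrow> exec c s k2 s2 \<Longrightarrow> k2 = k \<and> s2 = s'"
proof (induction arbitrary: k2 s2 rule: exec.induct)
  case (Seq c1 s k1 s' c2 k2' s'')
  from Seq.prems show ?case by (cases rule: exec.cases) (use Seq.IH in blast)+
next
  case (WhileTrue s b c k1 s' k2' s'')
  from WhileTrue.prems show ?case
    by (cases rule: exec.cases) (use WhileTrue.IH WhileTrue.hyps in blast)+
qed (erule exec.cases; force)+


section \<open>Input and output\<close>

text \<open>
  Sparse representation of a polynomial in \<open>n\<close> variables: the cell \<open>tn\<close> holds the number of terms, the
  cells \<open>en\<close> at \<open>[k, i]\<close> hold the exponent of the variable \<open>i\<close> in the \<open>k\<close>-th term and the cells \<open>cn\<close>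
  at \<open>[k]\<close> hold its nonzero coefficient.  The terms are listed without repetition, in any order.
\<close>

definition stores_poly :: "nat \<Rightarrow> string \<Rightarrow> string \<Rightarrow> string \<Rightarrow> cpoly \<Rightarrow> state \<Rightarrow> bool" where
  "stores_poly n tn en cn f s \<longleftrightarrow> (\<exists>ms. distinct ms \<and> set ms = Poly_Mapping.keys f \<and>
     ints s tn [] = length ms \<and>
     (\<forall>k<length ms. nums s cn [k] = Poly_Mapping.lookup f (ms ! k) \<and>
        (\<forall>i<n. ints s en [k, i] = Poly_Mapping.lookup (ms ! k) i)))"

definition stores_input :: "nat \<Rightarrow> nat \<Rightarrow> cpoly \<Rightarrow> state \<Rightarrow> bool" where
  "stores_input n d f s \<longleftrightarrow>
     ints s ''n'' [] = n \<and> ints s ''d'' [] = d \<and> stores_poly n ''t'' ''a'' ''c'' f s"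

definition stores_output :: "nat \<Rightarrow> cpoly \<Rightarrow> state \<Rightarrow> bool" where
  "stores_output n f s \<longleftrightarrow>
     ints s ''nondegenerate'' [] = (if nondegenerate n f then 1 else 0) \<and>
     (degenerate n f \<longrightarrow>
       (let r = ints s ''r'' []; P = mat n n (\<lambda>(i, j). nums s ''P'' [i, j])
        in \<exists>g. stores_poly r ''u'' ''b'' ''g'' g s \<and> reduces_to n f r P g))"

end

theory Submission
  imports Defs "Jordan_Normal_Form.Determinant"
begin

text \<open>
  The linear relations between the partial derivatives of \<open>f\<close> form the kernel of a matrix that has a
  column for each variable and a row for each monomial \<open>m\<close> such that some \<open>m x\<^sub>i\<close> is a term of \<open>f\<close>; the
  entry in the column \<open>i\<close> is \<open>m\<^sub>i + 1\<close> times the coefficient of \<open>m x\<^sub>i\<close>.  Every nonzero entry comes from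
  a term of \<open>f\<close> and a variable that occurs in it, so there are at most \<open>n t\<close> of them.

  The program never transforms this matrix.  It maintains a basis of the kernel of the rows that it
  has seen, starting with the unit vectors.  A row with \<open>w\<close> nonzero entries is evaluated at all basis
  vectors with \<open>2 n w\<close> operations, which makes \<open>O(n\<^sup>2 t)\<close> for all rows.  If all values are zero, the
  basis stays as it is.  Otherwise a basis vector with a nonzero value is used to make the other values
  zero and is then retired, with \<open>O(n\<^sup>2)\<close> operations
  (\<open>echelon_kernel_keep\<close>, \<open>echelon_kernel_eliminate\<close>).

  Up to \<open>n\<close> vectors may be retired, and \<open>n\<close> may be much larger than \<open>t\<close>.  A row with
  only one nonzero entry, however, retires the unit vector of its variable without any arithmetic, and
  the program treats these rows first.  Every later pivot is a variable \<open>x\<^sub>i\<close> of a row that has a second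
  entry \<open>x\<^sub>j\<close>; then \<open>m x\<^sub>i\<close> and \<open>m x\<^sub>j\<close> are both terms, and \<open>e\<^sub>i - e\<^sub>j\<close> is the difference of their exponent
  vectors.  The exponent vectors span a space of dimension at most \<open>t\<close>, which leaves room for at
  most \<open>2 t\<close> such variables (\<open>card_adjacent_vars_le\<close>, \<open>card_pivots_le\<close>).

  In the end let \<open>J\<close> be the set of the \<open>r\<close> retired variables.  Their partial derivatives are a basis of the
  span of all partial derivatives (\<open>partials_dim_echelon_kernel\<close>), and for each other variable \<open>x\<^sub>l\<close>
  the kernel contains a vector that is \<open>e\<^sub>l\<close> plus a combination of the \<open>e\<^sub>j\<close> with \<open>j \<in> J\<close>.  The columns
  of \<open>P\<close> are the \<open>e\<^sub>j\<close> followed by these kernel vectors.  By the chain rule \<open>f(Py)\<close> does not depend on the last \<open>n - r\<close>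
  variables, so they can be set to zero: \<open>f(Py)\<close> arises from \<open>f\<close> by deleting all terms with
  a variable outside \<open>J\<close> and renaming the others, which is free of arithmetic.  It is
  nondegenerate because its partial derivatives are the images of those with respect to \<open>J\<close> under
  an injective substitution (locale \<open>reduction\<close>).  If \<open>J\<close> contains all variables, then \<open>f\<close> is nondegenerate.

  The program is verified with weakest preconditions for postconditions that also see the cost.
\<close>

section \<open>Polynomials as sums of monomials\<close>

text \<open>
  Additive maps are determined by their values at monomials.  The product rules below come from
  using this induction on both factors.
\<close>

lemma cpoly_induct [case_names single add]:
  fixes f :: cpoly
  assumes single: "\<And>m a. Q (Poly_Mapping.single m a)"
    and add: "\<And>f g. Q f \<Longrightarrow> Q g \<Longrightarrow> Q (f + g)"
  shows "Q f"
proof (induction f rule: update_induct)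
  case const
  show ?case using single[of 0 0] by simp
next
  case (update f a b)
  have "Poly_Mapping.update a b f = f + Poly_Mapping.single a b"
    using update.hyps
    by (intro poly_mapping_eqI) (auto simp: lookup_update lookup_add lookup_single in_keys_iff when_def)
  then show ?case using update.IH single add by metis
qed

text \<open>
  Derivatives and substitutions are sums over the terms of a polynomial.  This lemma and the next two
  make such sums additive in the polynomial and evaluate them at monomials.
\<close>

lemma sum_keys_superset:
  fixes F :: "(nat \<Rightarrow>\<^sub>0 nat) \<Rightarrow> complex \<Rightarrow> 'b::comm_monoid_add"
  assumes "finite K" "Poly_Mapping.keys f \<subseteq> K" "\<And>m. F m 0 = 0"
  shows "(\<Sum>m\<in>Poly_Mapping.keys f. F m (Poly_Mapping.lookup f m)) =
    (\<Sum>m\<in>K. F m (Poly_Mapping.lookup f m))"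
  using assms by (intro sum.mono_neutral_left) (auto simp: in_keys_iff)

lemma sum_keys_add:
  fixes F :: "(nat \<Rightarrow>\<^sub>0 nat) \<Rightarrow> complex \<Rightarrow> 'b::comm_monoid_add"
  assumes "\<And>m. F m 0 = 0" "\<And>m a b. F m (a + b) = F m a + F m b"
  shows "(\<Sum>m\<in>Poly_Mapping.keys (f + g). F m (Poly_Mapping.lookup (f + g) m)) =
    (\<Sum>m\<in>Poly_Mapping.keys f. F m (Poly_Mapping.lookup f m)) +
    (\<Sum>m\<in>Poly_Mapping.keys g. F m (Poly_Mapping.lookup g m))"
proof -
  let ?K = "Poly_Mapping.keys f \<union> Poly_Mapping.keys g"
  have "Poly_Mapping.keys (f + g) \<subseteq> ?K" by (rule keys_add)
  then show ?thesis
    using sum_keys_superset[of ?K "f + g" F] sum_keys_superset[of ?K f F]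
      sum_keys_superset[of ?K g F] assms
    by (simp add: lookup_add sum.distrib)
qed

lemma sum_keys_single:
  fixes F :: "(nat \<Rightarrow>\<^sub>0 nat) \<Rightarrow> complex \<Rightarrow> 'b::comm_monoid_add"
  assumes "\<And>m. F m 0 = 0"
  shows "(\<Sum>m\<in>Poly_Mapping.keys (Poly_Mapping.single m0 a).
    F m (Poly_Mapping.lookup (Poly_Mapping.single m0 a) m)) = F m0 a"
  using assms by (cases "a = 0") simp_all

lemma poly_as_sum_of_monomials:
  "(\<Sum>m\<in>Poly_Mapping.keys f. Poly_Mapping.single m (Poly_Mapping.lookup f m)) = f"
proof (rule poly_mapping_eqI)
  fix m
  show "Poly_Mapping.lookup (\<Sum>m\<in>Poly_Mapping.keys f. Poly_Mapping.single m (Poly_Mapping.lookup f m)) m =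
      Poly_Mapping.lookup f m"
    by (cases "m \<in> Poly_Mapping.keys f") (auto simp: lookup_sum lookup_single when_def in_keys_iff)
qed

lemma const_0 [simp]: "const 0 = 0"
  and const_1 [simp]: "const 1 = 1"
  and const_add: "const (a + b) = const a + const b"
  and const_mult: "const (a * b) = const a * const b"
  by (simp_all add: const_def single_add mult_single)

lemma const_sum: "const (sum h I) = (\<Sum>i\<in>I. const (h i))"
  by (induction I rule: infinite_finite_induct) (simp_all add: const_add)

lemma const_mult_single: "const c * Poly_Mapping.single m a = Poly_Mapping.single m (c * a)"
  by (simp add: const_def mult_single)

lemma lookup_const_mult [simp]: "Poly_Mapping.lookup (const c * f) m = c * Poly_Mapping.lookup f m"
  by (induction f rule: cpoly_induct)
    (simp_all add: const_mult_single distrib_left lookup_add lookup_single when_def)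


section \<open>Partial derivatives and linear substitutions\<close>

lemma partial_single:
  "partial i (Poly_Mapping.single m a) =
    Poly_Mapping.single (m - Poly_Mapping.single i 1) (of_nat (Poly_Mapping.lookup m i) * a)"
  unfolding partial_def
  by (rule sum_keys_single[where F = "\<lambda>m c. Poly_Mapping.single (m - Poly_Mapping.single i 1)
    (of_nat (Poly_Mapping.lookup m i) * c)"]) simp

lemma partial_add: "partial i (f + g) = partial i f + partial i g"
  unfolding partial_def
  by (rule sum_keys_add[where F = "\<lambda>m c. Poly_Mapping.single (m - Poly_Mapping.single i 1)
    (of_nat (Poly_Mapping.lookup m i) * c)"]) (simp_all add: single_add distrib_left)

lemma partial_0 [simp]: "partial i 0 = 0"
  by (simp add: partial_def)

lemma partial_sum: "partial i (sum h I) = (\<Sum>j\<in>I. partial i (h j))"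
  by (induction I rule: infinite_finite_induct) (simp_all add: partial_add)

text \<open>
  Subtraction of exponents truncates at zero; it is undone by addition only if \<open>x\<^sub>i\<close> divides \<open>m\<close>.
\<close>

lemma shift_monomial_iff:
  fixes m m' :: "nat \<Rightarrow>\<^sub>0 nat"
  assumes "Poly_Mapping.lookup m i > 0"
  shows "m - Poly_Mapping.single i 1 = m' \<longleftrightarrow> m = m' + Poly_Mapping.single i 1"
  using assms
  by (auto simp: poly_mapping_eq_iff fun_eq_iff lookup_minus lookup_add lookup_single when_def
      split: if_splits; metis Suc_diff_1 Suc_pred diff_Suc_1 One_nat_def)

text \<open>
  Differentiation sends distinct monomials that contain \<open>x\<^sub>i\<close> to distinct monomials, so each coefficient of the derivative
  stems from one term.  This identifies the entries of the matrix of the gradient.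
\<close>

lemma lookup_partial:
  "Poly_Mapping.lookup (partial i f) m =
    of_nat (Suc (Poly_Mapping.lookup m i)) * Poly_Mapping.lookup f (m + Poly_Mapping.single i 1)"
proof (induction f rule: cpoly_induct)
  case (single m0 a)
  show ?case
    using shift_monomial_iff[of m0 i m]
    by (cases "Poly_Mapping.lookup m0 i = 0")
      (auto simp: partial_single lookup_single when_def lookup_add)
next
  case (add f g)
  then show ?case by (simp add: partial_add lookup_add algebra_simps)
qed

lemma partial_eq_0_imp_not_in_vars:
  assumes "partial i f = 0"
  shows "i \<notin> vars f"
proof
  assume "i \<in> vars f"
  then obtain m where m: "m \<in> Poly_Mapping.keys f" "Poly_Mapping.lookup m i > 0"
    by (auto simp: vars_def in_keys_iff)
  then have "(m - Poly_Mapping.single i 1) + Poly_Mapping.single i 1 = m"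
    using shift_monomial_iff by metis
  then have "Poly_Mapping.lookup (partial i f) (m - Poly_Mapping.single i 1) \<noteq> 0"
    using m(1) of_nat_neq_0 by (simp add: lookup_partial in_keys_iff del: of_nat_Suc)
  then show False using assms by simp
qed

lemma not_in_vars_imp_partial_eq_0: "i \<notin> vars f \<Longrightarrow> partial i f = 0"
  unfolding partial_def vars_def by (auto simp: in_keys_iff intro!: sum.neutral)

lemma partial_mult: "partial i (f * g) = partial i f * g + f * partial i g"
proof (induction f rule: cpoly_induct)
  case (single m a)
  show ?case
  proof (induction g rule: cpoly_induct)
    case (single m' b)
    have left: "Poly_Mapping.single (m + m' - Poly_Mapping.single i 1) (of_nat (Poly_Mapping.lookup m i) * c) =
      Poly_Mapping.single ((m - Poly_Mapping.single i 1) + m') (of_nat (Poly_Mapping.lookup m i) * c)"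
      for m m' :: "nat \<Rightarrow>\<^sub>0 nat" and c :: complex
    proof (cases "Poly_Mapping.lookup m i = 0")
      case False
      then have "m + m' - Poly_Mapping.single i 1 = (m - Poly_Mapping.single i 1) + m'"
        by (intro poly_mapping_eqI) (auto simp: lookup_add lookup_minus lookup_single when_def)
      then show ?thesis by simp
    qed simp
    show ?case
      using left[of m m' "a * b"] left[of m' m "a * b"]
      by (simp add: mult_single partial_single lookup_add single_add distrib_left distrib_right add.commute
          mult.left_commute mult.assoc)
  qed (simp add: partial_add algebra_simps)
qed (simp add: partial_add algebra_simps)

lemma partial_const [simp]: "partial i (const c) = 0"
  by (simp add: const_def partial_single)

lemma partial_var: "partial i (var j) = (if i = j then 1 else 0)"
  by (simp add: var_def partial_single lookup_single)

lemma partial_power: "partial i (f ^ e) = of_nat e * f ^ (e - 1) * partial i f"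
proof (induction e)
  case 0
  show ?case using partial_const[of i 1] by simp
next
  case (Suc e)
  then show ?case by (cases e) (simp_all add: partial_mult algebra_simps)
qed

lemma partial_prod:
  assumes "finite I"
  shows "partial k (prod h I) = (\<Sum>i\<in>I. partial k (h i) * prod h (I - {i}))"
  using assms
proof (induction I)
  case empty
  show ?case using partial_const[of k 1] by simp
next
  case (insert j I)
  have "(\<Sum>i\<in>I. partial k (h i) * prod h (insert j I - {i})) =
      h j * (\<Sum>i\<in>I. partial k (h i) * prod h (I - {i}))"
    unfolding sum_distrib_left
  proof (rule sum.cong[OF refl])
    fix i assume "i \<in> I"
    then have "insert j I - {i} = insert j (I - {i})" "j \<notin> I - {i}" using insert by auto
    then show "partial k (h i) * prod h (insert j I - {i}) = h j * (partial k (h i) * prod h (I - {i}))"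
      using insert.hyps by (simp add: mult.left_commute)
  qed
  then show ?case using insert by (simp add: partial_mult)
qed

definition row_form :: "nat \<Rightarrow> complex mat \<Rightarrow> nat \<Rightarrow> cpoly" where
  "row_form n P i = (\<Sum>j<n. const (P $$ (i, j)) * var j)"

lemma linear_subst_row_form:
  "linear_subst n P f = (\<Sum>m\<in>Poly_Mapping.keys f. const (Poly_Mapping.lookup f m) *
     (\<Prod>i<n. row_form n P i ^ Poly_Mapping.lookup m i))"
  by (simp add: linear_subst_def row_form_def)

lemma linear_subst_single:
  "linear_subst n P (Poly_Mapping.single m a) = const a * (\<Prod>i<n. row_form n P i ^ Poly_Mapping.lookup m i)"
  unfolding linear_subst_row_form
  by (rule sum_keys_single[where F = "\<lambda>m c. const c * (\<Prod>i<n. row_form n P i ^ Poly_Mapping.lookup m i)"]) simp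

lemma linear_subst_add: "linear_subst n P (f + g) = linear_subst n P f + linear_subst n P g"
  unfolding linear_subst_row_form
  by (rule sum_keys_add[where F = "\<lambda>m c. const c * (\<Prod>i<n. row_form n P i ^ Poly_Mapping.lookup m i)"])
    (simp_all add: const_add distrib_right)

lemma linear_subst_0 [simp]: "linear_subst n P 0 = 0"
  by (simp add: linear_subst_def)

lemma linear_subst_sum: "linear_subst n P (sum h I) = (\<Sum>j\<in>I. linear_subst n P (h j))"
  by (induction I rule: infinite_finite_induct) (simp_all add: linear_subst_add)

lemma linear_subst_const: "linear_subst n P (const c) = const c"
  unfolding const_def[of c] by (subst linear_subst_single) (simp add: const_def)

lemma linear_subst_mult: "linear_subst n P (f * g) = linear_subst n P f * linear_subst n P g"
proof (induction f rule: cpoly_induct)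
  case (single m a)
  show ?case
  proof (induction g rule: cpoly_induct)
    case (single m' b)
    show ?case
      by (simp add: mult_single linear_subst_single const_mult lookup_add power_add prod.distrib
          mult.assoc mult.left_commute)
  qed (simp add: linear_subst_add distrib_left)
qed (simp add: linear_subst_add distrib_right)

lemma linear_subst_prod: "linear_subst n P (prod h I) = (\<Prod>j\<in>I. linear_subst n P (h j))"
  using linear_subst_const[of n P 1]
  by (induction I rule: infinite_finite_induct) (simp_all add: linear_subst_mult)

lemma linear_subst_power: "linear_subst n P (f ^ e) = linear_subst n P f ^ e"
  using linear_subst_const[of n P 1] by (induction e) (simp_all add: linear_subst_mult)

lemma linear_subst_var:
  assumes "i < n"
  shows "linear_subst n P (var i) = row_form n P i"
proof -
  have "(\<Prod>j<n. row_form n P j ^ Poly_Mapping.lookup (Poly_Mapping.single i (1::nat)) j) =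
      (\<Prod>j<n. if j = i then row_form n P i else 1)"
    by (intro prod.cong) (auto simp: lookup_single when_def)
  then show ?thesis
    using assms unfolding var_def by (simp add: linear_subst_single prod.delta)
qed

text \<open>
  Substitutions compose like matrices, so an invertible matrix gives an injective substitution
  (\<open>linear_subst_eq_0_imp\<close>).
\<close>

lemma linear_subst_linear_subst:
  assumes "P \<in> carrier_mat n n" "Q \<in> carrier_mat n n"
  shows "linear_subst n Q (linear_subst n P f) = linear_subst n (P * Q) f"
proof -
  have "linear_subst n Q (row_form n P i) = row_form n (P * Q) i" if "i < n" for i
  proof -
    have "linear_subst n Q (row_form n P i) = (\<Sum>j<n. const (P $$ (i, j)) * row_form n Q j)"
      unfolding row_form_def[of n P]
      by (simp add: linear_subst_sum linear_subst_mult linear_subst_const linear_subst_var)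
    also have "\<dots> = (\<Sum>k<n. \<Sum>j<n. const (P $$ (i, j)) * (const (Q $$ (j, k)) * var k))"
      by (simp add: row_form_def sum_distrib_left) (rule sum.swap)
    also have "\<dots> = (\<Sum>k<n. const ((P * Q) $$ (i, k)) * var k)"
      using assms that
      by (intro sum.cong)
        (auto simp: scalar_prod_def const_sum const_mult sum_distrib_right mult.assoc atLeast0LessThan)
    finally show ?thesis by (simp add: row_form_def)
  qed
  then show ?thesis
    by (simp add: linear_subst_row_form[of n P] linear_subst_row_form[of n "P * Q"] linear_subst_sum
        linear_subst_mult linear_subst_const linear_subst_prod linear_subst_power)
qed

lemma var_power: "var i ^ e = Poly_Mapping.single (Poly_Mapping.single i e) 1"
  by (induction e) (simp_all add: var_def mult_single add.commute flip: single_add)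

lemma prod_single_1:
  "(\<Prod>i\<in>I. Poly_Mapping.single (h i) (1::complex)) = Poly_Mapping.single (sum h I) 1"
  by (induction I rule: infinite_finite_induct) (simp_all add: mult_single)

lemma monomial_as_sum:
  fixes m :: "nat \<Rightarrow>\<^sub>0 nat"
  assumes "Poly_Mapping.keys m \<subseteq> {..<n}"
  shows "(\<Sum>i<n. Poly_Mapping.single i (Poly_Mapping.lookup m i)) = m"
proof (rule poly_mapping_eqI)
  fix j
  show "Poly_Mapping.lookup (\<Sum>i<n. Poly_Mapping.single i (Poly_Mapping.lookup m i)) j = Poly_Mapping.lookup m j"
    using assms by (cases "j < n") (auto simp: lookup_sum lookup_single when_def in_keys_iff subset_iff)
qed

lemma linear_subst_one:
  assumes "vars f \<subseteq> {..<n}"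
  shows "linear_subst n (1\<^sub>m n) f = f"
proof -
  have L: "row_form n (1\<^sub>m n) i = var i" if "i < n" for i
  proof -
    have "row_form n (1\<^sub>m n) i = (\<Sum>j<n. if j = i then var i else 0)"
      unfolding row_form_def using that by (intro sum.cong) auto
    then show ?thesis using that by simp
  qed
  have "linear_subst n (1\<^sub>m n) f = (\<Sum>m\<in>Poly_Mapping.keys f. Poly_Mapping.single m (Poly_Mapping.lookup f m))"
    unfolding linear_subst_row_form
  proof (rule sum.cong[OF refl])
    fix m assume "m \<in> Poly_Mapping.keys f"
    then have "Poly_Mapping.keys m \<subseteq> {..<n}" using assms by (auto simp: vars_def)
    then show "const (Poly_Mapping.lookup f m) * (\<Prod>i<n. row_form n (1\<^sub>m n) i ^ Poly_Mapping.lookup m i) =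
        Poly_Mapping.single m (Poly_Mapping.lookup f m)"
      by (simp add: L var_power prod_single_1 monomial_as_sum const_mult_single)
  qed
  also have "\<dots> = f"
    by (rule poly_as_sum_of_monomials)
  finally show ?thesis .
qed

lemma linear_subst_eq_0_imp:
  assumes P: "P \<in> carrier_mat n n" "invertible_mat P"
    and f: "vars f \<subseteq> {..<n}" and "linear_subst n P f = 0"
  shows "f = 0"
proof -
  obtain Q where "inverts_mat P Q" "inverts_mat Q P"
    using P(2) by (auto simp: invertible_mat_def)
  then have PQ: "P * Q = 1\<^sub>m n" and QP: "Q * P = 1\<^sub>m (dim_row Q)"
    using P(1) by (auto simp: inverts_mat_def)
  have "Q \<in> carrier_mat n n"
    using P(1) PQ QP by (metis carrier_matD(2) carrier_matI index_mult_mat(3) index_one_mat(3))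
  then have "f = linear_subst n Q (linear_subst n P f)"
    using P(1) PQ f by (simp add: linear_subst_linear_subst linear_subst_one)
  then show ?thesis using assms(4) by simp
qed

lemma partial_row_form: "k < n \<Longrightarrow> partial k (row_form n P i) = const (P $$ (i, k))"
  by (simp add: row_form_def partial_sum partial_mult partial_var if_distrib cong: if_cong)

text \<open>
  The chain rule.  It suffices to check monomials, where it is the product rule for a product of powers of
  linear forms.
\<close>

lemma partial_linear_subst:
  assumes k: "k < n"
  shows "partial k (linear_subst n P f) = (\<Sum>i<n. const (P $$ (i, k)) * linear_subst n P (partial i f))"
proof (induction f rule: cpoly_induct)
  case (single m a)
  let ?L = "row_form n P" and ?e = "Poly_Mapping.lookup m"
  have rest: "(\<Prod>j<n. ?L j ^ Poly_Mapping.lookup (m - Poly_Mapping.single i 1) j) =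
      ?L i ^ (?e i - 1) * (\<Prod>j\<in>{..<n} - {i}. ?L j ^ ?e j)" if "i < n" for i
  proof -
    have "(\<Prod>j\<in>{..<n} - {i}. ?L j ^ Poly_Mapping.lookup (m - Poly_Mapping.single i 1) j) =
        (\<Prod>j\<in>{..<n} - {i}. ?L j ^ ?e j)"
      by (rule prod.cong) (auto simp: lookup_minus lookup_single)
    then show ?thesis
      using that by (subst prod.remove[of _ i]) (auto simp: lookup_minus)
  qed
  have "partial k (linear_subst n P (Poly_Mapping.single m a)) =
      const a * (\<Sum>i<n. of_nat (?e i) * ?L i ^ (?e i - 1) * const (P $$ (i, k)) *
        (\<Prod>j\<in>{..<n} - {i}. ?L j ^ ?e j))"
    using k by (simp add: linear_subst_single partial_mult partial_prod partial_power partial_row_form)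
  also have "\<dots> = (\<Sum>i<n. const (P $$ (i, k)) * linear_subst n P (partial i (Poly_Mapping.single m a)))"
    unfolding sum_distrib_left
  proof (rule sum.cong[OF refl])
    fix i assume "i \<in> {..<n}"
    moreover have "const (of_nat e) = of_nat e" for e
      by (induction e) (simp_all add: const_add)
    ultimately show "const a * (of_nat (?e i) * ?L i ^ (?e i - 1) * const (P $$ (i, k)) *
        (\<Prod>j\<in>{..<n} - {i}. ?L j ^ ?e j)) =
        const (P $$ (i, k)) * linear_subst n P (partial i (Poly_Mapping.single m a))"
      using rest[of i] by (simp add: partial_single linear_subst_single const_mult mult_ac)
  qed
  finally show ?case .
next
  case (add f g)
  then show ?case by (simp add: partial_add linear_subst_add distrib_left sum.distrib)
qed


section \<open>The number of variables that occur in several rows\<close>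

text \<open>
  Independence of a family rather than of a set: the family must also be injective, which a relation
  with the coefficients 1 and -1 shows.
\<close>

lemma independent_family:
  assumes "finite I"
    and indep: "\<And>u. (\<Sum>i\<in>I. const (u i) * b i) = 0 \<Longrightarrow> \<forall>i\<in>I. u i = 0"
  shows "cpoly.independent (b ` I)" "inj_on b I"
proof -
  show inj: "inj_on b I"
  proof (rule inj_onI, rule ccontr)
    fix i j assume ij: "i \<in> I" "j \<in> I" "b i = b j" "i \<noteq> j"
    define u :: "'a \<Rightarrow> complex" where "u = (\<lambda>k. if k = i then 1 else if k = j then - 1 else 0)"
    have "(\<Sum>k\<in>I. const (u k) * b k) = (\<Sum>k\<in>{i, j}. const (u k) * b k)"
      using ij assms(1) by (intro sum.mono_neutral_right) (auto simp: u_def)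
    also have "\<dots> = b i - b j"
      using ij(4) by (simp add: u_def const_def single_uminus)
    finally have "u i = 0" using indep[of u] ij by simp
    then show False by (simp add: u_def)
  qed
  show "cpoly.independent (b ` I)"
  proof (rule cpoly.independent_if_scalars_zero)
    fix u x assume sum: "(\<Sum>x\<in>b ` I. scale_poly (u x) x) = 0" and x: "x \<in> b ` I"
    have "(\<Sum>i\<in>I. const (u (b i)) * b i) = 0"
      using sum inj by (simp add: sum.reindex scale_poly_def)
    then show "u x = 0" using indep[of "\<lambda>i. u (b i)"] x by auto
  qed (use assms(1) in simp)
qed

lemma lookup_var: "Poly_Mapping.lookup (var j) (Poly_Mapping.single i 1) = (if i = j then 1 else 0)"
proof -
  have "Poly_Mapping.single j (1::nat) = Poly_Mapping.single i 1 \<longleftrightarrow> i = j"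
    by (metis lookup_single_eq lookup_single_not_eq zero_neq_one)
  then show ?thesis by (simp add: var_def lookup_single when_def)
qed

text \<open>
  Write \<open>i \<sim> j\<close> if \<open>e\<^sub>i - e\<^sub>j\<close> lies in the span \<open>U\<close> of the exponent vectors.  By assumption every class of this equivalence
  relation on \<open>V\<close> has at least two elements.  Choose a representative \<open>\<rho> i\<close> in each class.
  The vectors \<open>e\<^sub>i - e\<^bsub>\<rho> i\<^esub>\<close> with \<open>\<rho> i \<noteq> i\<close> are independent elements of \<open>U\<close>, so there are at most \<open>card S\<close>
  of them, and at least half of the elements of \<open>V\<close> are of this kind.  The vectors are encoded as linear forms, for
  which a vector space is at hand.
\<close>

lemma card_adjacent_vars_le:
  fixes S :: "(nat \<Rightarrow>\<^sub>0 nat) set"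
  assumes S: "finite S" and V: "finite V"
    and adj: "\<And>i. i \<in> V \<Longrightarrow> \<exists>j\<in>V. j \<noteq> i \<and> (\<exists>m\<in>S. \<exists>m'\<in>S.
      m + Poly_Mapping.single j 1 = m' + Poly_Mapping.single i 1)"
  shows "card V \<le> 2 * card S"
proof -
  define vec where "vec m = (\<Sum>i\<in>V. const (of_nat (Poly_Mapping.lookup m i)) * var i)"
    for m :: "nat \<Rightarrow>\<^sub>0 nat"
  define U where "U = cpoly.span (vec ` S)"
  define \<rho> where "\<rho> i = (LEAST j. j \<in> V \<and> var i - var j \<in> U)" for i
  define N where "N = {i\<in>V. \<rho> i \<noteq> i}"
  have U_diff: "a - b \<in> U" if "a \<in> U" "b \<in> U" for a b
    using that unfolding U_def by (rule cpoly.span_diff)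
  have U_0: "0 \<in> U" unfolding U_def by (rule cpoly.span_zero)
  have vec_add: "vec (m + Poly_Mapping.single j 1) = vec m + var j" if "j \<in> V" for m j
  proof -
    have "vec (m + Poly_Mapping.single j 1) = (\<Sum>i\<in>V. const (of_nat (Poly_Mapping.lookup m i)) * var i
        + (if i = j then var j else 0))"
      unfolding vec_def
      by (intro sum.cong) (auto simp: lookup_add lookup_single when_def const_add distrib_right)
    then show ?thesis using that V by (simp add: vec_def sum.distrib)
  qed
  have step: "\<exists>j\<in>V. j \<noteq> i \<and> var i - var j \<in> U" if i: "i \<in> V" for i
  proof -
    obtain j m m' where j: "j \<in> V" "j \<noteq> i" "m \<in> S" "m' \<in> S"
      "m + Poly_Mapping.single j 1 = m' + Poly_Mapping.single i 1"
      using adj[OF i] by blast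
    then have "vec m + var j = vec m' + var i" using vec_add i by metis
    then have "var i - var j = vec m - vec m'" by (simp add: algebra_simps)
    moreover have "vec m - vec m' \<in> U"
      using j by (intro U_diff) (auto simp: U_def intro: cpoly.span_base)
    ultimately show ?thesis using j by auto
  qed
  have \<rho>: "\<rho> i \<in> V \<and> var i - var (\<rho> i) \<in> U" if "i \<in> V" for i
    unfolding \<rho>_def by (rule LeastI[of _ i]) (use that U_0 in simp)
  have \<rho>_cong: "\<rho> i = \<rho> j" if "var i - var j \<in> U" for i j
  proof -
    have "var i - var k \<in> U \<longleftrightarrow> var j - var k \<in> U" for k
      using U_diff[OF _ that, of "var i - var k"] U_diff[OF that U_diff[OF U_0], of "var j - var k"]
      by (auto simp: algebra_simps)
    then show ?thesis by (simp add: \<rho>_def)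
  qed
  \<comment> \<open>Every representative has a partner in its class that is no representative, so at least half
     of the variables are no representatives.\<close>
  have "V - N \<subseteq> \<rho> ` N"
  proof
    fix i assume i: "i \<in> V - N"
    then obtain j where j: "j \<in> V" "j \<noteq> i" "var i - var j \<in> U" using step by blast
    then have "\<rho> j = i" using \<rho>_cong i by (auto simp: N_def)
    then show "i \<in> \<rho> ` N" using j by (auto simp: N_def)
  qed
  moreover have "finite N" using V by (simp add: N_def)
  ultimately have "card (V - N) \<le> card N" by (meson surj_card_le)
  moreover have "card V = card N + card (V - N)"
    using V by (metis (no_types, lifting) N_def card_Diff_subset card_mono finite_subset
        le_add_diff_inverse mem_Collect_eq subsetI)
  moreover have "card N \<le> card S"
  proof -
    let ?b = "\<lambda>i. var i - var (\<rho> i)"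
    have "\<forall>i\<in>N. u i = 0" if sum: "(\<Sum>i\<in>N. const (u i) * ?b i) = 0" for u
    proof
      fix k assume k: "k \<in> N"
      \<comment> \<open>The coordinate \<open>k\<close> isolates the summand \<open>k\<close>, because \<open>k\<close> itself is no representative.\<close>
      have "\<rho> i \<noteq> k" if "i \<in> N" for i
        using that k \<rho>[of i] \<rho>_cong[of i "\<rho> i"] by (auto simp: N_def)
      then have "(\<Sum>i\<in>N. u i * (Poly_Mapping.lookup (?b i) (Poly_Mapping.single k 1))) =
          (\<Sum>i\<in>N. if i = k then u k else 0)"
        by (intro sum.cong) (auto simp: lookup_minus lookup_var simp del: One_nat_def)
      also have "\<dots> = u k" using k \<open>finite N\<close> by simp
      finally show "u k = 0"
        using arg_cong[OF sum, of "\<lambda>p. Poly_Mapping.lookup p (Poly_Mapping.single k 1)"]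
        by (simp add: lookup_sum)
    qed
    from independent_family[OF \<open>finite N\<close> this]
    have B: "cpoly.independent (?b ` N)" "inj_on ?b N" by auto
    have "?b ` N \<subseteq> cpoly.span (vec ` S)"
      using \<rho> by (auto simp: N_def U_def)
    then have "card (?b ` N) \<le> card (vec ` S)"
      using cpoly.independent_span_bound[OF _ B(1)] S by simp
    also have "\<dots> \<le> card S" using S by (rule card_image_le)
    finally show ?thesis using B(2) by (simp add: card_image)
  qed
  ultimately show ?thesis by simp
qed


section \<open>Kernels in echelon form\<close>

text \<open>
  Vectors of length \<open>n\<close> are functions whose values at \<open>0, \<dots>, n - 1\<close> matter.  Compatibility with
  \<open>y - c z\<close> is the form of linearity that elimination uses.
\<close>

definition linear_functional :: "nat \<Rightarrow> ((nat \<Rightarrow> complex) \<Rightarrow> complex) \<Rightarrow> bool" where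
  "linear_functional n \<phi> \<longleftrightarrow>
     (\<forall>y z c. \<phi> (\<lambda>i. y i - c * z i) = \<phi> y - c * \<phi> z) \<and> (\<forall>y. (\<forall>i<n. y i = 0) \<longrightarrow> \<phi> y = 0)"

lemma linear_functional_diff:
  "linear_functional n \<phi> \<Longrightarrow> \<phi> (\<lambda>i. y i - c * z i) = \<phi> y - c * \<phi> z"
  by (simp add: linear_functional_def)

lemma linear_functional_zero: "linear_functional n \<phi> \<Longrightarrow> \<forall>i<n. y i = 0 \<Longrightarrow> \<phi> y = 0"
  by (simp add: linear_functional_def)

lemma linear_functional_cong:
  assumes "linear_functional n \<phi>" "\<And>i. i < n \<Longrightarrow> y i = z i"
  shows "\<phi> y = \<phi> z"
proof -
  have "\<phi> (\<lambda>i. y i - 1 * z i) = 0"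
    by (rule linear_functional_zero[OF assms(1)]) (simp add: assms(2))
  then show ?thesis using linear_functional_diff[OF assms(1), of y 1 z] by simp
qed

text \<open>
  The matrix \<open>Q\<close> holds a basis of the common kernel of \<open>\<Phi>\<close> in echelon form: the columns
  \<open>l \<in> A\<close> are \<open>e\<^sub>l\<close> plus a combination of the \<open>e\<^sub>j\<close> with \<open>j \<notin> A\<close> and are killed by \<open>\<Phi>\<close>, while the columns
  \<open>j \<notin> A\<close> are unit vectors.  The last condition says that the coordinates in \<open>A\<close> determine an element of the kernel, so that the
  columns in \<open>A\<close> span it.
\<close>

definition echelon_kernel ::
  "nat \<Rightarrow> ((nat \<Rightarrow> complex) \<Rightarrow> complex) set \<Rightarrow> nat set \<Rightarrow> (nat \<Rightarrow> nat \<Rightarrow> complex) \<Rightarrow> bool" where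
  "echelon_kernel n \<Phi> A Q \<longleftrightarrow> A \<subseteq> {..<n} \<and>
     (\<forall>i<n. \<forall>l<n. i \<in> A \<or> l \<notin> A \<longrightarrow> Q i l = (if i = l then 1 else 0)) \<and>
     (\<forall>l\<in>A. \<forall>\<phi>\<in>\<Phi>. \<phi> (\<lambda>i. Q i l) = 0) \<and>
     (\<forall>y. (\<forall>i\<in>A. y i = 0) \<longrightarrow> (\<forall>\<phi>\<in>\<Phi>. \<phi> y = 0) \<longrightarrow> (\<forall>i<n. y i = 0))"

lemma echelon_kernelD:
  assumes ker: "echelon_kernel n \<Phi> A Q"
  shows "A \<subseteq> {..<n}"
    and "i < n \<Longrightarrow> l < n \<Longrightarrow> i \<in> A \<or> l \<notin> A \<Longrightarrow> Q i l = (if i = l then 1 else 0)"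
    and "l \<in> A \<Longrightarrow> \<forall>\<phi>\<in>\<Phi>. \<phi> (\<lambda>i. Q i l) = 0"
    and "\<forall>i\<in>A. y i = 0 \<Longrightarrow> \<forall>\<phi>\<in>\<Phi>. \<phi> y = 0 \<Longrightarrow> \<forall>i<n. y i = 0"
proof -
  note c = ker[unfolded echelon_kernel_def]
  note unit = c[THEN conjunct2, THEN conjunct1]
    and kill = c[THEN conjunct2, THEN conjunct2, THEN conjunct1]
    and ind = c[THEN conjunct2, THEN conjunct2, THEN conjunct2]
  show "A \<subseteq> {..<n}" by (rule conjunct1[OF c])
  show "i < n \<Longrightarrow> l < n \<Longrightarrow> i \<in> A \<or> l \<notin> A \<Longrightarrow> Q i l = (if i = l then 1 else 0)"
    using unit by blast
  show "l \<in> A \<Longrightarrow> \<forall>\<phi>\<in>\<Phi>. \<phi> (\<lambda>i. Q i l) = 0"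
    by (rule bspec[OF kill])
  show "\<forall>i\<in>A. y i = 0 \<Longrightarrow> \<forall>\<phi>\<in>\<Phi>. \<phi> y = 0 \<Longrightarrow> \<forall>i<n. y i = 0"
    using spec[OF ind, of y] by (elim impE)
qed

text \<open>
  The program fills a finite square of cells only, so \<open>Q\<close> is known up to values at larger indices.
\<close>

lemma echelon_kernel_cong:
  assumes "\<And>\<phi>. \<phi> \<in> \<Phi> \<Longrightarrow> linear_functional n \<phi>"
    and "\<And>i l. i < n \<Longrightarrow> l < n \<Longrightarrow> Q' i l = Q i l"
    and ker: "echelon_kernel n \<Phi> A Q"
  shows "echelon_kernel n \<Phi> A Q'"
  unfolding echelon_kernel_def
proof (intro conjI allI ballI impI)
  show A: "A \<subseteq> {..<n}" by (rule echelon_kernelD(1)[OF ker])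
  show "Q' i l = (if i = l then 1 else 0)" if "i < n" "l < n" "i \<in> A \<or> l \<notin> A" for i l
    using echelon_kernelD(2)[OF ker that] assms(2) that by simp
  show "\<phi> (\<lambda>i. Q' i l) = 0" if "l \<in> A" "\<phi> \<in> \<Phi>" for l \<phi>
  proof -
    have "\<phi> (\<lambda>i. Q' i l) = \<phi> (\<lambda>i. Q i l)"
      by (rule linear_functional_cong[OF assms(1)[OF that(2)]]) (use assms(2) A that in blast)
    then show ?thesis using bspec[OF echelon_kernelD(3)[OF ker that(1)] that(2)] by simp
  qed
  show "y i = 0" if "\<forall>i\<in>A. y i = 0" "\<forall>\<phi>\<in>\<Phi>. \<phi> y = 0" "i < n" for y i
    using echelon_kernelD(4)[OF ker that(1,2)] that(3) by simp
qed

lemma echelon_kernel_keep: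
  assumes "echelon_kernel n \<Phi> A Q" "\<forall>l\<in>A. \<phi> (\<lambda>i. Q i l) = 0"
  shows "echelon_kernel n (insert \<phi> \<Phi>) A Q"
  using assms unfolding echelon_kernel_def by simp

text \<open>
  Here \<open>u l\<close> is the value of the new functional at the column \<open>l\<close>, and \<open>k\<close> is the pivot.  The pivot
  column is replaced by a unit vector, so that the final matrix can serve as a change of variables.
\<close>

definition eliminate ::
  "nat set \<Rightarrow> nat \<Rightarrow> (nat \<Rightarrow> complex) \<Rightarrow> (nat \<Rightarrow> nat \<Rightarrow> complex) \<Rightarrow> nat \<Rightarrow> nat \<Rightarrow> complex" where
  "eliminate A k u Q i l =
     (if l = k then if i = k then 1 else 0
      else if l \<in> A then Q i l - u l / u k * Q i k else Q i l)"

text \<open>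
  For the condition on coordinates, let \<open>y\<close> be killed by all functionals and vanish on \<open>A - {k}\<close>.  Then
  \<open>y - y\<^sub>k Q\<^sub>k\<close> is killed by the old functionals and vanishes on \<open>A\<close>, so it is zero; applying \<open>\<phi>\<close> to it gives
  \<open>y\<^sub>k u\<^sub>k = 0\<close>.
\<close>

lemma echelon_kernel_eliminate:
  assumes ker: "echelon_kernel n \<Phi> A Q"
    and lin: "\<forall>\<psi>\<in>insert \<phi> \<Phi>. linear_functional n \<psi>"
    and k: "k \<in> A" "u k \<noteq> 0" and u: "\<And>l. l \<in> A \<Longrightarrow> u l = \<phi> (\<lambda>i. Q i l)"
  shows "echelon_kernel n (insert \<phi> \<Phi>) (A - {k}) (eliminate A k u Q)"
proof -
  have A: "A \<subseteq> {..<n}"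
    and Q: "\<And>i l. i < n \<Longrightarrow> l < n \<Longrightarrow> i \<in> A \<or> l \<notin> A \<Longrightarrow> Q i l = (if i = l then 1 else 0)"
    and kill: "\<And>l \<psi>. l \<in> A \<Longrightarrow> \<psi> \<in> \<Phi> \<Longrightarrow> \<psi> (\<lambda>i. Q i l) = 0"
    and ind: "\<And>y. (\<forall>i\<in>A. y i = 0) \<Longrightarrow> (\<forall>\<psi>\<in>\<Phi>. \<psi> y = 0) \<Longrightarrow> \<forall>i<n. y i = 0"
    using ker by (auto simp: echelon_kernel_def)
  have sub: "\<psi> (\<lambda>i. y i - c * z i) = \<psi> y - c * \<psi> z" if "\<psi> \<in> insert \<phi> \<Phi>" for \<psi> y z c
    using lin that by (blast intro: linear_functional_diff)
  have "eliminate A k u Q i l = (if i = l then 1 else 0)"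
    if "i < n" "l < n" "i \<in> A - {k} \<or> l \<notin> A - {k}" for i l
    using that k A Q[of i l] Q[of i k] by (auto simp: eliminate_def)
  moreover have "\<psi> (\<lambda>i. eliminate A k u Q i l) = 0" if l: "l \<in> A - {k}" and \<psi>: "\<psi> \<in> insert \<phi> \<Phi>" for l \<psi>
  proof -
    have "\<psi> (\<lambda>i. eliminate A k u Q i l) = \<psi> (\<lambda>i. Q i l) - u l / u k * \<psi> (\<lambda>i. Q i k)"
      using l sub[OF \<psi>, of "\<lambda>i. Q i l" "u l / u k" "\<lambda>i. Q i k"] by (simp add: eliminate_def)
    moreover have "\<psi> (\<lambda>i. Q i l) = 0 \<and> \<psi> (\<lambda>i. Q i k) = 0 \<or> \<psi> = \<phi>"
      using l \<psi> k kill[of l \<psi>] kill[of k \<psi>] by blast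
    ultimately show ?thesis using l k u[of l] u[of k] by auto
  qed
  moreover have "\<forall>i<n. y i = 0"
    if y: "\<forall>i\<in>A - {k}. y i = 0" and zero: "\<forall>\<psi>\<in>insert \<phi> \<Phi>. \<psi> y = 0" for y
  proof -
    let ?z = "\<lambda>i. y i - y k * Q i k"
    have "\<forall>i\<in>A. ?z i = 0"
    proof
      fix i assume "i \<in> A"
      then show "?z i = 0" using y k A Q[of i k] by (cases "i = k") auto
    qed
    moreover have "\<forall>\<psi>\<in>\<Phi>. \<psi> ?z = 0"
    proof
      fix \<psi> assume "\<psi> \<in> \<Phi>"
      then show "\<psi> ?z = 0"
        using sub[of \<psi> y "y k" "\<lambda>i. Q i k"] bspec[OF zero, of \<psi>] kill[OF k(1), of \<psi>] by simp
    qed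
    ultimately have z: "\<forall>i<n. ?z i = 0" by (rule ind)
    have "\<phi> ?z = 0" by (rule linear_functional_zero[OF _ z]) (use lin in simp)
    moreover have "\<phi> ?z = \<phi> y - y k * \<phi> (\<lambda>i. Q i k)" by (rule sub) simp
    ultimately have "y k = 0" using zero k u by simp
    then show ?thesis using z by simp
  qed
  ultimately show ?thesis using A by (auto simp: echelon_kernel_def)
qed


section \<open>Degeneracy and directional derivatives\<close>

definition dir_deriv :: "nat \<Rightarrow> cpoly \<Rightarrow> (nat \<Rightarrow> complex) \<Rightarrow> cpoly" where
  "dir_deriv n f y = (\<Sum>i<n. const (y i) * partial i f)"

text \<open>
  The chain rule once more: the derivative of \<open>f(Py)\<close> by \<open>y\<^sub>k\<close> is the derivative of \<open>f\<close> along the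
  column \<open>k\<close> of \<open>P\<close>.
\<close>

lemma partial_linear_subst_dir_deriv:
  assumes "k < n"
  shows "partial k (linear_subst n P f) = linear_subst n P (dir_deriv n f (\<lambda>i. P $$ (i, k)))"
  using partial_linear_subst[OF assms]
  by (simp add: dir_deriv_def linear_subst_sum linear_subst_mult linear_subst_const)

lemma vars_iff: "i \<in> vars f \<longleftrightarrow> (\<exists>m\<in>Poly_Mapping.keys f. Poly_Mapping.lookup m i > 0)"
  by (auto simp: vars_def in_keys_iff)

lemma vars_add: "vars (f + g) \<subseteq> vars f \<union> vars g"
  unfolding vars_def using keys_add[of f g] by blast

lemma vars_sum:
  assumes "\<And>i. i \<in> I \<Longrightarrow> vars (h i) \<subseteq> X"
  shows "vars (sum h I) \<subseteq> X"
  using assms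
proof (induction I rule: infinite_finite_induct)
  case (insert i I)
  then have "vars (h i) \<subseteq> X" "vars (sum h I) \<subseteq> X" by simp_all
  then show ?case using insert.hyps vars_add[of "h i" "sum h I"] by auto
qed (simp_all add: vars_def)

lemma vars_partial: "vars (partial i f) \<subseteq> vars f"
proof
  fix j assume "j \<in> vars (partial i f)"
  then obtain m where m: "Poly_Mapping.lookup (partial i f) m \<noteq> 0" "Poly_Mapping.lookup m j > 0"
    by (auto simp: vars_iff in_keys_iff)
  then have "m + Poly_Mapping.single i 1 \<in> Poly_Mapping.keys f"
    by (simp add: lookup_partial in_keys_iff)
  moreover have "Poly_Mapping.lookup (m + Poly_Mapping.single i 1) j > 0"
    using m(2) by (simp add: lookup_add)
  ultimately show "j \<in> vars f" unfolding vars_iff by blast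
qed

lemma vars_const_mult: "vars (const c * f) \<subseteq> vars f"
  by (auto simp: vars_def in_keys_iff)

lemma keys_add_nat:
  fixes m m' :: "nat \<Rightarrow>\<^sub>0 nat"
  shows "Poly_Mapping.keys (m + m') = Poly_Mapping.keys m \<union> Poly_Mapping.keys m'"
  by (auto simp: in_keys_iff lookup_add)

lemma vars_mult: "vars (p * q) \<subseteq> vars p \<union> vars q"
proof
  fix i assume "i \<in> vars (p * q)"
  then obtain m where m: "m \<in> Poly_Mapping.keys (p * q)" "i \<in> Poly_Mapping.keys m"
    by (auto simp: vars_def)
  then obtain a b where "m = a + b" "a \<in> Poly_Mapping.keys p" "b \<in> Poly_Mapping.keys q"
    using keys_mult[of p q] by blast
  then show "i \<in> vars p \<union> vars q" using m(2) by (auto simp: vars_def keys_add_nat)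
qed

lemma vars_power_subset: "vars (p ^ e) \<subseteq> vars p"
proof (induction e)
  case (Suc e)
  then show ?case using vars_mult[of p "p ^ e"] by auto
qed (simp add: vars_def)

lemma vars_prod_subset: "(\<And>i. i \<in> I \<Longrightarrow> vars (h i) \<subseteq> X) \<Longrightarrow> vars (prod h I) \<subseteq> X"
proof (induction I rule: infinite_finite_induct)
  case (insert i I)
  then have "vars (h i) \<subseteq> X" "vars (prod h I) \<subseteq> X" by simp_all
  then show ?case using insert.hyps vars_mult[of "h i" "prod h I"] by auto
qed (simp_all add: vars_def)

lemma vars_row_form: "vars (row_form n P i) \<subseteq> {..<n}"
  unfolding row_form_def
  by (rule vars_sum) (auto simp: vars_def var_def in_keys_iff lookup_single when_def split: if_splits)

lemma vars_linear_subst: "vars (linear_subst n P p) \<subseteq> {..<n}"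
  unfolding linear_subst_row_form
proof (rule vars_sum)
  fix m
  have "vars (\<Prod>i<n. row_form n P i ^ Poly_Mapping.lookup m i) \<subseteq> {..<n}"
    using vars_power_subset vars_row_form by (intro vars_prod_subset) blast
  then show "vars (const (Poly_Mapping.lookup p m) * (\<Prod>i<n. row_form n P i ^ Poly_Mapping.lookup m i)) \<subseteq> {..<n}"
    using vars_const_mult by blast
qed

lemma vars_dir_deriv: "vars (dir_deriv n f y) \<subseteq> vars f"
  unfolding dir_deriv_def
  by (rule vars_sum) (use vars_partial vars_const_mult in blast)

lemma dir_deriv_cong: "(\<And>i. i < n \<Longrightarrow> y i = z i) \<Longrightarrow> dir_deriv n f y = dir_deriv n f z"
  unfolding dir_deriv_def by (intro sum.cong) auto

text \<open>
  If \<open>f(Py)\<close> does not involve \<open>y\<^sub>k\<close>, then by injectivity of the substitution the derivative of \<open>f\<close> along the column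
  \<open>k\<close> of \<open>P\<close> vanishes, and no column of an invertible matrix is zero.
\<close>

lemma nondegenerate_if_independent:
  assumes f: "vars f \<subseteq> {..<n}"
    and indep: "\<And>y. dir_deriv n f y = 0 \<Longrightarrow> \<forall>i<n. y i = 0"
  shows "nondegenerate n f"
proof
  assume "degenerate n f"
  then obtain P k where P: "P \<in> carrier_mat n n" "invertible_mat P" and k: "k < n"
    and free: "k \<notin> vars (linear_subst n P f)"
    by (auto simp: degenerate_def)
  have "linear_subst n P (dir_deriv n f (\<lambda>i. P $$ (i, k))) = 0"
    using not_in_vars_imp_partial_eq_0[OF free] partial_linear_subst_dir_deriv[OF k] by simp
  then have "dir_deriv n f (\<lambda>i. P $$ (i, k)) = 0"
    using linear_subst_eq_0_imp[OF P] vars_dir_deriv f by blast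
  then have col: "P $$ (i, k) = 0" if "i < n" for i using indep that by blast
  obtain R where "inverts_mat R P" using P(2) by (auto simp: invertible_mat_def)
  then have RP: "R * P = 1\<^sub>m (dim_row R)" by (simp add: inverts_mat_def)
  then have dim: "dim_row R = n" using P(1) by (metis carrier_matD(2) index_mult_mat(3) index_one_mat(3))
  have "(R * P) $$ (k, k) = 0"
    using P(1) k col dim by (auto simp: scalar_prod_def intro!: sum.neutral)
  then show False using RP k dim by simp
qed

text \<open>
  The columns in \<open>A\<close> express the partial derivatives with indices in \<open>A\<close> by those with indices
  outside, and the latter are independent because an element of the kernel that vanishes on \<open>A\<close> is zero.
\<close>

lemma partials_dim_echelon_kernel:
  assumes rel: "\<And>y. (\<forall>\<phi>\<in>\<Phi>. \<phi> y = 0) \<longleftrightarrow> dir_deriv n f y = 0"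
    and ker: "echelon_kernel n \<Phi> A Q"
  shows "partials_dim n f = n - card A"
proof -
  let ?J = "{..<n} - A" and ?d = "\<lambda>i. partial i f"
  have A: "A \<subseteq> {..<n}" and finA: "finite A"
    using ker by (auto simp: echelon_kernel_def intro: finite_subset)
  have ind: "\<And>y. (\<forall>i\<in>A. y i = 0) \<Longrightarrow> (\<forall>\<phi>\<in>\<Phi>. \<phi> y = 0) \<Longrightarrow> \<forall>i<n. y i = 0"
    using ker by (auto simp: echelon_kernel_def)
  have indep: "\<forall>i\<in>?J. u i = 0" if "(\<Sum>i\<in>?J. const (u i) * ?d i) = 0" for u
  proof -
    let ?y = "\<lambda>i. if i \<in> ?J then u i else 0"
    have "dir_deriv n f ?y = (\<Sum>i\<in>?J. const (u i) * ?d i)"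
      unfolding dir_deriv_def by (rule sum.mono_neutral_cong_right) auto
    then have "\<forall>\<phi>\<in>\<Phi>. \<phi> ?y = 0" using rel[of ?y] that by simp
    moreover have "\<forall>i\<in>A. ?y i = 0" by simp
    ultimately have "\<forall>i<n. ?y i = 0" by (intro ind)
    then show ?thesis by (metis DiffD1 lessThan_iff)
  qed
  have "finite ?J" by simp
  note B = independent_family[OF this indep]
  have "?d l \<in> cpoly.span (?d ` ?J)" if l: "l < n" for l
  proof (cases "l \<in> A")
    case True
    then have "dir_deriv n f (\<lambda>i. Q i l) = 0"
      using ker rel by (simp add: echelon_kernel_def)
    then have "0 = const (Q l l) * ?d l + (\<Sum>i\<in>{..<n} - {l}. const (Q i l) * ?d i)"
      using l by (simp add: dir_deriv_def sum.remove)
    also have "const (Q l l) * ?d l = ?d l"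
      using ker True l by (simp add: echelon_kernel_def)
    also have "(\<Sum>i\<in>{..<n} - {l}. const (Q i l) * ?d i) = (\<Sum>i\<in>?J. const (Q i l) * ?d i)"
      using ker True A by (intro sum.mono_neutral_right) (auto simp: echelon_kernel_def subset_iff)
    finally have "?d l = - (\<Sum>i\<in>?J. scale_poly (Q i l) (?d i))"
      by (simp add: scale_poly_def eq_neg_iff_add_eq_0)
    moreover have "(\<Sum>i\<in>?J. scale_poly (Q i l) (?d i)) \<in> cpoly.span (?d ` ?J)"
      by (intro cpoly.span_sum cpoly.span_scale cpoly.span_base imageI)
    ultimately show ?thesis by (simp add: cpoly.span_neg)
  qed (use l in \<open>auto intro: cpoly.span_base\<close>)
  then have "cpoly.span (?d ` {..<n}) = cpoly.span (?d ` ?J)"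
    by (intro cpoly.span_eq[THEN iffD2]) (auto intro: cpoly.span_base)
  then have "partials_dim n f = card (?d ` ?J)"
    unfolding partials_dim_def using B(1) by (simp add: cpoly.dim_eq_card_independent)
  also have "\<dots> = card ?J" using B(2) by (rule card_image)
  also have "\<dots> = n - card A" using A finA by (simp add: card_Diff_subset)
  finally show ?thesis .
qed


section \<open>The reduced polynomial\<close>

text \<open>
  Setting all variables with index at least \<open>r\<close> to zero.
\<close>

definition restrict_vars :: "nat \<Rightarrow> cpoly \<Rightarrow> cpoly" where
  "restrict_vars r f = (\<Sum>m\<in>Poly_Mapping.keys f.
     if Poly_Mapping.keys m \<subseteq> {..<r} then Poly_Mapping.single m (Poly_Mapping.lookup f m) else 0)"

lemma restrict_vars_single:
  "restrict_vars r (Poly_Mapping.single m a) =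
     (if Poly_Mapping.keys m \<subseteq> {..<r} then Poly_Mapping.single m a else 0)"
  unfolding restrict_vars_def
  by (rule sum_keys_single[where
      F = "\<lambda>m a. if Poly_Mapping.keys m \<subseteq> {..<r} then Poly_Mapping.single m a else 0"]) simp

lemma restrict_vars_add: "restrict_vars r (f + g) = restrict_vars r f + restrict_vars r g"
  unfolding restrict_vars_def
  by (rule sum_keys_add[where
      F = "\<lambda>m a. if Poly_Mapping.keys m \<subseteq> {..<r} then Poly_Mapping.single m a else 0"])
    (simp_all add: single_add)

lemma restrict_vars_0 [simp]: "restrict_vars r 0 = 0"
  by (simp add: restrict_vars_def)

lemma restrict_vars_sum: "restrict_vars r (sum h I) = (\<Sum>j\<in>I. restrict_vars r (h j))"
  by (induction I rule: infinite_finite_induct) (simp_all add: restrict_vars_add)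

lemma restrict_vars_const: "restrict_vars r (const c) = const c"
  by (simp add: const_def restrict_vars_single)

lemma restrict_vars_var: "restrict_vars r (var i) = (if i < r then var i else 0)"
  by (simp add: var_def restrict_vars_single)

lemma restrict_vars_mult: "restrict_vars r (f * g) = restrict_vars r f * restrict_vars r g"
proof (induction f rule: cpoly_induct)
  case (single m a)
  show ?case
  proof (induction g rule: cpoly_induct)
    case (single m' b)
    show ?case by (simp add: mult_single restrict_vars_single keys_add_nat)
  qed (simp add: restrict_vars_add distrib_left)
qed (simp add: restrict_vars_add distrib_right)

lemma restrict_vars_power: "restrict_vars r (f ^ e) = restrict_vars r f ^ e"
  using restrict_vars_const[of r 1] by (induction e) (simp_all add: restrict_vars_mult)

lemma restrict_vars_prod: "restrict_vars r (prod h I) = (\<Prod>j\<in>I. restrict_vars r (h j))"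
  using restrict_vars_const[of r 1]
  by (induction I rule: infinite_finite_induct) (simp_all add: restrict_vars_mult)

lemma restrict_vars_id:
  assumes "vars f \<subseteq> {..<r}"
  shows "restrict_vars r f = f"
proof -
  have "restrict_vars r f = (\<Sum>m\<in>Poly_Mapping.keys f. Poly_Mapping.single m (Poly_Mapping.lookup f m))"
    unfolding restrict_vars_def using assms by (intro sum.cong) (auto simp: vars_def)
  then show ?thesis by (simp add: poly_as_sum_of_monomials)
qed

definition rename_monomial :: "nat \<Rightarrow> (nat \<Rightarrow> nat) \<Rightarrow> (nat \<Rightarrow>\<^sub>0 nat) \<Rightarrow> nat \<Rightarrow>\<^sub>0 nat" where
  "rename_monomial r \<pi> m = (\<Sum>j<r. Poly_Mapping.single j (Poly_Mapping.lookup m (\<pi> j)))"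

lemma lookup_rename_monomial:
  "Poly_Mapping.lookup (rename_monomial r \<pi> m) j = (if j < r then Poly_Mapping.lookup m (\<pi> j) else 0)"
  by (simp add: rename_monomial_def lookup_sum lookup_single when_def)

definition kept_terms :: "nat set \<Rightarrow> cpoly \<Rightarrow> (nat \<Rightarrow>\<^sub>0 nat) set" where
  "kept_terms A f = {m \<in> Poly_Mapping.keys f. Poly_Mapping.keys m \<inter> A = {}}"

definition reduced_poly :: "nat \<Rightarrow> (nat \<Rightarrow> nat) \<Rightarrow> nat set \<Rightarrow> cpoly \<Rightarrow> cpoly" where
  "reduced_poly r \<pi> A f = (\<Sum>m\<in>kept_terms A f. Poly_Mapping.single (rename_monomial r \<pi> m) (Poly_Mapping.lookup f m))"

text \<open>
  The situation when all rows are eliminated.  The permutation \<open>\<pi>\<close> lists the \<open>r\<close> retired variables first.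
\<close>

locale reduction =
  fixes n :: nat and f :: cpoly and \<Phi> :: "((nat \<Rightarrow> complex) \<Rightarrow> complex) set" and A :: "nat set"
    and Q :: "nat \<Rightarrow> nat \<Rightarrow> complex" and \<pi> :: "nat \<Rightarrow> nat" and r :: nat
  assumes vars_f: "vars f \<subseteq> {..<n}"
    and functionals: "\<And>y. (\<forall>\<phi>\<in>\<Phi>. \<phi> y = 0) \<longleftrightarrow> dir_deriv n f y = 0"
    and kernel: "echelon_kernel n \<Phi> A Q"
    and bij: "bij_betw \<pi> {..<n} {..<n}"
    and r_le: "r \<le> n"
    and pivots: "\<pi> ` {..<r} = {..<n} - A"
begin

definition subst_mat :: "complex mat" where
  "subst_mat = mat n n (\<lambda>(i, j). Q i (\<pi> j))"

abbreviation "g \<equiv> reduced_poly r \<pi> A f"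

lemma A_subset: "A \<subseteq> {..<n}"
  by (rule echelon_kernelD(1)[OF kernel])

lemma Q_unit: "i < n \<Longrightarrow> l < n \<Longrightarrow> i \<in> A \<or> l \<notin> A \<Longrightarrow> Q i l = (if i = l then 1 else 0)"
  by (rule echelon_kernelD(2)[OF kernel])

lemma Q_kernel: "l \<in> A \<Longrightarrow> dir_deriv n f (\<lambda>i. Q i l) = 0"
  using echelon_kernelD(3)[OF kernel] functionals by blast

lemma pivots_independent: "\<forall>i\<in>A. y i = 0 \<Longrightarrow> dir_deriv n f y = 0 \<Longrightarrow> \<forall>i<n. y i = 0"
  using echelon_kernelD(4)[OF kernel] functionals by blast

lemma \<pi>_less: "j < n \<Longrightarrow> \<pi> j < n"
  using bij by (auto simp: bij_betw_def)

lemma \<pi>_inj: "inj_on \<pi> {..<n}"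
  using bij by (simp add: bij_betw_def)

lemma \<pi>_pivot_iff: "j < n \<Longrightarrow> \<pi> j \<in> A \<longleftrightarrow> r \<le> j"
proof
  assume j: "j < n"
  show "\<pi> j \<in> A" if "r \<le> j"
  proof (rule ccontr)
    assume "\<pi> j \<notin> A"
    then have "\<pi> j \<in> \<pi> ` {..<r}" using j \<pi>_less pivots by simp
    then obtain j' where "j' < r" "\<pi> j = \<pi> j'" by auto
    then show False using inj_onD[OF \<pi>_inj, of j j'] j r_le that by simp
  qed
  show "r \<le> j" if "\<pi> j \<in> A" using that pivots by (metis DiffD2 image_eqI lessThan_iff not_less)
qed

lemma r_eq: "r = n - card A"
proof -
  have "card (\<pi> ` {..<r}) = r"
    using \<pi>_inj r_le by (subst card_image) (auto intro: inj_on_subset)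
  moreover have "card ({..<n} - A) = n - card A"
    using A_subset by (simp add: card_Diff_subset finite_subset)
  ultimately show ?thesis using pivots by simp
qed

lemma subst_mat_carrier: "subst_mat \<in> carrier_mat n n"
  by (simp add: subst_mat_def)

text \<open>
  The matrix \<open>Q\<close> is the identity plus a part \<open>N\<close> that maps the span of the \<open>e\<^sub>l\<close> with \<open>l \<in> A\<close> to that of the others and
  the others to zero.  So \<open>N\<^sup>2 = 0\<close> and the inverse of \<open>Q\<close> is \<open>1 - N = 2 - Q\<close>.
\<close>

lemma Q_involution:
  assumes "i < n" "l < n"
  shows "(\<Sum>j<n. Q i j * ((if j = l then 2 else 0) - Q j l)) = (if i = l then 1 else 0)"
proof -
  have "(\<Sum>j<n. Q i j * Q j l) = 2 * Q i l - (if i = l then 1 else 0)"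
  proof (cases "l \<in> A")
    case False
    then have "(\<Sum>j<n. Q i j * Q j l) = (\<Sum>j<n. if j = l then Q i l else 0)"
      using assms Q_unit by (intro sum.cong) auto
    then show ?thesis using False assms Q_unit[of i l] by simp
  next
    case True
    have row: "Q i j * Q j l = (if j = l then Q i l else if j = i then Q i l else 0)" if "j < n" for j
      using that True assms Q_unit[of i j] Q_unit[of j l] Q_unit[of i l] by (cases "j \<in> A") auto
    have "(\<Sum>j<n. Q i j * Q j l) = (\<Sum>j<n. if j = l then Q i l else if j = i then Q i l else 0)"
      using row by (intro sum.cong) auto
    also have "\<dots> = (\<Sum>j\<in>{i, l}. Q i l)"
      using assms by (intro sum.mono_neutral_cong_right) auto
    finally show ?thesis using True assms Q_unit[of i l] by auto
  qed
  moreover have "(\<Sum>j<n. Q i j * ((if j = l then 2 else 0) - Q j l)) =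
      (\<Sum>j<n. (if j = l then 2 * Q i l else 0) - Q i j * Q j l)"
    by (intro sum.cong) (auto simp: right_diff_distrib)
  ultimately show ?thesis using assms(2) by (simp add: sum_subtractf)
qed

lemma invertible_subst_mat: "invertible_mat subst_mat"
proof -
  define R where "R = mat n n (\<lambda>(j, l). (if \<pi> j = l then 2 else 0) - Q (\<pi> j) l)"
  have "subst_mat * R = 1\<^sub>m n"
  proof (rule eq_matI)
    fix i l assume il: "i < dim_row (1\<^sub>m n :: complex mat)" "l < dim_col (1\<^sub>m n :: complex mat)"
    then have "(subst_mat * R) $$ (i, l) = (\<Sum>j<n. Q i (\<pi> j) * ((if \<pi> j = l then 2 else 0) - Q (\<pi> j) l))"
      by (simp add: subst_mat_def R_def scalar_prod_def atLeast0LessThan)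
    also have "\<dots> = (\<Sum>j<n. Q i j * ((if j = l then 2 else 0) - Q j l))"
      by (rule sum.reindex_bij_betw[OF bij])
    finally show "(subst_mat * R) $$ (i, l) = 1\<^sub>m n $$ (i, l)"
      using il Q_involution by simp
  qed (simp_all add: subst_mat_def R_def)
  moreover then have "R * subst_mat = 1\<^sub>m n"
    by (rule mat_mult_left_right_inverse[rotated 2]) (simp_all add: subst_mat_def R_def)
  ultimately show ?thesis
    by (auto simp: invertible_mat_def inverts_mat_def subst_mat_def R_def)
qed

lemma dir_deriv_subst_mat: "j < n \<Longrightarrow> dir_deriv n f (\<lambda>i. subst_mat $$ (i, j)) = dir_deriv n f (\<lambda>i. Q i (\<pi> j))"
  by (rule dir_deriv_cong) (simp add: subst_mat_def)

text \<open>
  The last \<open>n - r\<close> columns of the substitution are in the kernel, so the derivatives of \<open>f(Py)\<close> by the last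
  variables vanish; over the complex numbers these variables then do not occur.
\<close>

lemma vars_linear_subst_subst_mat: "vars (linear_subst n subst_mat f) \<subseteq> {..<r}"
proof
  fix j assume j: "j \<in> vars (linear_subst n subst_mat f)"
  then have "j < n" using vars_linear_subst by blast
  show "j \<in> {..<r}"
  proof (rule ccontr)
    assume "j \<notin> {..<r}"
    then have "\<pi> j \<in> A" using \<pi>_pivot_iff \<open>j < n\<close> by simp
    then have "partial j (linear_subst n subst_mat f) = 0"
      using \<open>j < n\<close> by (simp add: partial_linear_subst_dir_deriv dir_deriv_subst_mat Q_kernel)
    then show False using j partial_eq_0_imp_not_in_vars by blast
  qed
qed

lemma restrict_row_form:
  assumes "j < n"
  shows "restrict_vars r (row_form n subst_mat (\<pi> j)) = (if j < r then var j else 0)"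
proof -
  have "restrict_vars r (row_form n subst_mat (\<pi> j)) = (\<Sum>k<n. if k = j \<and> j < r then var j else 0)"
    unfolding row_form_def restrict_vars_sum
  proof (rule sum.cong[OF refl])
    fix k assume k: "k \<in> {..<n}"
    have "\<pi> j = \<pi> k \<longleftrightarrow> j = k"
      using assms k by (intro inj_on_eq_iff[OF \<pi>_inj]) auto
    moreover have "\<pi> k \<notin> A" if "k < r" using that k \<pi>_pivot_iff[of k] by simp
    ultimately have Q: "Q (\<pi> j) (\<pi> k) = (if j = k then 1 else 0)" if "k < r"
      using Q_unit[of "\<pi> j" "\<pi> k"] that assms k \<pi>_less by simp
    have "restrict_vars r (const (subst_mat $$ (\<pi> j, k)) * var k) =
        (if k < r then const (Q (\<pi> j) (\<pi> k)) * var k else 0)"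
      using assms k \<pi>_less
      by (simp add: restrict_vars_mult restrict_vars_const restrict_vars_var subst_mat_def)
    also have "\<dots> = (if k = j \<and> j < r then var j else 0)"
      using Q by (cases "k = j"; cases "k < r") simp_all
    finally show "restrict_vars r (const (subst_mat $$ (\<pi> j, k)) * var k) = (if k = j \<and> j < r then var j else 0)" .
  qed
  also have "\<dots> = (if j < r then var j else 0)" using assms by simp
  finally show ?thesis .
qed

text \<open>
  With the last variables set to zero, the linear form of a variable in \<open>A\<close> vanishes and that of
  \<open>\<pi> j\<close> with \<open>j < r\<close> is \<open>y\<^sub>j\<close>.  So a monomial either disappears or is renamed.
\<close>

lemma restrict_prod_row_form:
  assumes "m \<in> Poly_Mapping.keys f"
  shows "(\<Prod>i<n. restrict_vars r (row_form n subst_mat i) ^ Poly_Mapping.lookup m i) =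
    (if m \<in> kept_terms A f then Poly_Mapping.single (rename_monomial r \<pi> m) 1 else 0)"
proof -
  let ?h = "\<lambda>j. (if j < r then var j else 0) ^ Poly_Mapping.lookup m (\<pi> j)"
  have "(\<Prod>i<n. restrict_vars r (row_form n subst_mat i) ^ Poly_Mapping.lookup m i) =
      (\<Prod>j<n. restrict_vars r (row_form n subst_mat (\<pi> j)) ^ Poly_Mapping.lookup m (\<pi> j))"
    by (rule prod.reindex_bij_betw[OF bij, symmetric])
  also have "\<dots> = prod ?h {..<n}"
    by (rule prod.cong) (simp_all add: restrict_row_form)
  also have "\<dots> = (if m \<in> kept_terms A f then Poly_Mapping.single (rename_monomial r \<pi> m) 1 else 0)"
  proof (cases "m \<in> kept_terms A f")
    case True
    have "prod ?h {..<n} = prod ?h {..<r}"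
    proof (rule prod.mono_neutral_right)
      show "\<forall>j\<in>{..<n} - {..<r}. ?h j = 1"
      proof
        fix j assume j: "j \<in> {..<n} - {..<r}"
        then have "\<pi> j \<in> A" using \<pi>_pivot_iff by auto
        then have "Poly_Mapping.lookup m (\<pi> j) = 0"
          using True by (auto simp: kept_terms_def in_keys_iff disjoint_iff)
        then show "?h j = 1" by simp
      qed
    qed (use r_le in auto)
    also have "\<dots> = (\<Prod>j<r. Poly_Mapping.single (Poly_Mapping.single j (Poly_Mapping.lookup m (\<pi> j))) 1)"
      by (rule prod.cong) (simp_all add: var_power)
    finally show ?thesis using True by (simp add: prod_single_1 rename_monomial_def)
  next
    case False
    then obtain i where i: "i \<in> Poly_Mapping.keys m" "i \<in> A"
      using assms by (auto simp: kept_terms_def)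
    then have "i \<in> \<pi> ` {..<n}" using A_subset bij_betw_imp_surj_on[OF bij] by blast
    then obtain j where j: "j < n" "i = \<pi> j" by blast
    then have "?h j = 0" using i \<pi>_pivot_iff by (auto simp: in_keys_iff)
    then have "prod ?h {..<n} = 0" using j by (meson finite_lessThan lessThan_iff prod_zero)
    then show ?thesis using False by simp
  qed
  finally show ?thesis .
qed

text \<open>
  Since \<open>f(Py)\<close> does not involve the last variables, setting them to zero does not change it.
\<close>

lemma linear_subst_subst_mat: "linear_subst n subst_mat f = g"
proof -
  have "linear_subst n subst_mat f = restrict_vars r (linear_subst n subst_mat f)"
    using restrict_vars_id vars_linear_subst_subst_mat by simp
  also have "\<dots> = (\<Sum>m\<in>Poly_Mapping.keys f. const (Poly_Mapping.lookup f m) *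
      (if m \<in> kept_terms A f then Poly_Mapping.single (rename_monomial r \<pi> m) 1 else 0))"
    by (simp add: linear_subst_row_form restrict_vars_sum restrict_vars_mult restrict_vars_const
        restrict_vars_prod restrict_vars_power restrict_prod_row_form)
  also have "\<dots> = g"
    unfolding reduced_poly_def
    by (rule sum.mono_neutral_cong_right) (auto simp: kept_terms_def const_mult_single)
  finally show ?thesis .
qed

lemma vars_g: "vars g \<subseteq> {..<r}"
  using vars_linear_subst_subst_mat linear_subst_subst_mat by simp

text \<open>
  The derivative of \<open>g\<close> by \<open>y\<^sub>j\<close> is the image of the derivative of \<open>f\<close> by the retired variable \<open>\<pi> j\<close>, so a
  relation between the former pulls back to a relation between the latter.
\<close>

lemma nondegenerate_g: "nondegenerate r g"
proof (rule nondegenerate_if_independent[OF vars_g])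
  fix y assume y: "dir_deriv r g y = 0"
  \<comment> \<open>The coefficients \<open>y\<close> as a vector of length \<open>n\<close> that is supported on the retired variables.\<close>
  define z where "z i = (\<Sum>j<r. if \<pi> j = i then y j else 0)" for i
  have z: "z (\<pi> j) = (if j < r then y j else 0)" if "j < n" for j
  proof -
    have "z (\<pi> j) = (\<Sum>k<r. if k = j then y j else 0)"
      unfolding z_def using that r_le inj_on_eq_iff[OF \<pi>_inj, of _ j] by (intro sum.cong) simp_all
    then show ?thesis by simp
  qed
  have col: "dir_deriv n f (\<lambda>i. subst_mat $$ (i, j)) = partial (\<pi> j) f" if "j < r" for j
  proof -
    have "j < n" using that r_le by simp
    have "\<pi> j \<notin> A" using \<pi>_pivot_iff[OF \<open>j < n\<close>] that by simp
    then have "Q i (\<pi> j) = (if i = \<pi> j then 1 else 0)" if "i < n" for i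
      using Q_unit[OF that \<pi>_less[OF \<open>j < n\<close>]] by simp
    then have "dir_deriv n f (\<lambda>i. subst_mat $$ (i, j)) = (\<Sum>i<n. if i = \<pi> j then partial (\<pi> j) f else 0)"
      unfolding dir_deriv_subst_mat[OF \<open>j < n\<close>] unfolding dir_deriv_def
      by (intro sum.cong) simp_all
    then show ?thesis using \<pi>_less \<open>j < n\<close> by simp
  qed
  have "dir_deriv n f z = (\<Sum>j<n. const (z (\<pi> j)) * partial (\<pi> j) f)"
    unfolding dir_deriv_def by (rule sum.reindex_bij_betw[OF bij, symmetric])
  also have "\<dots> = (\<Sum>j<r. const (y j) * partial (\<pi> j) f)"
    using r_le z by (intro sum.mono_neutral_cong_right) auto
  finally have "linear_subst n subst_mat (dir_deriv n f z) =
      (\<Sum>j<r. const (y j) * linear_subst n subst_mat (partial (\<pi> j) f))"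
    by (simp add: linear_subst_sum linear_subst_mult linear_subst_const)
  also have "\<dots> = dir_deriv r g y"
    unfolding dir_deriv_def
  proof (rule sum.cong[OF refl])
    fix j assume "j \<in> {..<r}"
    then show "const (y j) * linear_subst n subst_mat (partial (\<pi> j) f) = const (y j) * partial j g"
      using r_le col by (simp flip: linear_subst_subst_mat add: partial_linear_subst_dir_deriv)
  qed
  finally have "linear_subst n subst_mat (dir_deriv n f z) = 0" using y by simp
  then have "dir_deriv n f z = 0"
    using linear_subst_eq_0_imp[OF subst_mat_carrier invertible_subst_mat] vars_dir_deriv vars_f by blast
  moreover have "\<forall>i\<in>A. z i = 0"
  proof
    fix i assume "i \<in> A"
    then have "\<pi> j \<noteq> i" if "j < r" for j using \<pi>_pivot_iff[of j] that r_le by auto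
    then show "z i = 0" unfolding z_def by (intro sum.neutral) simp
  qed
  ultimately have zero: "\<forall>i<n. z i = 0" by (intro pivots_independent)
  show "\<forall>j<r. y j = 0"
  proof (intro allI impI)
    fix j assume j: "j < r"
    then have "z (\<pi> j) = 0" using zero \<pi>_less r_le by simp
    then show "y j = 0" using z[of j] j r_le by simp
  qed
qed

lemma degenerate_iff: "degenerate n f \<longleftrightarrow> r < n"
proof
  assume deg: "degenerate n f"
  show "r < n"
  proof (rule ccontr)
    assume "\<not> r < n"
    then have "r = n" using r_le by simp
    then have "{..<n} - A = {..<n}" using pivots bij_betw_imp_surj_on[OF bij] by metis
    then have "A = {}" using A_subset by blast
    then have "nondegenerate n f"
      by (intro nondegenerate_if_independent[OF vars_f] pivots_independent) simp_all
    then show False using deg by simp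
  qed
next
  assume "r < n"
  then show "degenerate n f"
    using subst_mat_carrier invertible_subst_mat vars_linear_subst_subst_mat unfolding degenerate_def by blast
qed

lemma reduces_to_g: "r < n \<Longrightarrow> reduces_to n f r subst_mat g"
  unfolding reduces_to_def
  using partials_dim_echelon_kernel[OF functionals kernel] r_eq subst_mat_carrier invertible_subst_mat
    linear_subst_subst_mat vars_g nondegenerate_g
  by simp

lemma inj_on_rename: "inj_on (rename_monomial r \<pi>) (kept_terms A f)"
proof (rule inj_onI)
  fix m m' assume m: "m \<in> kept_terms A f" "m' \<in> kept_terms A f"
    and eq: "rename_monomial r \<pi> m = rename_monomial r \<pi> m'"
  show "m = m'"
  proof (rule poly_mapping_eqI)
    fix i
    show "Poly_Mapping.lookup m i = Poly_Mapping.lookup m' i"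
    proof (cases "i \<in> {..<n} - A")
      case True
      then obtain j where "j < r" "i = \<pi> j" using pivots by blast
      then show ?thesis using arg_cong[OF eq, of "\<lambda>m. Poly_Mapping.lookup m j"]
        by (simp add: lookup_rename_monomial)
    next
      case False
      then have "i \<notin> Poly_Mapping.keys m" "i \<notin> Poly_Mapping.keys m'"
        using m vars_f by (auto simp: kept_terms_def vars_def)
      then show ?thesis by (simp add: in_keys_iff)
    qed
  qed
qed

lemma lookup_g:
  assumes "m \<in> kept_terms A f"
  shows "Poly_Mapping.lookup g (rename_monomial r \<pi> m) = Poly_Mapping.lookup f m"
proof -
  have "Poly_Mapping.lookup g (rename_monomial r \<pi> m) =
      (\<Sum>m'\<in>kept_terms A f. if m' = m then Poly_Mapping.lookup f m else 0)"
    unfolding reduced_poly_def lookup_sum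
    using assms inj_on_eq_iff[OF inj_on_rename] by (intro sum.cong) (auto simp: lookup_single when_def)
  also have "\<dots> = Poly_Mapping.lookup f m"
    using assms by (simp add: kept_terms_def)
  finally show ?thesis .
qed

lemma keys_g: "Poly_Mapping.keys g = rename_monomial r \<pi> ` kept_terms A f"
proof
  show "Poly_Mapping.keys g \<subseteq> rename_monomial r \<pi> ` kept_terms A f"
  proof
    fix m' assume "m' \<in> Poly_Mapping.keys g"
    then have "(\<Sum>m\<in>kept_terms A f. Poly_Mapping.lookup
        (Poly_Mapping.single (rename_monomial r \<pi> m) (Poly_Mapping.lookup f m)) m') \<noteq> 0"
      by (simp add: reduced_poly_def in_keys_iff lookup_sum)
    then obtain m where "m \<in> kept_terms A f" "rename_monomial r \<pi> m = m'"
      by (rule sum.not_neutral_contains_not_neutral) (auto simp: lookup_single when_def split: if_splits)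
    then show "m' \<in> rename_monomial r \<pi> ` kept_terms A f" by blast
  qed
  show "rename_monomial r \<pi> ` kept_terms A f \<subseteq> Poly_Mapping.keys g"
    using lookup_g by (auto simp: in_keys_iff kept_terms_def)
qed

end


section \<open>Weakest preconditions with costs\<close>

text \<open>
  Termination is included, and the postcondition sees the cost of the run.
\<close>

definition wp :: "com \<Rightarrow> (nat \<Rightarrow> state \<Rightarrow> bool) \<Rightarrow> state \<Rightarrow> bool" where
  "wp c R s \<longleftrightarrow> (\<exists>k s'. exec c s k s' \<and> R k s')"

lemma wp_mono: "wp c R s \<Longrightarrow> (\<And>k s'. R k s' \<Longrightarrow> R' k s') \<Longrightarrow> wp c R' s"
  by (auto simp: wp_def)

lemma wp_Skip: "R 0 s \<Longrightarrow> wp Skip R s"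
  unfolding wp_def by (blast intro: exec.intros)

lemma wp_SetInt: "R 0 (set_int s l (nval s e)) \<Longrightarrow> wp (SetInt l e) R s"
  unfolding wp_def by (blast intro: exec.intros)

lemma wp_SetZero: "R 0 (set_num s l 0) \<Longrightarrow> wp (SetZero l) R s"
  unfolding wp_def by (blast intro: exec.intros)

lemma wp_SetOne: "R 0 (set_num s l 1) \<Longrightarrow> wp (SetOne l) R s"
  unfolding wp_def by (blast intro: exec.intros)

lemma wp_Copy: "R 0 (set_num s l (get_num s l')) \<Longrightarrow> wp (Copy l l') R s"
  unfolding wp_def by (blast intro: exec.intros)

lemma wp_OfNat: "R 1 (set_num s l (of_nat (nval s e))) \<Longrightarrow> wp (OfNat l e) R s"
  unfolding wp_def by (blast intro: exec.intros)

lemma wp_Arith: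
  "(a = Divide \<Longrightarrow> get_num s l2 \<noteq> 0) \<Longrightarrow>
    R 1 (set_num s l (apply_arith a (get_num s l1) (get_num s l2))) \<Longrightarrow> wp (Arith l a l1 l2) R s"
  unfolding wp_def by (blast intro: exec.intros)

lemma wp_Seq: "wp c1 (\<lambda>k s'. wp c2 (\<lambda>k'. R (k + k')) s') s \<Longrightarrow> wp (Seq c1 c2) R s"
  unfolding wp_def by (blast intro: exec.intros)

lemma wp_If:
  "(bval s b \<Longrightarrow> wp c1 R s) \<Longrightarrow> (\<not> bval s b \<Longrightarrow> wp c2 R s) \<Longrightarrow> wp (If b c1 c2) R s"
  unfolding wp_def by (cases "bval s b") (blast intro: exec.intros)+

lemma wp_IfZero:
  "(get_num s l = 0 \<Longrightarrow> wp c1 (\<lambda>k. R (k + 1)) s) \<Longrightarrow>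
    (get_num s l \<noteq> 0 \<Longrightarrow> wp c2 (\<lambda>k. R (k + 1)) s) \<Longrightarrow> wp (IfZero l c1 c2) R s"
  unfolding wp_def by (cases "get_num s l = 0") (blast intro: exec.intros)+

lemmas wp_intros = wp_Skip wp_SetInt wp_SetZero wp_SetOne wp_Copy wp_OfNat wp_Arith wp_Seq wp_If wp_IfZero

text \<open>
  The invariant relates the state to the cost spent so far; the measure \<open>M\<close> ensures termination.
\<close>

lemma wp_While:
  fixes M :: "state \<Rightarrow> nat"
  assumes step: "\<And>k s. I k s \<Longrightarrow> bval s b \<Longrightarrow> wp c (\<lambda>k' s'. I (k + k') s' \<and> M s' < M s) s"
    and exit: "\<And>k s. I k s \<Longrightarrow> \<not> bval s b \<Longrightarrow> R k s"
    and init: "I 0 s"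
  shows "wp (While b c) R s"
proof -
  have "\<exists>k' s'. exec (While b c) s k' s' \<and> R (k + k') s'" if "I k s" for k s
    using that
  proof (induction "M s" arbitrary: k s rule: less_induct)
    case less
    show ?case
    proof (cases "bval s b")
      case True
      then obtain k1 s1 where 1: "exec c s k1 s1" "I (k + k1) s1" "M s1 < M s"
        using step[OF less.prems] by (auto simp: wp_def)
      then obtain k2 s2 where "exec (While b c) s1 k2 s2" "R (k + k1 + k2) s2"
        using less.hyps by blast
      then show ?thesis using exec.WhileTrue[OF True 1(1)] by (metis add.assoc)
    next
      case False
      then show ?thesis using exec.WhileFalse exit[OF less.prems] by (metis add_0_right)
    qed
  qed
  from this[OF init] show ?thesis by (simp add: wp_def)
qed

abbreviation V :: "string \<Rightarrow> nexp" where
  "V x \<equiv> NAt x []"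

definition BEq :: "nexp \<Rightarrow> nexp \<Rightarrow> bexp" where
  "BEq a b = BAnd (BNot (BLess a b)) (BNot (BLess b a))"

lemma bval_BEq [simp]: "bval s (BEq a b) \<longleftrightarrow> nval s a = nval s b"
  by (auto simp: BEq_def)

definition For :: "string \<Rightarrow> nexp \<Rightarrow> com \<Rightarrow> com" where
  "For x e c = Seq (SetInt (x, []) (NLit 0))
     (While (BLess (V x) e) (Seq c (SetInt (x, []) (NAdd (V x) (NLit 1)))))"

lemma ints_set_int:
  "ints (set_int s l v) y = (if y = fst l then (ints s y)(map (nval s) (snd l) := v) else ints s y)"
  by (simp add: set_int_def)

lemma nums_set_num:
  "nums (set_num s l v) y = (if y = fst l then (nums s y)(map (nval s) (snd l) := v) else nums s y)"
  by (simp add: set_num_def)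

lemma nums_set_int [simp]: "nums (set_int s l v) = nums s"
  by (simp add: set_int_def)

lemma ints_set_num [simp]: "ints (set_num s l v) = ints s"
  by (simp add: set_num_def)

lemma nval_set_num [simp]: "nval (set_num s l v) e = nval s e"
proof (induction e)
  case (NAt x es)
  then have "map (nval (set_num s l v)) es = map (nval s) es" by simp
  then show ?case by (simp only: nval.simps ints_set_num)
qed simp_all

lemmas state_simps = ints_set_int nums_set_num get_num_def

text \<open>
  The invariant is indexed by the counter and may depend on the cost spent so far.
  The body must leave the counter alone.
\<close>

lemma wp_For:
  assumes init: "I 0 0 (set_int s (x, []) 0)"
    and bound: "\<And>i k s. I i k s \<Longrightarrow> nval s e = N"
    and step: "\<And>i k s. i < N \<Longrightarrow> I i k s \<Longrightarrow> ints s x [] = i \<Longrightarrow>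
      wp c (\<lambda>k' s'. ints s' x [] = i \<and> I (Suc i) (k + k') (set_int s' (x, []) (Suc i))) s"
    and exit: "\<And>k s. I N k s \<Longrightarrow> R k s"
  shows "wp (For x e c) R s"
proof -
  define J where "J k s \<longleftrightarrow> ints s x [] \<le> N \<and> I (ints s x []) k s" for k s
  have "wp (While (BLess (V x) e) (Seq c (SetInt (x, []) (NAdd (V x) (NLit 1))))) R (set_int s (x, []) 0)"
  proof (rule wp_While[where I = J and M = "\<lambda>s. N - ints s x []"])
    show "J 0 (set_int s (x, []) 0)" using init by (simp add: J_def ints_set_int)
  next
    fix k s assume "J k s" and b: "bval s (BLess (V x) e)"
    then have I: "I (ints s x []) k s" and less: "ints s x [] < N" using bound by (auto simp: J_def)
    show "wp (Seq c (SetInt (x, []) (NAdd (V x) (NLit 1))))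
        (\<lambda>k' s'. J (k + k') s' \<and> N - ints s' x [] < N - ints s x []) s"
      by (rule wp_Seq, rule wp_mono[OF step[OF less I refl]])
        (use less in \<open>auto intro!: wp_SetInt simp: J_def ints_set_int\<close>)
  next
    fix k s assume J: "J k s" "\<not> bval s (BLess (V x) e)"
    then have "I (ints s x []) k s" "ints s x [] = N" using bound by (fastforce simp: J_def)+
    then show "R k s" using exit by simp
  qed
  then show ?thesis
    unfolding For_def by (intro wp_Seq wp_SetInt) (simp add: wp_mono)
qed

text \<open>
  Only the integer arrays in \<open>X\<close> and the number arrays in \<open>Y\<close> differ.
\<close>

definition frame :: "string set \<Rightarrow> string set \<Rightarrow> state \<Rightarrow> state \<Rightarrow> bool" where
  "frame X Y s s' \<longleftrightarrow> (\<forall>x. x \<notin> X \<longrightarrow> ints s' x = ints s x) \<and> (\<forall>y. y \<notin> Y \<longrightarrow> nums s' y = nums s y)"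

lemma frame_refl: "frame X Y s s"
  by (simp add: frame_def)

lemma frame_set_int: "frame X Y s s' \<Longrightarrow> fst l \<in> X \<Longrightarrow> frame X Y s (set_int s' l v)"
  by (auto simp: frame_def ints_set_int)

lemma frame_set_num: "frame X Y s s' \<Longrightarrow> fst l \<in> Y \<Longrightarrow> frame X Y s (set_num s' l v)"
  by (auto simp: frame_def nums_set_num)

lemma frame_init:
  "fst l \<in> X \<Longrightarrow> frame X Y s (set_int s l v)" "fst l \<in> Y \<Longrightarrow> frame X Y s (set_num s l w)"
  by (simp_all add: frame_set_int frame_set_num frame_refl)

lemmas frame_update = frame_set_int frame_set_num

lemma frame_trans: "frame X Y s s' \<Longrightarrow> frame X' Y' s' s'' \<Longrightarrow> X' \<subseteq> X \<Longrightarrow> Y' \<subseteq> Y \<Longrightarrow> frame X Y s s''"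
  by (auto simp: frame_def)

text \<open>
  With a fixed initial state \<open>s\<close> these rules rewrite a read access in any later state to one in \<open>s\<close>.
\<close>

lemma frame_ints: "frame X Y s s' \<Longrightarrow> x \<notin> X \<Longrightarrow> ints s' x = ints s x"
  and frame_nums: "frame X Y s s' \<Longrightarrow> y \<notin> Y \<Longrightarrow> nums s' y = nums s y"
  by (simp_all add: frame_def)


section \<open>Tabulating the sparse coefficient matrix\<close>

text \<open>
  The \<open>m\<close> nonzero entries of the matrix of the gradient are numbered.  The entry \<open>q\<close> comes from the term \<open>ek\<^sub>q\<close> and
  the variable \<open>ev\<^sub>q\<close> that occurs in it.
\<close>

definition list_entries :: com where
  "list_entries = Seq (SetInt (''m'', []) (NLit 0))
     (For ''k'' (V ''t'') (For ''i'' (V ''n'')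
        (If (BLess (NLit 0) (NAt ''a'' [V ''k'', V ''i'']))
          (Seq (SetInt (''ek'', [V ''m'']) (V ''k''))
          (Seq (SetInt (''ev'', [V ''m'']) (V ''i''))
               (SetInt (''m'', []) (NAdd (V ''m'') (NLit 1)))))
          Skip)))"

text \<open>
  Several loops collect the elements of a set in an array without repetition.  Their invariant is a
  bijection between the used indices and the part of the set that has been visited.
\<close>

lemma bij_betw_append:
  assumes "bij_betw h {..<m} S" "x \<notin> S" "\<And>q. q < m \<Longrightarrow> h' q = h q" "h' m = x"
  shows "bij_betw h' {..<Suc m} (insert x S)"
proof -
  have "bij_betw h' {..<m} S" using assms(1,3) bij_betw_cong[of "{..<m}" h' h S] by simp
  then have "bij_betw h' ({..<m} \<union> {m}) (S \<union> {x})"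
    using assms(2,4) by (intro bij_betw_combine) (auto simp: bij_betw_def)
  then show ?thesis by (simp add: lessThan_Suc)
qed

definition entry :: "state \<Rightarrow> nat \<Rightarrow> nat \<times> nat" where
  "entry s q = (ints s ''ek'' [q], ints s ''ev'' [q])"

lemma wp_list_entries:
  assumes "ints s ''n'' [] = n" "ints s ''t'' [] = t"
  shows "wp list_entries (\<lambda>k s'. k = 0 \<and> frame {''m'', ''k'', ''i'', ''ek'', ''ev''} {} s s' \<and>
    bij_betw (entry s') {..<ints s' ''m'' []} {(k, i). k < t \<and> i < n \<and> 0 < ints s ''a'' [k, i]}) s"
proof -
  \<comment> \<open>The entries visited before the pair \<open>(k, i)\<close> in lexicographic order.\<close>
  define E where "E k i = {(k', i'). i' < n \<and> 0 < ints s ''a'' [k', i'] \<and> (k' < k \<or> k' = k \<and> i' < i)}"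
    for k i
  define I where "I k i c s' \<longleftrightarrow> c = 0 \<and> frame {''m'', ''k'', ''i'', ''ek'', ''ev''} {} s s' \<and>
    bij_betw (entry s') {..<ints s' ''m'' []} (E k i)" for k i and c :: nat and s'
  have fr: "I k i c s' \<Longrightarrow> ints s' ''n'' [] = n \<and> ints s' ''t'' [] = t \<and> ints s' ''a'' = ints s ''a''" for k i c s'
    using assms by (simp add: I_def frame_def)
  have counter: "I k i c (set_int s' (x, []) v) \<longleftrightarrow> I k i c s'" if "x = ''k'' \<or> x = ''i''" for k i c s' x v
    using that by (auto simp: I_def frame_def ints_set_int entry_def[abs_def])
  have E0: "E 0 0 = {}" and Ek: "E (Suc k) 0 = E k n" for k by (auto simp: E_def)
  have En: "E t 0 = {(k, i). k < t \<and> i < n \<and> 0 < ints s ''a'' [k, i]}" by (auto simp: E_def)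
  have Ei: "E k (Suc i) = (if 0 < ints s ''a'' [k, i] then insert (k, i) (E k i) else E k i)" if "i < n" for k i
    using that by (auto simp: E_def less_Suc_eq)
  have step: "wp (If (BLess (NLit 0) (NAt ''a'' [V ''k'', V ''i'']))
          (Seq (SetInt (''ek'', [V ''m'']) (V ''k''))
          (Seq (SetInt (''ev'', [V ''m'']) (V ''i''))
               (SetInt (''m'', []) (NAdd (V ''m'') (NLit 1)))))
          Skip) (\<lambda>c' s'. ints s' ''i'' [] = i \<and> ints s' ''k'' [] = k \<and> I k (Suc i) (c + c') s') s1"
    if "i < n" "I k i c s1" "ints s1 ''i'' [] = i" "ints s1 ''k'' [] = k" for i k c s1
  proof -
    have "bij_betw (entry s2) {..<Suc (ints s1 ''m'' [])} (insert (k, i) (E k i))"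
      if "s2 = set_int (set_int (set_int s1 (''ek'', [V ''m'']) k) (''ev'', [V ''m'']) i) (''m'', []) (Suc (ints s1 ''m'' []))"
      for s2
      by (rule bij_betw_append[where h = "entry s1"])
        (use \<open>I k i c s1\<close> that in \<open>auto simp: I_def entry_def ints_set_int E_def\<close>)
    then show ?thesis
      using that fr[OF that(2)]
      by (intro wp_intros) (auto simp: ints_set_int I_def Ei frame_def)
  qed
  have next_term: "I (Suc k) 0 c s' \<longleftrightarrow> I k n c s'" for k c s' by (simp add: I_def Ek)
  show ?thesis
    unfolding list_entries_def
  proof (intro wp_Seq wp_SetInt, rule wp_For[where I = "\<lambda>k c s'. I k 0 c s'" and N = t], goal_cases)
    case 1
    show ?case by (simp add: I_def E0 frame_def ints_set_int bij_betw_def)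
  next
    case (2 i k s)
    then show ?case by (auto dest: fr)
  next
    case (3 k c s1)
    show ?case
    proof (rule wp_For[where I = "\<lambda>i c' s'. ints s' ''k'' [] = k \<and> I k i (c + c') s'" and N = n], goal_cases)
      case 1
      show ?case using 3 counter by (simp add: ints_set_int)
    next
      case (2 i k s)
      then show ?case by (auto dest: fr)
    next
      case (3 i c' s2)
      then show ?case
        by (intro wp_mono[OF step]) (auto simp: counter ints_set_int add.assoc)
    next
      case (4 c' s')
      then show ?case by (simp add: counter next_term)
    qed
  next
    case (4 c s')
    then show ?case by (simp add: I_def En)
  qed
qed

text \<open>
  The exponent vector of the monomial that labels the row of the entry \<open>q\<close>: the term divided by the variable.
\<close>

definition tabulate_rows :: com where
  "tabulate_rows = For ''q'' (V ''m'') (For ''j'' (V ''n'')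
     (If (BEq (V ''j'') (NAt ''ev'' [V ''q'']))
        (SetInt (''R'', [V ''q'', V ''j'']) (NSub (NAt ''a'' [NAt ''ek'' [V ''q''], V ''j'']) (NLit 1)))
        (SetInt (''R'', [V ''q'', V ''j'']) (NAt ''a'' [NAt ''ek'' [V ''q''], V ''j'']))))"

lemma wp_tabulate_rows:
  assumes "ints s ''n'' [] = n" "ints s ''m'' [] = T"
  shows "wp tabulate_rows (\<lambda>k s'. k = 0 \<and> frame {''q'', ''j'', ''R''} {} s s' \<and>
    (\<forall>q<T. \<forall>j<n. ints s' ''R'' [q, j] =
      ints s ''a'' [ints s ''ek'' [q], j] - (if j = ints s ''ev'' [q] then 1 else 0))) s"
proof -
  define rowv where "rowv q j = ints s ''a'' [ints s ''ek'' [q], j] - (if j = ints s ''ev'' [q] then 1 else 0)" for q j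
  define I where "I q j c s' \<longleftrightarrow> c = 0 \<and> frame {''q'', ''j'', ''R''} {} s s' \<and>
    (\<forall>q' j'. j' < n \<longrightarrow> q' < q \<or> q' = q \<and> j' < j \<longrightarrow> ints s' ''R'' [q', j'] = rowv q' j')"
    for q j and c :: nat and s'
  note FR = frame_update frame_ints[of "{''q'', ''j'', ''R''}" "{}" s] frame_nums[of "{''q'', ''j'', ''R''}" "{}" s]
  show ?thesis
    unfolding tabulate_rows_def
  proof (rule wp_For[where I = "\<lambda>q c s'. I q 0 c s'" and N = T], goal_cases)
    case 1
    show ?case by (auto simp: I_def FR frame_init ints_set_int)
  next
    case (2 i k s)
    then show ?case using assms by (simp add: I_def FR)
  next
    case (3 q c s1)
    show ?case
    proof (rule wp_For[where I = "\<lambda>j c' s'. ints s' ''q'' [] = q \<and> I q j (c + c') s'" and N = n], goal_cases)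
      case 1
      show ?case using 3 by (auto simp: I_def FR frame_init ints_set_int)
    next
      case (2 i k s)
      then show ?case using assms by (simp add: I_def FR)
    next
      case (3 j c' s2)
      let ?s' = "set_int s2 (''R'', [V ''q'', V ''j'']) (rowv q j)"
      have effect: "wp (If (BEq (V ''j'') (NAt ''ev'' [V ''q'']))
          (SetInt (''R'', [V ''q'', V ''j'']) (NSub (NAt ''a'' [NAt ''ek'' [V ''q''], V ''j'']) (NLit 1)))
          (SetInt (''R'', [V ''q'', V ''j'']) (NAt ''a'' [NAt ''ek'' [V ''q''], V ''j''])))
          (\<lambda>k' s'. k' = 0 \<and> s' = ?s') s2"
        using 3 by (intro wp_intros) (simp_all add: I_def FR rowv_def)
      show ?case
        by (rule wp_mono[OF effect]) (use 3 in \<open>auto simp: I_def FR frame_update ints_set_int elim!: less_SucE\<close>)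
    next
      case (4 c' s')
      then show ?case by (auto simp: I_def FR ints_set_int elim!: less_SucE)
    qed
  next
    case (4 c s')
    then show ?case by (simp add: I_def rowv_def)
  qed
qed

text \<open>
  The rows are named by numbers of entries.  The inner loop overwrites \<open>rid\<^sub>q\<close> whenever it
  meets an entry of the same row, so all entries of a row end up with the last one.
\<close>

definition identify_rows :: com where
  "identify_rows = For ''q'' (V ''m'') (For ''p'' (V ''m'')
     (Seq (SetInt (''x'', []) (NLit 1))
     (Seq (For ''j'' (V ''n'')
            (If (BEq (NAt ''R'' [V ''p'', V ''j'']) (NAt ''R'' [V ''q'', V ''j''])) Skip
              (SetInt (''x'', []) (NLit 0))))
          (If (BLess (NLit 0) (V ''x'')) (SetInt (''rid'', [V ''q'']) (V ''p'')) Skip))))"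

definition same_row :: "nat \<Rightarrow> state \<Rightarrow> nat \<Rightarrow> nat \<Rightarrow> bool" where
  "same_row n s p q \<longleftrightarrow> (\<forall>j<n. ints s ''R'' [p, j] = ints s ''R'' [q, j])"

lemma Max_below_Suc:
  fixes p :: nat
  shows "{p'. p' < Suc p \<and> B p'} = (if B p then insert p {p'. p' < p \<and> B p'} else {p'. p' < p \<and> B p'})"
    and "B p \<Longrightarrow> Max {p'. p' < Suc p \<and> B p'} = p"
proof -
  show *: "{p'. p' < Suc p \<and> B p'} = (if B p then insert p {p'. p' < p \<and> B p'} else {p'. p' < p \<and> B p'})"
    by (auto simp: less_Suc_eq)
  show "B p \<Longrightarrow> Max {p'. p' < Suc p \<and> B p'} = p"
    by (rule Max_eqI) auto
qed

lemma wp_identify_rows: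
  assumes "ints s ''n'' [] = n" "ints s ''m'' [] = T"
  shows "wp identify_rows (\<lambda>k s'. k = 0 \<and> frame {''q'', ''p'', ''j'', ''x'', ''rid''} {} s s' \<and>
    (\<forall>q<T. ints s' ''rid'' [q] = Max {p. p < T \<and> same_row n s p q})) s"
proof -
  define F where "F c s' \<longleftrightarrow> c = 0 \<and> frame {''q'', ''p'', ''j'', ''x'', ''rid''} {} s s'" for c :: nat and s'
  define D where "D q s' \<longleftrightarrow> (\<forall>q'<q. ints s' ''rid'' [q'] = Max {p. p < T \<and> same_row n s p q'})" for q and s' :: state
  define E where "E q p s' \<longleftrightarrow> ({p'. p' < p \<and> same_row n s p' q} \<noteq> {} \<longrightarrow>
    ints s' ''rid'' [q] = Max {p'. p' < p \<and> same_row n s p' q})" for q p and s' :: state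
  note FR = frame_update frame_ints[of "{''q'', ''p'', ''j'', ''x'', ''rid''}" "{}" s] frame_nums[of "{''q'', ''p'', ''j'', ''x'', ''rid''}" "{}" s]
  show ?thesis
    unfolding identify_rows_def
  proof (rule wp_For[where I = "\<lambda>q c s'. F c s' \<and> D q s'" and N = T], goal_cases)
    case 1
    show ?case by (auto simp: F_def D_def FR frame_init ints_set_int)
  next
    case (2 i k s)
    then show ?case using assms by (simp add: F_def FR)
  next
    case (3 q c s1)
    show ?case
    proof (rule wp_For[where I = "\<lambda>p c' s'. F (c + c') s' \<and> D q s' \<and> E q p s' \<and> ints s' ''q'' [] = q"
          and N = T], goal_cases)
      case 1
      show ?case using 3 by (auto simp: F_def D_def E_def FR frame_init ints_set_int)
    next
      case (2 i k s)
      then show ?case using assms by (simp add: F_def FR)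
    next
      case (3 p c' s2)
      show ?case
      proof (intro wp_Seq wp_SetInt, rule wp_For[where I = "\<lambda>j c'' s'. F (c + c' + c'') s' \<and> D q s' \<and>
            E q p s' \<and> ints s' ''q'' [] = q \<and> ints s' ''p'' [] = p \<and>
            ints s' ''x'' [] = (if \<forall>j'<j. ints s ''R'' [p, j'] = ints s ''R'' [q, j'] then 1 else 0)"
            and N = n], goal_cases)
        case 1
        show ?case using 3 by (auto simp: F_def D_def E_def FR frame_init ints_set_int)
      next
        case (2 i k s)
        then show ?case using assms by (simp add: F_def FR)
      next
        case (3 j c'' s3)
        then show ?case
          by (intro wp_intros) (auto simp: F_def D_def E_def FR ints_set_int All_less_Suc Ex_less_Suc)
      next
        case (4 c'' s3)
        then have x: "ints s3 ''x'' [] = (if same_row n s p q then 1 else 0)"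
          by (simp add: same_row_def)
        show ?case
        proof (intro wp_intros, goal_cases)
          case 1
          then have "same_row n s p q" using x by (simp split: if_splits)
          then show ?case using 4 Max_below_Suc(2)[of "\<lambda>p. same_row n s p q" p]
            by (auto simp: F_def D_def E_def FR ints_set_int)
        next
          case 2
          then have "\<not> same_row n s p q" using x by (simp split: if_splits)
          then show ?case using 4 Max_below_Suc(1)[of p "\<lambda>p. same_row n s p q"]
            by (auto simp: F_def D_def E_def FR ints_set_int)
        qed
      qed
    next
      case (4 c' s')
      have "{p'. p' < T \<and> same_row n s p' q} \<noteq> {}" using \<open>q < T\<close> by (auto simp: same_row_def)
      then show ?case using 4 by (auto simp: F_def D_def E_def FR ints_set_int All_less_Suc Ex_less_Suc)
    qed
  next
    case (4 c s')
    then show ?case by (simp add: F_def D_def)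
  qed
qed

lemma Max_same_row:
  assumes "p < T" "q < T"
  shows "Max {p'. p' < T \<and> same_row n s p' q} < T"
    and "Max {p'. p' < T \<and> same_row n s p' p} = Max {p'. p' < T \<and> same_row n s p' q} \<longleftrightarrow> same_row n s p q"
proof -
  have Max: "Max {p'. p' < T \<and> same_row n s p' q} \<in> {p'. p' < T \<and> same_row n s p' q}" if "q < T" for q
    by (rule Max_in) (use that in \<open>auto simp: same_row_def\<close>)
  show "Max {p'. p' < T \<and> same_row n s p' q} < T" using Max[OF assms(2)] by simp
  show "Max {p'. p' < T \<and> same_row n s p' p} = Max {p'. p' < T \<and> same_row n s p' q} \<longleftrightarrow> same_row n s p q"
  proof
    assume "Max {p'. p' < T \<and> same_row n s p' p} = Max {p'. p' < T \<and> same_row n s p' q}"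
    then show "same_row n s p q"
      using Max[OF assms(1)] Max[OF assms(2)] by (auto simp: same_row_def)
  next
    assume "same_row n s p q"
    then have "same_row n s p' p \<longleftrightarrow> same_row n s p' q" for p' by (auto simp: same_row_def)
    then show "Max {p'. p' < T \<and> same_row n s p' p} = Max {p'. p' < T \<and> same_row n s p' q}" by simp
  qed
qed

definition init_identity :: com where
  "init_identity = For ''i'' (V ''n'') (Seq (SetInt (''act'', [V ''i'']) (NLit 1))
     (Seq (For ''l'' (V ''n'') (SetZero (''Q'', [V ''i'', V ''l''])))
          (SetOne (''Q'', [V ''i'', V ''i'']))))"

lemma wp_init_identity:
  assumes "ints s ''n'' [] = n"
  shows "wp init_identity (\<lambda>k s'. k = 0 \<and> frame {''i'', ''l'', ''act''} {''Q''} s s' \<and>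
    (\<forall>i<n. ints s' ''act'' [i] = 1 \<and> (\<forall>l<n. nums s' ''Q'' [i, l] = (if i = l then 1 else 0)))) s"
proof -
  define I where "I i c s' \<longleftrightarrow> c = 0 \<and> frame {''i'', ''l'', ''act''} {''Q''} s s' \<and>
    (\<forall>i'<i. ints s' ''act'' [i'] = 1 \<and> (\<forall>l<n. nums s' ''Q'' [i', l] = (if i' = l then 1 else 0)))"
    for i and c :: nat and s'
  note FR = frame_update frame_ints[of "{''i'', ''l'', ''act''}" "{''Q''}" s] frame_nums[of "{''i'', ''l'', ''act''}" "{''Q''}" s]
  show ?thesis
    unfolding init_identity_def
  proof (rule wp_For[where I = I and N = n], goal_cases)
    case 1
    show ?case by (auto simp: I_def FR frame_init ints_set_int)
  next
    case (2 i k s)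
    then show ?case using assms by (simp add: I_def FR)
  next
    case (3 i c s1)
    show ?case
    proof (intro wp_Seq wp_SetInt, rule wp_For[where I = "\<lambda>l c' s'. I i (c + c') s' \<and> ints s' ''i'' [] = i \<and>
        ints s' ''act'' [i] = 1 \<and> (\<forall>l'<l. nums s' ''Q'' [i, l'] = 0)" and N = n], goal_cases)
      case 1
      show ?case using 3 by (auto simp: I_def FR frame_init ints_set_int)
    next
      case (2 i k s)
      then show ?case using assms by (simp add: I_def FR)
    next
      case (3 l c' s2)
      then show ?case
        by (intro wp_intros) (auto simp: I_def FR ints_set_int nums_set_num All_less_Suc Ex_less_Suc)
    next
      case (4 c' s')
      then show ?case using \<open>i < n\<close>
        by (intro wp_intros) (auto simp: I_def FR ints_set_int nums_set_num All_less_Suc Ex_less_Suc)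
    qed
  next
    case (4 c s')
    then show ?case by (simp add: I_def)
  qed
qed

text \<open>
  A row with a single entry says that the coordinate of its variable is zero.  The unit vectors of
  the other variables are in its kernel, so it suffices to change the flag of this variable.
\<close>

definition retire_singletons :: com where
  "retire_singletons = For ''q'' (V ''m'') (Seq (SetInt (''x'', []) (NLit 1))
     (Seq (For ''p'' (V ''m'')
            (If (BAnd (BEq (NAt ''rid'' [V ''p'']) (NAt ''rid'' [V ''q''])) (BNot (BEq (V ''p'') (V ''q''))))
              (SetInt (''x'', []) (NLit 0)) Skip))
          (If (BLess (NLit 0) (V ''x'')) (SetInt (''act'', [NAt ''ev'' [V ''q'']]) (NLit 0)) Skip)))"

definition alone :: "nat \<Rightarrow> (nat \<Rightarrow> nat) \<Rightarrow> nat \<Rightarrow> bool" where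
  "alone T rid q \<longleftrightarrow> (\<forall>p<T. rid p = rid q \<longrightarrow> p = q)"

lemma wp_retire_singletons:
  assumes "ints s ''m'' [] = T" "\<forall>i<n. ints s ''act'' [i] = 1"
  shows "wp retire_singletons (\<lambda>k s'. k = 0 \<and> frame {''q'', ''p'', ''x'', ''act''} {} s s' \<and>
    (\<forall>i<n. ints s' ''act'' [i] =
      (if \<exists>q<T. ints s ''ev'' [q] = i \<and> alone T (\<lambda>q. ints s ''rid'' [q]) q then 0 else 1))) s"
proof -
  define al where "al = alone T (\<lambda>q. ints s ''rid'' [q])"
  define I where "I q c s' \<longleftrightarrow> c = 0 \<and> frame {''q'', ''p'', ''x'', ''act''} {} s s' \<and>
    (\<forall>i<n. ints s' ''act'' [i] = (if \<exists>q'<q. ints s ''ev'' [q'] = i \<and> al q' then 0 else 1))"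
    for q and c :: nat and s'
  note FR = frame_update frame_ints[of "{''q'', ''p'', ''x'', ''act''}" "{}" s] frame_nums[of "{''q'', ''p'', ''x'', ''act''}" "{}" s]
  show ?thesis
    unfolding retire_singletons_def
  proof (rule wp_For[where I = I and N = T], goal_cases)
    case 1
    show ?case using assms by (auto simp: I_def FR frame_init ints_set_int)
  next
    case (2 i k s)
    then show ?case using assms by (simp add: I_def FR)
  next
    case (3 q c s1)
    show ?case
    proof (intro wp_Seq wp_SetInt, rule wp_For[where I = "\<lambda>p c' s'. I q (c + c') s' \<and> ints s' ''q'' [] = q \<and>
        ints s' ''x'' [] = (if \<forall>p'<p. ints s ''rid'' [p'] = ints s ''rid'' [q] \<longrightarrow> p' = q then 1 else 0)"
        and N = T], goal_cases)
      case 1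
      show ?case using 3 by (auto simp: I_def FR frame_init ints_set_int)
    next
      case (2 i k s)
      then show ?case using assms by (simp add: I_def FR)
    next
      case (3 p c' s2)
      then show ?case
        by (intro wp_intros) (auto simp: I_def FR ints_set_int All_less_Suc Ex_less_Suc)
    next
      case (4 c' s')
      then have x: "ints s' ''x'' [] = (if al q then 1 else 0)" by (simp add: al_def alone_def)
      show ?case
      proof (intro wp_intros, goal_cases)
        case 1
        then have "al q" using x by (simp split: if_splits)
        then show ?case using 4 by (simp add: I_def FR ints_set_int Ex_less_Suc) blast
      next
        case 2
        then have "\<not> al q" using x by (simp split: if_splits)
        then show ?case using 4 by (simp add: I_def FR ints_set_int Ex_less_Suc)
      qed
    qed
  next
    case (4 c s')
    then show ?case by (simp add: I_def al_def)
  qed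
qed

definition compute_coeffs :: com where
  "compute_coeffs = For ''q'' (V ''m'')
     (Seq (OfNat (''v'', [V ''q'']) (NAt ''a'' [NAt ''ek'' [V ''q''], NAt ''ev'' [V ''q'']]))
          (Arith (''v'', [V ''q'']) Times (''v'', [V ''q'']) (''c'', [NAt ''ek'' [V ''q''] ])))"

lemma wp_compute_coeffs:
  assumes "ints s ''m'' [] = T"
  shows "wp compute_coeffs (\<lambda>k s'. k = 2 * T \<and> frame {''q''} {''v''} s s' \<and>
    (\<forall>q<T. nums s' ''v'' [q] = of_nat (ints s ''a'' [ints s ''ek'' [q], ints s ''ev'' [q]]) *
      nums s ''c'' [ints s ''ek'' [q]])) s"
proof -
  note FR = frame_update frame_ints[of "{''q''}" "{''v''}" s] frame_nums[of "{''q''}" "{''v''}" s]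
  show ?thesis
    unfolding compute_coeffs_def
  proof (rule wp_For[where I = "\<lambda>q k s'. k = 2 * q \<and> frame {''q''} {''v''} s s' \<and>
    (\<forall>q'<q. nums s' ''v'' [q'] = of_nat (ints s ''a'' [ints s ''ek'' [q'], ints s ''ev'' [q']]) *
      nums s ''c'' [ints s ''ek'' [q']])" and N = T], goal_cases)
  case (3 q k s1)
  then show ?case
    by (intro wp_intros) (auto simp: FR state_simps All_less_Suc Ex_less_Suc)
qed (use assms in \<open>auto simp: FR frame_init ints_set_int\<close>)
qed


section \<open>Eliminating the rows\<close>

text \<open>
  The summation over all entries has the form of the loop that computes it; \<open>p\<close> selects the row.
\<close>

definition row_functional ::
  "nat \<Rightarrow> (nat \<Rightarrow> nat) \<Rightarrow> (nat \<Rightarrow> nat) \<Rightarrow> (nat \<Rightarrow> complex) \<Rightarrow> nat \<Rightarrow> (nat \<Rightarrow> complex) \<Rightarrow> complex" where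
  "row_functional T rid ev v p y = (\<Sum>q<T. if rid q = p then v q * y (ev q) else 0)"

lemma linear_row_functional:
  assumes "\<And>q. q < T \<Longrightarrow> ev q < n"
  shows "linear_functional n (row_functional T rid ev v p)"
  unfolding linear_functional_def
proof (intro conjI allI impI)
  fix y z c
  have "row_functional T rid ev v p (\<lambda>i. y i - c * z i) =
      (\<Sum>q<T. (if rid q = p then v q * y (ev q) else 0) - c * (if rid q = p then v q * z (ev q) else 0))"
    unfolding row_functional_def by (rule sum.cong) (simp_all add: algebra_simps)
  then show "row_functional T rid ev v p (\<lambda>i. y i - c * z i) =
      row_functional T rid ev v p y - c * row_functional T rid ev v p z"
    by (simp add: row_functional_def sum_subtractf sum_distrib_left)
next
  fix y :: "nat \<Rightarrow> complex" assume "\<forall>i<n. y i = 0"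
  then show "row_functional T rid ev v p y = 0"
    using assms by (auto simp: row_functional_def intro!: sum.neutral)
qed

text \<open>
  Only the entries of the row \<open>p\<close> cost arithmetic, \<open>2 n\<close> operations each.  Comparing row numbers is
  free, and every entry belongs to one row.
\<close>

definition accumulate_row :: com where
  "accumulate_row = Seq (For ''l'' (V ''n'') (SetZero (''w'', [V ''l''])))
     (For ''q'' (V ''m'') (If (BEq (NAt ''rid'' [V ''q'']) (V ''p''))
        (For ''l'' (V ''n'')
          (Seq (Arith (''h'', []) Times (''v'', [V ''q'']) (''Q'', [NAt ''ev'' [V ''q''], V ''l'']))
               (Arith (''w'', [V ''l'']) Plus (''w'', [V ''l'']) (''h'', []))))
        Skip))"

lemma card_less_Suc_filter:
  "card {q'. q' < Suc q \<and> B q'} = card {q'. q' < q \<and> B q'} + (if B q then 1 else 0)"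
proof -
  have "{q'. q' < Suc q \<and> B q'} = (if B q then insert q {q'. q' < q \<and> B q'} else {q'. q' < q \<and> B q'})"
    by (auto simp: less_Suc_eq)
  then show ?thesis by simp
qed

lemma wp_accumulate_row:
  assumes "ints s ''n'' [] = n" "ints s ''m'' [] = T" "ints s ''p'' [] = p"
  shows "wp accumulate_row (\<lambda>k s'. k = 2 * n * card {q. q < T \<and> ints s ''rid'' [q] = p} \<and>
    frame {''q'', ''l''} {''w'', ''h''} s s' \<and>
    (\<forall>l<n. nums s' ''w'' [l] = row_functional T (\<lambda>q. ints s ''rid'' [q]) (\<lambda>q. ints s ''ev'' [q])
      (\<lambda>q. nums s ''v'' [q]) p (\<lambda>i. nums s ''Q'' [i, l]))) s"
proof -
  define R where "R q l = row_functional q (\<lambda>q. ints s ''rid'' [q]) (\<lambda>q. ints s ''ev'' [q])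
      (\<lambda>q. nums s ''v'' [q]) p (\<lambda>i. nums s ''Q'' [i, l])" for q l
  have R_Suc: "R (Suc q) l = (if ints s ''rid'' [q] = p
      then R q l + nums s ''v'' [q] * nums s ''Q'' [ints s ''ev'' [q], l] else R q l)" for q l
    by (simp add: R_def row_functional_def)
  define N where "N q = card {q'. q' < q \<and> ints s ''rid'' [q'] = p}" for q
  have N_Suc: "N (Suc q) = (if ints s ''rid'' [q] = p then N q + 1 else N q)" for q
    by (simp add: N_def card_less_Suc_filter)
  define F where "F s' \<longleftrightarrow> frame {''q'', ''l''} {''w'', ''h''} s s'" for s'
  note FR = F_def frame_update frame_ints[of "{''q'', ''l''}" "{''w'', ''h''}" s]
    frame_nums[of "{''q'', ''l''}" "{''w'', ''h''}" s]
  show ?thesis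
    unfolding accumulate_row_def
  proof (intro wp_Seq, rule wp_For[where I = "\<lambda>l c s'. c = 0 \<and> F s' \<and> (\<forall>l'<l. nums s' ''w'' [l'] = R 0 l')"
      and N = n], goal_cases)
    case 1
    show ?case by (simp add: FR frame_init)
  next
    case (2 i k s)
    then show ?case using assms by (simp add: FR)
  next
    case (3 l c s1)
    then show ?case
      by (intro wp_intros) (simp_all add: FR state_simps All_less_Suc R_def row_functional_def)
  next
    case (4 c s1)
    show ?case
    proof (rule wp_For[where I = "\<lambda>q c' s'. c' = 2 * n * N q \<and> F s' \<and> (\<forall>l<n. nums s' ''w'' [l] = R q l)"
          and N = T], goal_cases)
      case 1
      show ?case using 4 by (simp add: FR N_def)
    next
      case (2 i k s)
      then show ?case using assms by (simp add: FR)
    next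
      case (3 q c' s2)
      show ?case
      proof (rule wp_If)
        assume "bval s2 (BEq (NAt ''rid'' [V ''q'']) (V ''p''))"
        then have q: "ints s ''rid'' [q] = p" using 3 assms by (simp add: FR)
        show "wp (For ''l'' (V ''n'')
          (Seq (Arith (''h'', []) Times (''v'', [V ''q'']) (''Q'', [NAt ''ev'' [V ''q''], V ''l'']))
               (Arith (''w'', [V ''l'']) Plus (''w'', [V ''l'']) (''h'', []))))
          (\<lambda>k' s'. ints s' ''q'' [] = q \<and> c' + k' = 2 * n * N (Suc q) \<and> F (set_int s' (''q'', []) (Suc q)) \<and>
             (\<forall>l<n. nums (set_int s' (''q'', []) (Suc q)) ''w'' [l] = R (Suc q) l)) s2"
        proof (rule wp_For[where I = "\<lambda>l c'' s'. c'' = 2 * l \<and> F s' \<and> ints s' ''q'' [] = q \<and>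
            (\<forall>l'<n. nums s' ''w'' [l'] = (if l' < l then R (Suc q) l' else R q l'))" and N = n], goal_cases)
          case 1
          show ?case using 3 by (simp add: FR ints_set_int)
        next
          case (2 i k s)
          then show ?case using assms by (simp add: FR)
        next
          case (3 l c'' s3)
          then show ?case
            by (intro wp_intros) (auto simp: FR state_simps R_Suc q less_Suc_eq)
        next
          case (4 c'' s')
          then show ?case using 3 q by (simp add: FR N_Suc)
        qed
      next
        assume "\<not> bval s2 (BEq (NAt ''rid'' [V ''q'']) (V ''p''))"
        then have q: "ints s ''rid'' [q] \<noteq> p" using 3 assms by (simp add: FR)
        show "wp Skip (\<lambda>k' s'. ints s' ''q'' [] = q \<and> c' + k' = 2 * n * N (Suc q) \<and> F (set_int s' (''q'', []) (Suc q)) \<and>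
             (\<forall>l<n. nums (set_int s' (''q'', []) (Suc q)) ''w'' [l] = R (Suc q) l)) s2"
          using 3 q by (intro wp_intros) (simp add: FR N_Suc R_Suc)
      qed
    next
      case (4 c' s')
      then show ?case using \<open>c = 0 \<and> _\<close> by (simp add: F_def R_def N_def)
    qed
  qed
qed

text \<open>
  The value \<open>n\<close> of \<open>piv\<close> stands for the absence of a pivot.
\<close>

definition find_pivot :: com where
  "find_pivot = Seq (SetInt (''piv'', []) (V ''n''))
     (For ''l'' (V ''n'') (If (BLess (NLit 0) (NAt ''act'' [V ''l'']))
        (IfZero (''w'', [V ''l'']) Skip (SetInt (''piv'', []) (V ''l''))) Skip))"

lemma wp_find_pivot:
  assumes "ints s ''n'' [] = n"
  shows "wp find_pivot (\<lambda>k s'. k \<le> n \<and> frame {''l'', ''piv''} {} s s' \<and>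
    (ints s' ''piv'' [] = n \<and> (\<forall>l<n. 0 < ints s ''act'' [l] \<longrightarrow> nums s ''w'' [l] = 0) \<or>
     ints s' ''piv'' [] < n \<and> 0 < ints s ''act'' [ints s' ''piv'' []] \<and>
       nums s ''w'' [ints s' ''piv'' []] \<noteq> 0)) s"
proof -
  note FR = frame_update frame_ints[of "{''l'', ''piv''}" "{}" s] frame_nums[of "{''l'', ''piv''}" "{}" s]
  show ?thesis
    unfolding find_pivot_def
  proof (intro wp_Seq wp_SetInt, rule wp_For[where I = "\<lambda>l k s'. k \<le> l \<and> frame {''l'', ''piv''} {} s s' \<and>
      (ints s' ''piv'' [] = n \<and> (\<forall>l'<l. 0 < ints s ''act'' [l'] \<longrightarrow> nums s ''w'' [l'] = 0) \<or>
       ints s' ''piv'' [] < n \<and> 0 < ints s ''act'' [ints s' ''piv'' []] \<and>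
         nums s ''w'' [ints s' ''piv'' []] \<noteq> 0)" and N = n], goal_cases)
    case 1
    show ?case using assms by (simp add: FR frame_init ints_set_int)
  next
    case (2 i k s)
    then show ?case using assms by (simp add: FR)
  next
    case (3 l c s1)
    then show ?case
      by (intro wp_intros) (auto simp: FR state_simps All_less_Suc)
  next
    case (4 c s')
    then show ?case by simp
  qed
qed

text \<open>
  The column \<open>k\<close> is read while the other columns change, and it is overwritten by a unit vector after
  that.
\<close>

definition eliminate_pivot :: com where
  "eliminate_pivot = Seq
     (For ''l'' (V ''n'') (If (BAnd (BLess (NLit 0) (NAt ''act'' [V ''l''])) (BNot (BEq (V ''l'') (V ''piv''))))
        (Seq (Arith (''y'', []) Divide (''w'', [V ''l'']) (''w'', [V ''piv'']))
          (For ''i'' (V ''n'')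
            (Seq (Arith (''h'', []) Times (''y'', []) (''Q'', [V ''i'', V ''piv'']))
                 (Arith (''Q'', [V ''i'', V ''l'']) Minus (''Q'', [V ''i'', V ''l'']) (''h'', [])))))
        Skip))
     (Seq (For ''i'' (V ''n'') (SetZero (''Q'', [V ''i'', V ''piv''])))
     (Seq (SetOne (''Q'', [V ''piv'', V ''piv'']))
          (SetInt (''act'', [V ''piv'']) (NLit 0))))"

lemma wp_eliminate_pivot:
  assumes "ints s ''n'' [] = n" "ints s ''piv'' [] = k" "k < n" "nums s ''w'' [k] \<noteq> 0"
  shows "wp eliminate_pivot (\<lambda>c s'. c \<le> n * (1 + 2 * n) \<and> frame {''l'', ''i'', ''act''} {''Q'', ''y'', ''h''} s s' \<and>
    (\<forall>l<n. ints s' ''act'' [l] = (if l = k then 0 else ints s ''act'' [l])) \<and>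
    (\<forall>i<n. \<forall>l<n. nums s' ''Q'' [i, l] = eliminate {l. 0 < ints s ''act'' [l]} k
      (\<lambda>l. nums s ''w'' [l]) (\<lambda>i l. nums s ''Q'' [i, l]) i l)) s"
proof -
  let ?X = "{''l'', ''i'', ''act''}" and ?Y = "{''Q'', ''y'', ''h''}"
  define F where "F s' \<longleftrightarrow> frame ?X ?Y s s'" for s'
  note FR = F_def frame_update frame_ints[of ?X ?Y s] frame_nums[of ?X ?Y s]
  let ?el = "eliminate {l. 0 < ints s ''act'' [l]} k (\<lambda>l. nums s ''w'' [l]) (\<lambda>i l. nums s ''Q'' [i, l])"
  define W where "W i l = nums s ''Q'' [i, l] - nums s ''w'' [l] / nums s ''w'' [k] * nums s ''Q'' [i, k]" for i l
  define ac where "ac l \<longleftrightarrow> 0 < ints s ''act'' [l] \<and> l \<noteq> k" for l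
  have el: "?el i l = (if l = k then if i = k then 1 else 0 else if ac l then W i l else nums s ''Q'' [i, l])" for i l
    by (simp add: eliminate_def W_def ac_def)
  define G where "G l s' \<longleftrightarrow> F s' \<and> ints s' ''act'' = ints s ''act'' \<and>
    (\<forall>i<n. \<forall>l'<n. nums s' ''Q'' [i, l'] = (if l' < l \<and> ac l' then W i l' else nums s ''Q'' [i, l']))" for l s'
  show ?thesis
    unfolding eliminate_pivot_def
  proof (intro wp_Seq, rule wp_For[where I = "\<lambda>l c s'. c \<le> l * (1 + 2 * n) \<and> G l s'" and N = n], goal_cases)
    case 1
    show ?case by (simp add: G_def FR frame_init ints_set_int)
  next
    case (2 i k s)
    then show ?case using assms by (simp add: G_def FR)
  next
    case (3 l c s1)
    show ?case
    proof (rule wp_If)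
      assume "bval s1 (BAnd (BLess (NLit 0) (NAt ''act'' [V ''l''])) (BNot (BEq (V ''l'') (V ''piv''))))"
      then have l: "ac l" using 3 assms by (simp add: G_def FR ac_def)
      then have "l \<noteq> k" by (simp add: ac_def)
      show "wp (Seq (Arith (''y'', []) Divide (''w'', [V ''l'']) (''w'', [V ''piv'']))
          (For ''i'' (V ''n'')
            (Seq (Arith (''h'', []) Times (''y'', []) (''Q'', [V ''i'', V ''piv'']))
                 (Arith (''Q'', [V ''i'', V ''l'']) Minus (''Q'', [V ''i'', V ''l'']) (''h'', [])))))
          (\<lambda>k' s'. ints s' ''l'' [] = l \<and> c + k' \<le> Suc l * (1 + 2 * n) \<and> G (Suc l) (set_int s' (''l'', []) (Suc l))) s1"
      proof (rule wp_Seq, rule wp_Arith, goal_cases)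
        case 1
        show ?case using 3 assms by (simp add: G_def FR get_num_def)
      next
        case 2
        show ?case
        proof (rule wp_For[where I = "\<lambda>i c' s'. c' = 2 * i \<and> F s' \<and> ints s' ''act'' = ints s ''act'' \<and>
            ints s' ''l'' [] = l \<and> nums s' ''y'' [] = nums s ''w'' [l] / nums s ''w'' [k] \<and>
            (\<forall>i'<n. \<forall>l'<n. nums s' ''Q'' [i', l'] =
              (if l' < l \<and> ac l' \<or> l' = l \<and> i' < i then W i' l' else nums s ''Q'' [i', l']))" and N = n], goal_cases)
          case 1
          show ?case using 3 assms by (simp add: G_def FR state_simps)
        next
          case (2 i k s)
          then show ?case using assms by (simp add: FR)
        next
          case (3 i c' s2)
          have "\<not> (k < l \<and> ac k \<or> k = l \<and> i < i)" using \<open>l \<noteq> k\<close> by (simp add: ac_def)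
          then have Q: "nums s2 ''Q'' [i, k] = nums s ''Q'' [i, k]" "nums s2 ''Q'' [i, l] = nums s ''Q'' [i, l]"
            using 3 assms \<open>l < n\<close> \<open>l \<noteq> k\<close> by auto
          let ?s' = "set_num (set_num s2 (''h'', []) (nums s ''w'' [l] / nums s ''w'' [k] * nums s ''Q'' [i, k]))
            (''Q'', [V ''i'', V ''l'']) (W i l)"
          have piv: "ints s2 ''piv'' [] = k" using 3 assms by (simp add: FR)
          have effect: "wp (Seq (Arith (''h'', []) Times (''y'', []) (''Q'', [V ''i'', V ''piv'']))
              (Arith (''Q'', [V ''i'', V ''l'']) Minus (''Q'', [V ''i'', V ''l'']) (''h'', [])))
              (\<lambda>k' s'. k' = 2 \<and> s' = ?s') s2"
            using 3 Q piv by (intro wp_intros) (simp_all add: state_simps W_def)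
          show ?case
            by (rule wp_mono[OF effect]) (use 3 in \<open>auto simp: FR frame_update state_simps less_Suc_eq\<close>)
        next
          case (4 c' s')
          then have "G (Suc l) (set_int s' (''l'', []) (Suc l))"
            using l unfolding G_def by (auto simp: FR ints_set_int less_Suc_eq)
          then show ?case using 4 3 by simp
        qed
      qed
    next
      assume "\<not> bval s1 (BAnd (BLess (NLit 0) (NAt ''act'' [V ''l''])) (BNot (BEq (V ''l'') (V ''piv''))))"
      then have l: "\<not> ac l" using 3 assms by (simp add: G_def FR ac_def)
      show "wp Skip (\<lambda>k' s'. ints s' ''l'' [] = l \<and> c + k' \<le> Suc l * (1 + 2 * n) \<and>
          G (Suc l) (set_int s' (''l'', []) (Suc l))) s1"
        using 3 l by (intro wp_intros) (auto simp: G_def FR ints_set_int less_Suc_eq)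
    qed
  next
    case (4 c s1)
    show ?case
    proof (intro wp_Seq, rule wp_For[where I = "\<lambda>i c' s'. c' = 0 \<and> F s' \<and> ints s' ''act'' = ints s ''act'' \<and>
        (\<forall>i'<n. \<forall>l'<n. nums s' ''Q'' [i', l'] = (if l' = k then if i' < i then 0 else nums s ''Q'' [i', k]
          else if ac l' then W i' l' else nums s ''Q'' [i', l']))" and N = n], goal_cases)
      case 1
      show ?case using 4 by (auto simp: G_def FR ints_set_int ac_def)
    next
      case (2 i k s)
      then show ?case using assms by (simp add: FR)
    next
      case (3 i c' s2)
      then show ?case using assms
        by (intro wp_intros) (auto simp: FR state_simps less_Suc_eq)
    next
      case (4 c' s')
      then show ?case using assms \<open>c \<le> n * (1 + 2 * n) \<and> G n s1\<close>
        by (intro wp_intros) (auto simp: FR state_simps el)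
    qed
  qed
qed


definition active :: "nat \<Rightarrow> state \<Rightarrow> nat set" where
  "active n s = {l. l < n \<and> 0 < ints s ''act'' [l]}"

definition eliminate_rows :: com where
  "eliminate_rows = For ''p'' (V ''m'') (Seq accumulate_row (Seq find_pivot
     (If (BLess (V ''piv'') (V ''n'')) eliminate_pivot Skip)))"

text \<open>
  The summand \<open>3 n T\<close> pays for evaluating the rows at the basis vectors and for testing the values.  Every
  pivot lowers the number of active columns by one, which pays for the elimination.  The set \<open>\<Phi>\<^sub>0\<close>
  consists of the functionals whose kernel the initial columns describe; in the complete program they
  are the rows with a single entry.
\<close>

lemma wp_eliminate_rows:
  fixes \<Phi>\<^sub>0 :: "((nat \<Rightarrow> complex) \<Rightarrow> complex) set"
  defines "rowf s \<equiv> row_functional (ints s ''m'' []) (\<lambda>q. ints s ''rid'' [q]) (\<lambda>q. ints s ''ev'' [q])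
      (\<lambda>q. nums s ''v'' [q])"
  assumes "ints s ''n'' [] = n" "ints s ''m'' [] = T"
    and ev: "\<And>q. q < T \<Longrightarrow> ints s ''ev'' [q] < n"
    and lin: "\<And>\<phi>. \<phi> \<in> \<Phi>\<^sub>0 \<Longrightarrow> linear_functional n \<phi>"
    and init: "echelon_kernel n \<Phi>\<^sub>0 (active n s) (\<lambda>i l. nums s ''Q'' [i, l])"
  shows "wp eliminate_rows (\<lambda>c s'.
    frame {''p'', ''q'', ''l'', ''i'', ''piv'', ''act''} {''w'', ''h'', ''y'', ''Q''} s s' \<and>
    active n s' \<subseteq> active n s \<and>
    echelon_kernel n (\<Phi>\<^sub>0 \<union> rowf s ` {..<T}) (active n s') (\<lambda>i l. nums s' ''Q'' [i, l]) \<and>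
    c \<le> 3 * n * T + (card (active n s) - card (active n s')) * (n * (1 + 2 * n))) s"
proof -
  let ?X = "{''p'', ''q'', ''l'', ''i'', ''piv'', ''act''}" and ?Y = "{''w'', ''h'', ''y'', ''Q''}"
  define B where "B = n * (1 + 2 * n)"
  \<comment> \<open>The number of entries of the rows before \<open>p\<close>.\<close>
  define N where "N p = card {q. q < T \<and> ints s ''rid'' [q] < p}" for p
  have N_Suc: "N (Suc p) = N p + card {q. q < T \<and> ints s ''rid'' [q] = p}" for p
  proof -
    have "{q. q < T \<and> ints s ''rid'' [q] < Suc p} =
        {q. q < T \<and> ints s ''rid'' [q] < p} \<union> {q. q < T \<and> ints s ''rid'' [q] = p}"
      by (auto simp: less_Suc_eq)
    then show ?thesis unfolding N_def by (simp add: card_Un_disjoint disjoint_iff)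
  qed
  have N_T: "N T \<le> T"
    unfolding N_def using card_mono[of "{..<T}" "{q. q < T \<and> ints s ''rid'' [q] < T}"] by auto
  define ker where "ker p s' \<longleftrightarrow> active n s' \<subseteq> active n s \<and>
    echelon_kernel n (\<Phi>\<^sub>0 \<union> rowf s ` {..<p}) (active n s') (\<lambda>i l. nums s' ''Q'' [i, l])" for p s'
  define bnd where "bnd p s' = 2 * n * N p + n * p + (card (active n s) - card (active n s')) * B" for p s'
  note FR = frame_ints[of ?X ?Y s] frame_nums[of ?X ?Y s]
  have lin_rowf: "linear_functional n (rowf s p)" for p
    unfolding rowf_def using ev assms(3) by (intro linear_row_functional) simp
  have fin: "finite (active n s')" for s' by (simp add: active_def)
  show ?thesis
    unfolding eliminate_rows_def
  proof (rule wp_For[where I = "\<lambda>p c s'. frame ?X ?Y s s' \<and> ker p s' \<and> c \<le> bnd p s'" and N = T], goal_cases)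
    case 1
    show ?case using init by (simp add: frame_init ker_def bnd_def N_def active_def ints_set_int)
  next
    case (2 i k s)
    then show ?case using assms by (simp add: FR)
  next
    case (3 p c s1)
    then have s1: "frame ?X ?Y s s1" "ker p s1" "c \<le> bnd p s1" "ints s1 ''p'' [] = p" "p < T" by auto
    have in1: "ints s1 ''n'' [] = n" "ints s1 ''m'' [] = T" "ints s1 ''rid'' = ints s ''rid''"
      "ints s1 ''ev'' = ints s ''ev''" "nums s1 ''v'' = nums s ''v''"
      using s1(1) assms by (simp_all add: FR)
    show ?case
    proof (rule wp_Seq, rule wp_mono[OF wp_accumulate_row[OF in1(1,2) s1(4)]], rule wp_Seq, goal_cases)
      case (1 k2 s2)
      then have s2: "k2 = 2 * n * card {q. q < T \<and> ints s ''rid'' [q] = p}"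
        "frame {''q'', ''l''} {''w'', ''h''} s1 s2"
        "\<And>l. l < n \<Longrightarrow> nums s2 ''w'' [l] = rowf s p (\<lambda>i. nums s1 ''Q'' [i, l])"
        using in1 assms(3) by (simp_all add: rowf_def)
      note F2 = frame_ints[OF s2(2)] frame_nums[OF s2(2)]
      have n2: "ints s2 ''n'' [] = n" using in1 by (simp add: F2)
      show ?case
      proof (rule wp_mono[OF wp_find_pivot[OF n2]], goal_cases)
        case (1 k3 s3)
        then have s3: "k3 \<le> n" "frame {''l'', ''piv''} {} s2 s3" by auto
        note F3 = frame_ints[OF s3(2)] frame_nums[OF s3(2)]
        have n3: "ints s3 ''n'' [] = n" "ints s3 ''p'' [] = p" "ints s3 ''act'' = ints s1 ''act''"
          "nums s3 ''Q'' = nums s1 ''Q''" "nums s3 ''w'' = nums s2 ''w''"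
          using n2 s1(4) by (simp_all add: F2 F3)
        have fr3: "frame ?X ?Y s s3"
          using frame_trans[OF frame_trans[OF s1(1) s2(2)] s3(2)] by simp
        have act3: "active n s3 = active n s1" by (simp add: active_def n3)
        have cost: "c + (k2 + k3) \<le> bnd (Suc p) s1"
          using s1(3) s2(1) s3(1) by (simp add: bnd_def N_Suc distrib_left)
        have insert: "\<Phi>\<^sub>0 \<union> rowf s ` {..<Suc p} = insert (rowf s p) (\<Phi>\<^sub>0 \<union> rowf s ` {..<p})"
          by (auto simp: lessThan_Suc)
        show ?case
        proof (rule wp_If)
          assume "bval s3 (BLess (V ''piv'') (V ''n''))"
          then have piv: "ints s3 ''piv'' [] < n" "0 < ints s1 ''act'' [ints s3 ''piv'' []]"
            "nums s2 ''w'' [ints s3 ''piv'' []] \<noteq> 0"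
            using 1 n3 by (auto simp: F2)
          define k where "k = ints s3 ''piv'' []"
          have k: "k < n" "k \<in> active n s1" "nums s3 ''w'' [k] \<noteq> 0"
            using piv by (simp_all add: k_def active_def n3)
          show "wp eliminate_pivot (\<lambda>k' s'. ints s' ''p'' [] = p \<and>
              frame ?X ?Y s (set_int s' (''p'', []) (Suc p)) \<and> ker (Suc p) (set_int s' (''p'', []) (Suc p)) \<and>
              c + (k2 + (k3 + k')) \<le> bnd (Suc p) (set_int s' (''p'', []) (Suc p))) s3"
          proof (rule wp_mono[OF wp_eliminate_pivot[OF n3(1) k_def[symmetric] k(1,3)]], goal_cases)
            case (1 k4 s4)
            then have s4: "k4 \<le> B" "frame {''l'', ''i'', ''act''} {''Q'', ''y'', ''h''} s3 s4"
              by (simp_all add: B_def)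
            have act4: "active n s4 = active n s1 - {k}"
              using 1 by (auto simp: active_def n3 split: if_splits)
            have Q4: "nums s4 ''Q'' [i, l] =
                eliminate (active n s1) k (\<lambda>l. nums s2 ''w'' [l]) (\<lambda>i l. nums s1 ''Q'' [i, l]) i l"
              if "i < n" "l < n" for i l
              using 1 that by (simp add: n3 eliminate_def active_def)
            have "echelon_kernel n (insert (rowf s p) (\<Phi>\<^sub>0 \<union> rowf s ` {..<p})) (active n s1 - {k})
                (eliminate (active n s1) k (\<lambda>l. nums s2 ''w'' [l]) (\<lambda>i l. nums s1 ''Q'' [i, l]))"
            proof (rule echelon_kernel_eliminate)
              show "echelon_kernel n (\<Phi>\<^sub>0 \<union> rowf s ` {..<p}) (active n s1) (\<lambda>i l. nums s1 ''Q'' [i, l])"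
                using s1(2) by (simp add: ker_def)
              show "\<forall>\<psi>\<in>insert (rowf s p) (\<Phi>\<^sub>0 \<union> rowf s ` {..<p}). linear_functional n \<psi>"
                using lin lin_rowf by blast
              show "nums s2 ''w'' [k] \<noteq> 0" using k n3 by simp
              show "nums s2 ''w'' [l] = rowf s p (\<lambda>i. nums s1 ''Q'' [i, l])" if "l \<in> active n s1" for l
                using that s2(3) by (simp add: active_def)
            qed fact
            then have "echelon_kernel n (\<Phi>\<^sub>0 \<union> rowf s ` {..<Suc p}) (active n s4) (\<lambda>i l. nums s4 ''Q'' [i, l])"
              unfolding insert act4 by (rule echelon_kernel_cong[rotated 2]) (use lin lin_rowf Q4 in blast)+
            then have ker4: "ker (Suc p) s4" using s1(2) act4 by (auto simp: ker_def)
            have "card (active n s1) \<le> card (active n s)" "0 < card (active n s1)"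
              using s1(2) k(2) fin by (auto simp: ker_def intro: card_mono simp: card_gt_0_iff)
            moreover have "card (active n s4) = card (active n s1) - 1"
              using act4 k(2) fin by simp
            ultimately have "card (active n s) - card (active n s4) = card (active n s) - card (active n s1) + 1"
              by linarith
            then have "bnd (Suc p) s4 = bnd (Suc p) s1 + B" by (simp add: bnd_def)
            then have "c + (k2 + (k3 + k4)) \<le> bnd (Suc p) s4" using cost s4(1) by linarith
            moreover have "frame ?X ?Y s s4"
              using frame_trans[OF fr3 s4(2)] by simp
            moreover have "ints s4 ''p'' [] = p" using n3 frame_ints[OF s4(2)] by simp
            ultimately show ?case
              using ker4 by (simp add: frame_update ker_def bnd_def active_def ints_set_int)
          qed
        next
          assume "\<not> bval s3 (BLess (V ''piv'') (V ''n''))"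
          then have zero: "nums s2 ''w'' [l] = 0" if "l \<in> active n s1" for l
            using 1 that n3 by (auto simp: F2 active_def)
          have "echelon_kernel n (insert (rowf s p) (\<Phi>\<^sub>0 \<union> rowf s ` {..<p})) (active n s1) (\<lambda>i l. nums s1 ''Q'' [i, l])"
            using s1(2) zero s2(3) by (intro echelon_kernel_keep) (auto simp: ker_def active_def)
          then have "ker (Suc p) s3" using s1(2) by (simp add: ker_def insert act3 n3)
          moreover have "bnd (Suc p) s3 = bnd (Suc p) s1" by (simp add: bnd_def act3)
          ultimately show "wp Skip (\<lambda>k' s'. ints s' ''p'' [] = p \<and>
              frame ?X ?Y s (set_int s' (''p'', []) (Suc p)) \<and> ker (Suc p) (set_int s' (''p'', []) (Suc p)) \<and>
              c + (k2 + (k3 + k')) \<le> bnd (Suc p) (set_int s' (''p'', []) (Suc p))) s3"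
            using fr3 n3 cost
            by (intro wp_intros) (simp add: frame_update ker_def bnd_def active_def ints_set_int)
        qed
      qed
    qed
  next
    case (4 c s')
    have "2 * n * N T + n * T \<le> 3 * n * T" using N_T by (simp add: mult_le_mono)
    moreover have "c \<le> 2 * n * N T + n * T + (card (active n s) - card (active n s')) * B"
      using 4 by (simp add: bnd_def)
    ultimately have "c \<le> 3 * n * T + (card (active n s) - card (active n s')) * B" by linarith
    then show ?case using 4 unfolding ker_def B_def by blast
  qed
qed

section \<open>Writing the output\<close>

text \<open>
  The retired variables come first, so the kernel vectors become the last columns of \<open>P\<close>.
\<close>

definition order_variables :: com where
  "order_variables = Seq (SetInt (''r'', []) (NLit 0))
     (Seq (For ''i'' (V ''n'') (If (BLess (NLit 0) (NAt ''act'' [V ''i''])) Skip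
        (Seq (SetInt (''perm'', [V ''r'']) (V ''i'')) (SetInt (''r'', []) (NAdd (V ''r'') (NLit 1))))))
     (Seq (SetInt (''z'', []) (V ''r''))
        (For ''i'' (V ''n'') (If (BLess (NLit 0) (NAt ''act'' [V ''i'']))
          (Seq (SetInt (''perm'', [V ''z'']) (V ''i'')) (SetInt (''z'', []) (NAdd (V ''z'') (NLit 1))))
          Skip))))"

lemma wp_order_variables:
  assumes "ints s ''n'' [] = n"
  shows "wp order_variables (\<lambda>k s'. k = 0 \<and> frame {''r'', ''z'', ''i'', ''perm''} {} s s' \<and>
    bij_betw (\<lambda>j. ints s' ''perm'' [j]) {..<n} {..<n} \<and> ints s' ''r'' [] \<le> n \<and>
    (\<lambda>j. ints s' ''perm'' [j]) ` {..<ints s' ''r'' []} = {..<n} - active n s) s"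
proof -
  let ?X = "{''r'', ''z'', ''i'', ''perm''}"
  note FR = frame_update frame_ints[of ?X "{}" s] frame_nums[of ?X "{}" s]
  define J where "J i = {l. l < i \<and> ints s ''act'' [l] = 0}" for i
  define K where "K i = {l. l < i \<and> 0 < ints s ''act'' [l]}" for i
  have J_Suc: "J (Suc i) = (if ints s ''act'' [i] = 0 then insert i (J i) else J i)"
    and K_Suc: "K (Suc i) = (if ints s ''act'' [i] = 0 then K i else insert i (K i))" for i
    by (auto simp: J_def K_def less_Suc_eq)
  define p where "p s' = (\<lambda>j. ints s' ''perm'' [j])" for s' :: state
  define F where "F c s' \<longleftrightarrow> c = 0 \<and> frame ?X {} s s'" for c :: nat and s'
  have p_frame: "p (set_int s' (x, es) v) = p s'" if "x \<noteq> ''perm''" for s' x es v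
    using that by (simp add: p_def ints_set_int)
  have p_set: "p (set_int s' (''perm'', [V x]) v) j = (if j = ints s' x [] then v else p s' j)" for s' x v j
    by (simp add: p_def ints_set_int)
  show ?thesis
    unfolding order_variables_def
  proof (intro wp_Seq wp_SetInt, rule wp_For[where I = "\<lambda>i c s'. F c s' \<and>
      bij_betw (p s') {..<ints s' ''r'' []} (J i)" and N = n], goal_cases)
    case 1
    show ?case by (simp add: F_def FR frame_init ints_set_int J_def bij_betw_def)
  next
    case (2 i k s)
    then show ?case using assms by (simp add: F_def FR)
  next
    case (3 i c s1)
    have "bij_betw (p (set_int s1 (''perm'', [V ''r'']) i)) {..<Suc (ints s1 ''r'' [])} (insert i (J i))"
      by (rule bij_betw_append[where h = "p s1"]) (use 3 in \<open>auto simp: p_set J_def\<close>)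
    then show ?case using 3
      by (intro wp_intros) (simp_all add: F_def FR ints_set_int p_frame J_Suc)
  next
    case (4 c s1)
    show ?case
    proof (intro wp_Seq wp_SetInt, rule wp_For[where I = "\<lambda>i c' s'. F (c + c') s' \<and>
        ints s' ''r'' [] = ints s1 ''r'' [] \<and> ints s1 ''r'' [] \<le> ints s' ''z'' [] \<and>
        p s' ` {..<ints s1 ''r'' []} = J n \<and>
        bij_betw (p s') {..<ints s' ''z'' []} (J n \<union> K i)" and N = n], goal_cases)
      case 1
      show ?case using 4 by (simp add: F_def FR ints_set_int p_frame K_def bij_betw_def)
    next
      case (2 i k s)
      then show ?case using assms by (simp add: F_def FR)
    next
      case (3 i c' s2)
      have "bij_betw (p (set_int s2 (''perm'', [V ''z'']) i)) {..<Suc (ints s2 ''z'' [])} (insert i (J n \<union> K i))"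
        if "0 < ints s ''act'' [i]"
        by (rule bij_betw_append[where h = "p s2"]) (use 3 that in \<open>auto simp: p_set J_def K_def\<close>)
      moreover have "p (set_int s2 (''perm'', [V ''z'']) i) ` {..<ints s1 ''r'' []} = J n"
      proof -
        have "p (set_int s2 (''perm'', [V ''z'']) i) ` {..<ints s1 ''r'' []} = p s2 ` {..<ints s1 ''r'' []}"
          using 3 by (intro image_cong) (auto simp: p_set)
        also have "\<dots> = J n" using 3 by blast
        finally show ?thesis .
      qed
      ultimately show ?case using 3
        by (intro wp_intros) (simp_all add: F_def FR ints_set_int p_frame K_Suc)
    next
      case (4 c' s')
      have un: "J n \<union> K n = {..<n}" by (auto simp: J_def K_def)
      then have "card {..<ints s' ''z'' []} = card {..<n}" using 4 bij_betw_same_card by metis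
      then have z: "ints s' ''z'' [] = n" by simp
      have "J n = {..<n} - active n s" by (auto simp: J_def active_def)
      then show ?case using 4 un z by (simp add: F_def p_def)
    qed
  qed
qed

definition copy_matrix :: com where
  "copy_matrix = For ''i'' (V ''n'') (For ''j'' (V ''n'')
     (Copy (''P'', [V ''i'', V ''j'']) (''Q'', [V ''i'', NAt ''perm'' [V ''j'']])))"

lemma wp_copy_matrix:
  assumes "ints s ''n'' [] = n"
  shows "wp copy_matrix (\<lambda>k s'. k = 0 \<and> frame {''i'', ''j''} {''P''} s s' \<and>
    (\<forall>i<n. \<forall>j<n. nums s' ''P'' [i, j] = nums s ''Q'' [i, ints s ''perm'' [j]])) s"
proof -
  note FR = frame_update frame_ints[of "{''i'', ''j''}" "{''P''}" s] frame_nums[of "{''i'', ''j''}" "{''P''}" s]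
  show ?thesis
    unfolding copy_matrix_def
  proof (rule wp_For[where I = "\<lambda>i c s'. c = 0 \<and> frame {''i'', ''j''} {''P''} s s' \<and>
      (\<forall>i'<i. \<forall>j<n. nums s' ''P'' [i', j] = nums s ''Q'' [i', ints s ''perm'' [j]])" and N = n], goal_cases)
    case 1
    show ?case by (simp add: frame_init)
  next
    case (2 i k s)
    then show ?case using assms by (simp add: FR)
  next
    case (3 i c s1)
    show ?case
    proof (rule wp_For[where I = "\<lambda>j c' s'. c + c' = 0 \<and> frame {''i'', ''j''} {''P''} s s' \<and>
        ints s' ''i'' [] = i \<and>
        (\<forall>i'<i. \<forall>j<n. nums s' ''P'' [i', j] = nums s ''Q'' [i', ints s ''perm'' [j]]) \<and>
        (\<forall>j'<j. nums s' ''P'' [i, j'] = nums s ''Q'' [i, ints s ''perm'' [j']])" and N = n], goal_cases)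
      case 1
      show ?case using 3 by (simp add: FR ints_set_int)
    next
      case (2 i k s)
      then show ?case using assms by (simp add: FR)
    next
      case (3 j c' s2)
      then show ?case
        by (intro wp_intros) (simp add: FR state_simps All_less_Suc)
    next
      case (4 c' s')
      then show ?case by (simp add: FR All_less_Suc)
    qed
  next
    case (4 c s')
    then show ?case by simp
  qed
qed

text \<open>
  The terms in which only retired variables occur.
\<close>

definition select_terms :: com where
  "select_terms = Seq (SetInt (''u'', []) (NLit 0))
     (For ''k'' (V ''t'') (Seq (SetInt (''x'', []) (NLit 1))
       (Seq (For ''i'' (V ''n'') (If (BAnd (BLess (NLit 0) (NAt ''act'' [V ''i'']))
              (BLess (NLit 0) (NAt ''a'' [V ''k'', V ''i'']))) (SetInt (''x'', []) (NLit 0)) Skip))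
            (If (BLess (NLit 0) (V ''x''))
              (Seq (SetInt (''kt'', [V ''u'']) (V ''k'')) (SetInt (''u'', []) (NAdd (V ''u'') (NLit 1))))
              Skip))))"

lemma wp_select_terms:
  assumes "ints s ''n'' [] = n" "ints s ''t'' [] = t"
  shows "wp select_terms (\<lambda>k s'. k = 0 \<and> frame {''u'', ''k'', ''x'', ''i'', ''kt''} {} s s' \<and>
    bij_betw (\<lambda>q. ints s' ''kt'' [q]) {..<ints s' ''u'' []}
      {k. k < t \<and> (\<forall>i\<in>active n s. ints s ''a'' [k, i] = 0)}) s"
proof -
  let ?X = "{''u'', ''k'', ''x'', ''i'', ''kt''}"
  note FR = frame_update frame_ints[of ?X "{}" s] frame_nums[of ?X "{}" s]
  define keep where "keep k \<longleftrightarrow> (\<forall>i\<in>active n s. ints s ''a'' [k, i] = 0)" for k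
  define S where "S k = {k'. k' < k \<and> keep k'}" for k
  have S_Suc: "S (Suc k) = (if keep k then insert k (S k) else S k)" for k
    by (auto simp: S_def less_Suc_eq)
  define p where "p s' = (\<lambda>j. ints s' ''kt'' [j])" for s' :: state
  define F where "F c s' \<longleftrightarrow> c = 0 \<and> frame ?X {} s s'" for c :: nat and s'
  have p_frame: "p (set_int s' (x, es) v) = p s'" if "x \<noteq> ''kt''" for s' x es v
    using that by (simp add: p_def ints_set_int)
  have p_set: "p (set_int s' (''kt'', [V x]) v) j = (if j = ints s' x [] then v else p s' j)" for s' x v j
    by (simp add: p_def ints_set_int)
  show ?thesis
    unfolding select_terms_def
  proof (intro wp_Seq wp_SetInt, rule wp_For[where I = "\<lambda>k c s'. F c s' \<and>
      bij_betw (p s') {..<ints s' ''u'' []} (S k)" and N = t], goal_cases)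
    case 1
    show ?case by (simp add: F_def FR frame_init ints_set_int S_def bij_betw_def)
  next
    case (2 i k s)
    then show ?case using assms by (simp add: F_def FR)
  next
    case (3 k c s1)
    show ?case
    proof (intro wp_Seq wp_SetInt, rule wp_For[where I = "\<lambda>i c' s'. F (c + c') s' \<and> ints s' ''k'' [] = k \<and>
        bij_betw (p s') {..<ints s' ''u'' []} (S k) \<and>
        ints s' ''x'' [] = (if \<forall>i'<i. ints s ''act'' [i'] = 0 \<or> ints s ''a'' [k, i'] = 0 then 1 else 0)"
        and N = n], goal_cases)
      case 1
      show ?case using 3 by (simp add: F_def FR ints_set_int p_frame)
    next
      case (2 i k s)
      then show ?case using assms by (simp add: F_def FR)
    next
      case (3 i c' s2)
      then show ?case
        by (intro wp_intros) (simp_all add: F_def FR ints_set_int p_frame All_less_Suc)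
    next
      case (4 c' s2)
      then have x: "ints s2 ''x'' [] = (if keep k then 1 else 0)"
        by (auto simp: keep_def active_def)
      have "bij_betw (p (set_int s2 (''kt'', [V ''u'']) k)) {..<Suc (ints s2 ''u'' [])} (insert k (S k))"
        by (rule bij_betw_append[where h = "p s2"]) (use 4 in \<open>simp_all add: p_set S_def\<close>)
      moreover have "F (c + c') s2" "ints s2 ''k'' [] = k" "bij_betw (p s2) {..<ints s2 ''u'' []} (S k)"
        using 4 by auto
      ultimately show ?case using x
        by (cases "keep k"; intro wp_intros) (simp_all add: F_def FR ints_set_int p_frame S_Suc)
    qed
  next
    case (4 c s')
    then show ?case by (simp add: F_def S_def keep_def p_def)
  qed
qed

definition write_terms :: com where
  "write_terms = For ''q'' (V ''u'') (Seq (Copy (''g'', [V ''q'']) (''c'', [NAt ''kt'' [V ''q'']]))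
     (For ''j'' (V ''r'')
       (SetInt (''b'', [V ''q'', V ''j'']) (NAt ''a'' [NAt ''kt'' [V ''q''], NAt ''perm'' [V ''j'']]))))"

lemma wp_write_terms:
  assumes "ints s ''u'' [] = u" "ints s ''r'' [] = r"
  shows "wp write_terms (\<lambda>k s'. k = 0 \<and> frame {''q'', ''j'', ''b''} {''g''} s s' \<and>
    (\<forall>q<u. nums s' ''g'' [q] = nums s ''c'' [ints s ''kt'' [q]] \<and>
      (\<forall>j<r. ints s' ''b'' [q, j] = ints s ''a'' [ints s ''kt'' [q], ints s ''perm'' [j]]))) s"
proof -
  let ?X = "{''q'', ''j'', ''b''}"
  note FR = frame_update frame_ints[of ?X "{''g''}" s] frame_nums[of ?X "{''g''}" s]
  define fin where "fin q s' \<longleftrightarrow> (\<forall>q'<q. nums s' ''g'' [q'] = nums s ''c'' [ints s ''kt'' [q']] \<and>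
      (\<forall>j<r. ints s' ''b'' [q', j] = ints s ''a'' [ints s ''kt'' [q'], ints s ''perm'' [j]]))" for q and s' :: state
  show ?thesis
    unfolding write_terms_def
  proof (rule wp_For[where I = "\<lambda>q c s'. c = 0 \<and> frame ?X {''g''} s s' \<and> fin q s'" and N = u], goal_cases)
    case 1
    show ?case by (simp add: frame_init fin_def)
  next
    case (2 i k s)
    then show ?case using assms by (simp add: FR)
  next
    case (3 q c s1)
    show ?case
    proof (intro wp_Seq wp_Copy, rule wp_For[where I = "\<lambda>j c' s'. c + c' = 0 \<and> frame ?X {''g''} s s' \<and>
        fin q s' \<and> ints s' ''q'' [] = q \<and> nums s' ''g'' [q] = nums s ''c'' [ints s ''kt'' [q]] \<and>
        (\<forall>j'<j. ints s' ''b'' [q, j'] = ints s ''a'' [ints s ''kt'' [q], ints s ''perm'' [j']])" and N = r], goal_cases)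
      case 1
      show ?case using 3 by (simp add: FR state_simps fin_def)
    next
      case (2 i k s)
      then show ?case using assms by (simp add: FR)
    next
      case (3 j c' s2)
      then show ?case
        by (intro wp_intros) (simp add: FR ints_set_int fin_def All_less_Suc)
    next
      case (4 c' s')
      then show ?case by (simp add: FR ints_set_int fin_def All_less_Suc)
    qed
  next
    case (4 c s')
    then show ?case by (simp add: fin_def)
  qed
qed


section \<open>The coefficient matrix of the gradient\<close>

text \<open>
  The tables that the program has computed, seen as a matrix: the entry \<open>q\<close> lies in the row \<open>rid q\<close> and
  in the column \<open>ev q\<close> and has the value \<open>v q\<close>.  A row
  stands for the common quotient of the terms of its entries by their variables.
\<close>

locale gradient_matrix =
  fixes n :: nat and f :: cpoly and ms :: "(nat \<Rightarrow>\<^sub>0 nat) list" and T :: nat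
    and ek ev rid :: "nat \<Rightarrow> nat" and v :: "nat \<Rightarrow> complex"
  assumes vars_f: "vars f \<subseteq> {..<n}"
    and ms: "distinct ms" "set ms = Poly_Mapping.keys f"
    and entries: "bij_betw (\<lambda>q. (ek q, ev q)) {..<T}
      {(k, i). k < length ms \<and> i < n \<and> 0 < Poly_Mapping.lookup (ms ! k) i}"
    and rid_less: "\<And>q. q < T \<Longrightarrow> rid q < T"
    and rid_eq_iff: "\<And>p q. p < T \<Longrightarrow> q < T \<Longrightarrow> rid p = rid q \<longleftrightarrow>
      ms ! ek p - Poly_Mapping.single (ev p) 1 = ms ! ek q - Poly_Mapping.single (ev q) 1"
    and v: "\<And>q. q < T \<Longrightarrow> v q = of_nat (Poly_Mapping.lookup (ms ! ek q) (ev q)) * Poly_Mapping.lookup f (ms ! ek q)"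
begin

abbreviation "rowf \<equiv> row_functional T rid ev v"

definition label :: "nat \<Rightarrow> nat \<Rightarrow>\<^sub>0 nat" where
  "label q = ms ! ek q - Poly_Mapping.single (ev q) 1"

lemma entry_bounds:
  assumes "q < T"
  shows "ek q < length ms" "ev q < n" "0 < Poly_Mapping.lookup (ms ! ek q) (ev q)"
  using bij_betw_apply[OF entries] assms by auto

lemma entryE:
  assumes "k < length ms" "i < n" "0 < Poly_Mapping.lookup (ms ! k) i"
  obtains q where "q < T" "ek q = k" "ev q = i"
proof -
  have "(k, i) \<in> (\<lambda>q. (ek q, ev q)) ` {..<T}"
    using assms bij_betw_imp_surj_on[OF entries] by simp
  then show ?thesis using that by auto
qed

lemma entry_monomial: "q < T \<Longrightarrow> ms ! ek q = label q + Poly_Mapping.single (ev q) 1"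
  using shift_monomial_iff[OF entry_bounds(3), of q "label q"] by (simp add: label_def)

lemma entry_eqI:
  assumes "p < T" "q < T" "label p = label q" "ev p = ev q"
  shows "p = q"
proof -
  have "ms ! ek p = ms ! ek q" using assms entry_monomial by metis
  then have "ek p = ek q" using assms entry_bounds(1) ms(1) nth_eq_iff_index_eq by blast
  then show ?thesis
    using assms bij_betw_imp_inj_on[OF entries] by (auto dest: inj_onD)
qed

lemma T_le: "T \<le> n * length ms"
proof -
  have "T = card {(k, i). k < length ms \<and> i < n \<and> 0 < Poly_Mapping.lookup (ms ! k) i}"
    using bij_betw_same_card[OF entries] by simp
  also have "\<dots> \<le> card ({..<length ms} \<times> {..<n})"
    by (rule card_mono) auto
  finally show ?thesis by (simp add: mult.commute)
qed

lemma v_nonzero: "q < T \<Longrightarrow> v q \<noteq> 0"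
  using entry_bounds[of q] ms(2) nth_mem[of "ek q" ms] by (auto simp: v in_keys_iff)

text \<open>
  For a fixed row \<open>m\<close> an entry is determined by its variable \<open>l\<close>, and the variables that occur are those for
  which \<open>m x\<^sub>l\<close> is a term of \<open>f\<close>.
\<close>

lemma sum_label_eq_lookup_dir_deriv:
  "(\<Sum>q<T. if label q = m then v q * y (ev q) else 0) = Poly_Mapping.lookup (dir_deriv n f y) m"
proof -
  let ?S = "{q. q < T \<and> label q = m}"
  let ?L = "{l. l < n \<and> m + Poly_Mapping.single l 1 \<in> Poly_Mapping.keys f}"
  let ?h = "\<lambda>l. y l * (of_nat (Suc (Poly_Mapping.lookup m l)) * Poly_Mapping.lookup f (m + Poly_Mapping.single l 1))"
  have "(\<Sum>q<T. if label q = m then v q * y (ev q) else 0) = (\<Sum>q\<in>?S. v q * y (ev q))"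
    by (rule sum.mono_neutral_cong_right) auto
  also have "\<dots> = sum ?h ?L"
  proof (rule sum.reindex_cong[symmetric])
    show "inj_on ev ?S" by (auto intro!: inj_onI entry_eqI)
    show "?L = ev ` ?S"
    proof
      show "?L \<subseteq> ev ` ?S"
      proof
        fix l assume l: "l \<in> ?L"
        then obtain k where k: "k < length ms" "ms ! k = m + Poly_Mapping.single l 1"
          using ms(2) by (metis (no_types, lifting) in_set_conv_nth mem_Collect_eq)
        then obtain q where q: "q < T" "ek q = k" "ev q = l"
          using l by (auto simp: lookup_add elim: entryE)
        then have "label q = m" using k by (simp add: label_def)
        then show "l \<in> ev ` ?S" using q by blast
      qed
      show "ev ` ?S \<subseteq> ?L"
      proof
        fix l assume "l \<in> ev ` ?S"
        then obtain q where q: "q < T" "label q = m" "l = ev q" by auto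
        then have "m + Poly_Mapping.single l 1 = ms ! ek q" using entry_monomial by simp
        moreover have "ms ! ek q \<in> Poly_Mapping.keys f"
          using entry_bounds(1)[OF q(1)] ms(2) nth_mem by blast
        ultimately show "l \<in> ?L" using q entry_bounds(2) by simp
      qed
    qed
    show "?h (ev q) = v q * y (ev q)" if "q \<in> ?S" for q
      using that entry_monomial[of q] by (simp add: v lookup_add mult.commute)
  qed
  also have "\<dots> = sum ?h {..<n}"
    by (rule sum.mono_neutral_left) (auto simp: in_keys_iff)
  also have "\<dots> = Poly_Mapping.lookup (dir_deriv n f y) m"
    by (simp add: dir_deriv_def lookup_sum lookup_partial)
  finally show ?thesis .
qed

lemma rowf_rid: "p < T \<Longrightarrow> rowf (rid p) y = Poly_Mapping.lookup (dir_deriv n f y) (label p)"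
  unfolding sum_label_eq_lookup_dir_deriv[symmetric] row_functional_def
  by (rule sum.cong) (auto simp: rid_eq_iff label_def)

text \<open>
  The rows are the coefficients of the directional derivative.  Numbers that name no row give
  the zero functional, and monomials that label no row have the coefficient zero.
\<close>

lemma rows_vanish_iff: "(\<forall>\<phi>\<in>rowf ` {..<T}. \<phi> y = 0) \<longleftrightarrow> dir_deriv n f y = 0"
proof
  assume rows: "\<forall>\<phi>\<in>rowf ` {..<T}. \<phi> y = 0"
  show "dir_deriv n f y = 0"
  proof (rule poly_mapping_eqI)
    fix m
    show "Poly_Mapping.lookup (dir_deriv n f y) m = Poly_Mapping.lookup 0 m"
    proof (cases "\<exists>q<T. label q = m")
      case True
      then obtain q where q: "q < T" "label q = m" by blast
      then have "rowf (rid q) y = 0" using rows rid_less by blast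
      then show ?thesis using rowf_rid[OF q(1)] q(2) by simp
    next
      case False
      then show ?thesis by (simp flip: sum_label_eq_lookup_dir_deriv)
    qed
  qed
next
  assume zero: "dir_deriv n f y = 0"
  show "\<forall>\<phi>\<in>rowf ` {..<T}. \<phi> y = 0"
  proof
    fix \<phi> assume "\<phi> \<in> rowf ` {..<T}"
    then obtain p where p: "\<phi> = rowf p" by blast
    show "\<phi> y = 0"
    proof (cases "\<exists>q<T. rid q = p")
      case True
      then show ?thesis using rowf_rid zero p by auto
    next
      case False
      then show ?thesis by (simp add: p row_functional_def)
    qed
  qed
qed

definition singletons :: "nat set" where
  "singletons = {i. \<exists>q<T. ev q = i \<and> alone T rid q}"

definition singleton_rows :: "((nat \<Rightarrow> complex) \<Rightarrow> complex) set" where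
  "singleton_rows = {rowf (rid q) | q. q < T \<and> alone T rid q}"

lemma singleton_rows_subset: "singleton_rows \<subseteq> rowf ` {..<T}"
  using rid_less by (auto simp: singleton_rows_def)

lemma linear_rowf: "linear_functional n (rowf p)"
  by (rule linear_row_functional) (rule entry_bounds(2))

lemma rowf_alone:
  assumes "q < T" "alone T rid q"
  shows "rowf (rid q) y = v q * y (ev q)"
proof -
  have "rowf (rid q) y = (\<Sum>p<T. if p = q then v q * y (ev q) else 0)"
    unfolding row_functional_def using assms by (intro sum.cong) (auto simp: alone_def)
  then show ?thesis using assms by simp
qed

lemma echelon_kernel_singletons:
  "echelon_kernel n singleton_rows ({..<n} - singletons) (\<lambda>i l. if i = l then 1 else 0)"
  unfolding echelon_kernel_def
proof (intro conjI allI ballI impI)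
  fix l \<phi> assume l: "l \<in> {..<n} - singletons" and "\<phi> \<in> singleton_rows"
  then obtain q where q: "\<phi> = rowf (rid q)" "q < T" "alone T rid q"
    by (auto simp: singleton_rows_def)
  then have "ev q \<noteq> l" using l by (auto simp: singletons_def)
  then show "\<phi> (\<lambda>i. if i = l then 1 else 0) = 0" using q by (simp add: rowf_alone)
next
  fix y i assume y: "\<forall>i\<in>{..<n} - singletons. y i = 0" "\<forall>\<phi>\<in>singleton_rows. \<phi> y = 0" and i: "i < n"
  show "y i = 0"
  proof (cases "i \<in> singletons")
    case True
    then obtain q where q: "q < T" "alone T rid q" "ev q = i" by (auto simp: singletons_def)
    then have "rowf (rid q) y = 0" using y(2) by (auto simp: singleton_rows_def)
    then show ?thesis using q v_nonzero by (simp add: rowf_alone)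
  qed (use y i in auto)
qed auto

text \<open>
  Let \<open>i\<close> be retired by the elimination.  The unit vector \<open>e\<^sub>i\<close> vanishes on \<open>A\<close>, so some row does not kill
  it and has an entry with the variable \<open>i\<close>.  As \<open>i\<close> was not retired for being alone in a row, this row has a second
  entry with another variable \<open>j\<close>, and the two terms differ by exchanging \<open>x\<^sub>i\<close> and \<open>x\<^sub>j\<close>.
\<close>

lemma card_pivots_le:
  assumes ker: "echelon_kernel n (rowf ` {..<T}) A Q" and A: "A \<subseteq> {..<n} - singletons"
  shows "card ({..<n} - singletons) - card A \<le> 2 * length ms"
proof -
  define W where "W = {i. \<exists>q<T. ev q = i \<and> (\<exists>q'<T. q' \<noteq> q \<and> rid q' = rid q)}"
  have "W \<subseteq> {..<n}" using entry_bounds(2) by (auto simp: W_def)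
  then have finW: "finite W" by (rule finite_subset) simp
  have "({..<n} - singletons) - A \<subseteq> W"
  proof
    fix i assume i: "i \<in> ({..<n} - singletons) - A"
    let ?e = "\<lambda>l. if l = i then 1 else 0 :: complex"
    have "\<exists>\<phi>\<in>rowf ` {..<T}. \<phi> ?e \<noteq> 0"
    proof (rule ccontr)
      assume "\<not> ?thesis"
      then have "\<forall>l<n. ?e l = 0"
        using i by (intro echelon_kernelD(4)[OF ker]) auto
      then show False using i by auto
    qed
    then obtain p where "rowf p ?e \<noteq> 0" by auto
    then obtain q where q: "q < T" "ev q = i"
      unfolding row_functional_def
      by (rule sum.not_neutral_contains_not_neutral) (auto split: if_splits)
    then have "\<not> alone T rid q" using i by (auto simp: singletons_def)
    then show "i \<in> W" using q by (auto simp: W_def alone_def)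
  qed
  then have "card (({..<n} - singletons) - A) \<le> card W"
    using finW by (rule card_mono[rotated])
  also have "card W \<le> 2 * card (set ms)"
  proof (rule card_adjacent_vars_le[OF _ finW])
    fix i assume "i \<in> W"
    then obtain q q' where q: "q < T" "ev q = i" "q' < T" "q' \<noteq> q" "rid q' = rid q"
      by (auto simp: W_def)
    have lab: "label q' = label q" using q rid_eq_iff by (simp add: label_def)
    have "ev q' \<noteq> i" using entry_eqI[OF q(3,1) lab] q(2,4) by auto
    moreover have "ev q' \<in> W"
      unfolding W_def using q by (intro CollectI exI[of _ q'] conjI exI[of _ q]) simp_all
    moreover have "ms ! ek q \<in> set ms" "ms ! ek q' \<in> set ms" using q entry_bounds(1) by simp_all
    moreover have "ms ! ek q + Poly_Mapping.single (ev q') 1 = ms ! ek q' + Poly_Mapping.single i 1"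
      using q lab entry_monomial by (simp add: add_ac)
    ultimately show "\<exists>j\<in>W. j \<noteq> i \<and> (\<exists>m\<in>set ms. \<exists>m'\<in>set ms.
        m + Poly_Mapping.single j 1 = m' + Poly_Mapping.single i 1)"
      by blast
  qed simp
  also have "card (set ms) = length ms" using ms(1) by (rule distinct_card)
  finally show ?thesis
    using A by (simp add: card_Diff_subset finite_subset[OF A])
qed

end

section \<open>The complete program\<close>

definition detect_and_reduce :: com where
  "detect_and_reduce = Seq list_entries (Seq tabulate_rows (Seq identify_rows (Seq init_identity
     (Seq retire_singletons (Seq compute_coeffs (Seq eliminate_rows (Seq order_variables
     (Seq copy_matrix (Seq select_terms (Seq write_terms
       (If (BLess (V ''r'') (V ''n'')) (SetInt (''nondegenerate'', []) (NLit 0))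
         (SetInt (''nondegenerate'', []) (NLit 1)))))))))))))"

text \<open>
  The coefficients cost \<open>2 T\<close>, where \<open>T \<le> n t\<close> is the number of entries, and \<open>A \<le> 2 t\<close> is the number of pivots.
\<close>

lemma cost_le:
  fixes n t T A :: nat
  assumes "T \<le> n * t" "A \<le> 2 * t"
  shows "2 * T + (3 * n * T + A * (n * (1 + 2 * n))) \<le> 11 * (n\<^sup>2 * t)"
proof -
  have nn: "n \<le> n\<^sup>2" by (simp add: power2_eq_square)
  have "2 * T \<le> 2 * (n\<^sup>2 * t)"
    using assms(1) mult_le_mono1[OF nn, of t] by linarith
  moreover have "3 * n * T \<le> 3 * (n\<^sup>2 * t)"
    using mult_le_mono2[OF assms(1), of n] by (simp add: power2_eq_square mult_ac)
  moreover have "A * (n * (1 + 2 * n)) \<le> 6 * (n\<^sup>2 * t)"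
  proof -
    have "n * (1 + 2 * n) \<le> 3 * n\<^sup>2" using nn by (simp add: power2_eq_square distrib_left)
    then have "A * (n * (1 + 2 * n)) \<le> (2 * t) * (3 * n\<^sup>2)" by (rule mult_le_mono[OF assms(2)])
    then show ?thesis by (simp add: mult_ac)
  qed
  ultimately show ?thesis by linarith
qed

lemma wp_detect_and_reduce:
  assumes f: "vars f \<subseteq> {..<n}" and input: "stores_input n d f s"
  shows "wp detect_and_reduce (\<lambda>k s'. k \<le> 11 * (n\<^sup>2 * num_terms f) \<and> stores_output n f s') s"
proof -
  obtain ms where ms: "distinct ms" "set ms = Poly_Mapping.keys f"
    and tn: "ints s ''t'' [] = length ms"
    and c: "\<And>k. k < length ms \<Longrightarrow> nums s ''c'' [k] = Poly_Mapping.lookup f (ms ! k)"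
    and a: "\<And>k i. k < length ms \<Longrightarrow> i < n \<Longrightarrow> ints s ''a'' [k, i] = Poly_Mapping.lookup (ms ! k) i"
    and n: "ints s ''n'' [] = n"
    using input by (auto simp: stores_input_def stores_poly_def)
  have num_terms: "num_terms f = length ms"
    using ms distinct_card by (metis num_terms_def)
  show ?thesis
    unfolding detect_and_reduce_def
  proof (rule wp_Seq, rule wp_mono[OF wp_list_entries[OF n tn]], goal_cases)
    case (1 k1 s1)
    then have s1: "k1 = 0" "frame {''m'', ''k'', ''i'', ''ek'', ''ev''} {} s s1"
      and bij1: "bij_betw (entry s1) {..<ints s1 ''m'' []} {(k, i). k < length ms \<and> i < n \<and> 0 < ints s ''a'' [k, i]}"
      by auto
    note F1 = frame_ints[OF s1(2)] frame_nums[OF s1(2)]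
    define T where "T = ints s1 ''m'' []"
    define ek where "ek q = ints s1 ''ek'' [q]" for q
    define ev where "ev q = ints s1 ''ev'' [q]" for q
    have "{(k, i). k < length ms \<and> i < n \<and> 0 < ints s ''a'' [k, i]} =
        {(k, i). k < length ms \<and> i < n \<and> 0 < Poly_Mapping.lookup (ms ! k) i}"
      using a by auto
    then have bij: "bij_betw (\<lambda>q. (ek q, ev q)) {..<T}
        {(k, i). k < length ms \<and> i < n \<and> 0 < Poly_Mapping.lookup (ms ! k) i}"
      using bij1 by (simp add: T_def ek_def ev_def entry_def[abs_def])
    have ent: "ek q < length ms" "ev q < n" if "q < T" for q
      using bij_betw_apply[OF bij, of q] that by auto
    have n1: "ints s1 ''n'' [] = n" "ints s1 ''m'' [] = T" using n by (simp_all add: F1 T_def)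
    show ?case
    proof (rule wp_Seq, rule wp_mono[OF wp_tabulate_rows[OF n1]], goal_cases)
      case (1 k2 s2)
      then have s2: "k2 = 0" "frame {''q'', ''j'', ''R''} {} s1 s2"
        and R: "\<And>q j. q < T \<Longrightarrow> j < n \<Longrightarrow>
          ints s2 ''R'' [q, j] = ints s1 ''a'' [ek q, j] - (if j = ev q then 1 else 0)"
        by (auto simp: ek_def ev_def)
      note F2 = frame_ints[OF s2(2)] frame_nums[OF s2(2)]
      have n2: "ints s2 ''n'' [] = n" "ints s2 ''m'' [] = T" using n1 by (simp_all add: F2)
      have same: "same_row n s2 p q \<longleftrightarrow>
          ms ! ek p - Poly_Mapping.single (ev p) 1 = ms ! ek q - Poly_Mapping.single (ev q) 1"
        if "p < T" "q < T" for p q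
      proof -
        have R': "ints s2 ''R'' [q, j] = Poly_Mapping.lookup (ms ! ek q - Poly_Mapping.single (ev q) 1) j"
          if "q < T" "j < n" for q j
          using that R ent a by (simp add: F1 lookup_minus lookup_single when_def)
        have out: "Poly_Mapping.lookup (ms ! ek q - Poly_Mapping.single (ev q) 1) j = 0"
          if "q < T" "\<not> j < n" for q j
        proof -
          have "ms ! ek q \<in> Poly_Mapping.keys f" using that ent ms(2) nth_mem by blast
          then have "Poly_Mapping.lookup (ms ! ek q) j = 0"
            using f that(2) by (force simp: vars_iff)
          then show ?thesis by (simp add: lookup_minus)
        qed
        show ?thesis
          unfolding same_row_def poly_mapping_eq_iff fun_eq_iff
          using R' out that by metis
      qed
      show ?case
      proof (rule wp_Seq, rule wp_mono[OF wp_identify_rows[OF n2]], goal_cases)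
        case (1 k3 s3)
        then have s3: "k3 = 0" "frame {''q'', ''p'', ''j'', ''x'', ''rid''} {} s2 s3"
          and rid3: "\<And>q. q < T \<Longrightarrow> ints s3 ''rid'' [q] = Max {p. p < T \<and> same_row n s2 p q}"
          by auto
        note F3 = frame_ints[OF s3(2)] frame_nums[OF s3(2)]
        define rid where "rid q = ints s3 ''rid'' [q]" for q
        define v where "v q = of_nat (ints s ''a'' [ek q, ev q]) * nums s ''c'' [ek q]" for q
        interpret gradient_matrix n f ms T ek ev rid v
        proof
          show "rid q < T" if "q < T" for q
            using that rid3 Max_same_row(1) by (simp add: rid_def)
          show "rid p = rid q \<longleftrightarrow>
              ms ! ek p - Poly_Mapping.single (ev p) 1 = ms ! ek q - Poly_Mapping.single (ev q) 1"
            if "p < T" "q < T" for p q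
            unfolding same[OF that, symmetric] using Max_same_row(2)[OF that] that rid3 by (simp add: rid_def)
          show "v q = of_nat (Poly_Mapping.lookup (ms ! ek q) (ev q)) * Poly_Mapping.lookup f (ms ! ek q)"
            if "q < T" for q
            using that ent a c by (simp add: v_def)
        qed fact+
        have n3: "ints s3 ''n'' [] = n" using n2 by (simp add: F3)
        show ?case
        proof (rule wp_Seq, rule wp_mono[OF wp_init_identity[OF n3]], goal_cases)
          case (1 k4 s4)
          then have s4: "k4 = 0" "frame {''i'', ''l'', ''act''} {''Q''} s3 s4"
            and act4: "\<forall>i<n. ints s4 ''act'' [i] = 1"
            and Q4: "\<And>i l. i < n \<Longrightarrow> l < n \<Longrightarrow> nums s4 ''Q'' [i, l] = (if i = l then 1 else 0)"
            by auto
          note F4 = frame_ints[OF s4(2)] frame_nums[OF s4(2)]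
          have m4: "ints s4 ''m'' [] = T" using n2 by (simp add: F3 F4)
          have rid4: "(\<lambda>q. ints s4 ''rid'' [q]) = rid" "\<And>q. ints s4 ''ev'' [q] = ev q"
            by (simp_all add: F2 F3 F4 rid_def ev_def fun_eq_iff)
          show ?case
          proof (rule wp_Seq, rule wp_mono[OF wp_retire_singletons[OF m4 act4]], goal_cases)
            case (1 k5 s5)
            then have s5: "k5 = 0" "frame {''q'', ''p'', ''x'', ''act''} {} s4 s5"
              and act5: "\<And>i. i < n \<Longrightarrow> ints s5 ''act'' [i] = (if i \<in> singletons then 0 else 1)"
              by (auto simp: rid4 singletons_def)
            note F5 = frame_ints[OF s5(2)] frame_nums[OF s5(2)]
            have m5: "ints s5 ''m'' [] = T" using m4 by (simp add: F5)
            show ?case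
            proof (rule wp_Seq, rule wp_mono[OF wp_compute_coeffs[OF m5]], goal_cases)
              case (1 k6 s6)
              then have s6: "k6 = 2 * T" "frame {''q''} {''v''} s5 s6"
                and v6: "\<And>q. q < T \<Longrightarrow> nums s6 ''v'' [q] = v q"
                by (simp_all add: v_def F1 F2 F3 F4 F5 ek_def ev_def)
              note F6 = frame_ints[OF s6(2)] frame_nums[OF s6(2)]
              have in6: "ints s6 ''n'' [] = n" "ints s6 ''m'' [] = T" "ints s6 ''t'' [] = length ms"
                "ints s6 ''a'' = ints s ''a''" "nums s6 ''c'' = nums s ''c''"
                using n tn m5 by (simp_all add: F1 F2 F3 F4 F5 F6)
              have ev6: "\<And>q. q < T \<Longrightarrow> ints s6 ''ev'' [q] < n"
                using ent rid4 by (simp add: F5 F6)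
              have rows6: "row_functional (ints s6 ''m'' []) (\<lambda>q. ints s6 ''rid'' [q]) (\<lambda>q. ints s6 ''ev'' [q])
                  (\<lambda>q. nums s6 ''v'' [q]) = rowf"
                unfolding row_functional_def in6
                using v6 fun_cong[OF rid4(1)] rid4(2) by (intro ext sum.cong) (simp_all add: F5 F6)
              have act6: "active n s6 = {..<n} - singletons"
                using act5 by (auto simp: active_def F6)
              have lin6: "linear_functional n \<phi>" if "\<phi> \<in> singleton_rows" for \<phi>
                using that linear_rowf by (auto simp: singleton_rows_def)
              have ker6: "echelon_kernel n singleton_rows (active n s6) (\<lambda>i l. nums s6 ''Q'' [i, l])"
                unfolding act6
                by (rule echelon_kernel_cong[OF lin6 _ echelon_kernel_singletons])
                  (simp_all add: Q4 F5 F6)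
              show ?case
              proof (rule wp_Seq, rule wp_mono[OF wp_eliminate_rows[OF in6(1,2) ev6 lin6 ker6]], goal_cases)
                case (3 k7 s7)
                then have s7: "frame {''p'', ''q'', ''l'', ''i'', ''piv'', ''act''} {''w'', ''h'', ''y'', ''Q''} s6 s7"
                  and A: "active n s7 \<subseteq> {..<n} - singletons"
                  and "echelon_kernel n (singleton_rows \<union> rowf ` {..<T}) (active n s7) (\<lambda>i l. nums s7 ''Q'' [i, l])"
                  and k7: "k7 \<le> 3 * n * T + (card ({..<n} - singletons) - card (active n s7)) * (n * (1 + 2 * n))"
                  unfolding rows6 act6 by blast+
                then have ker7: "echelon_kernel n (rowf ` {..<T}) (active n s7) (\<lambda>i l. nums s7 ''Q'' [i, l])"
                  using singleton_rows_subset by (simp add: Un_absorb1)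
                have cost: "2 * T + k7 \<le> 11 * (n\<^sup>2 * num_terms f)"
                  using cost_le[OF T_le card_pivots_le[OF ker7 A]] k7 unfolding num_terms by linarith
                note F7 = frame_ints[OF s7] frame_nums[OF s7]
                have n7: "ints s7 ''n'' [] = n" using in6 by (simp add: F7)
                show ?case
                proof (rule wp_Seq, rule wp_mono[OF wp_order_variables[OF n7]], goal_cases)
                  case (1 k8 s8)
                  define \<pi> where "\<pi> j = ints s8 ''perm'' [j]" for j
                  define r where "r = ints s8 ''r'' []"
                  have s8: "k8 = 0" "frame {''r'', ''z'', ''i'', ''perm''} {} s7 s8"
                    and \<pi>: "bij_betw \<pi> {..<n} {..<n}" "r \<le> n" "\<pi> ` {..<r} = {..<n} - active n s7"
                    using 1 by (simp_all add: \<pi>_def[abs_def] r_def)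
                  note F8 = frame_ints[OF s8(2)] frame_nums[OF s8(2)]
                  interpret red: reduction n f "rowf ` {..<T}" "active n s7" "\<lambda>i l. nums s7 ''Q'' [i, l]" \<pi> r
                    by unfold_locales (use vars_f rows_vanish_iff ker7 \<pi> in blast)+
                  have n8: "ints s8 ''n'' [] = n" using n7 by (simp add: F8)
                  show ?case
                  proof (rule wp_Seq, rule wp_mono[OF wp_copy_matrix[OF n8]], goal_cases)
                    case (1 k9 s9)
                    then have s9: "k9 = 0" "frame {''i'', ''j''} {''P''} s8 s9"
                      and P: "\<And>i j. i < n \<Longrightarrow> j < n \<Longrightarrow> nums s9 ''P'' [i, j] = nums s7 ''Q'' [i, \<pi> j]"
                      by (simp_all add: F8 \<pi>_def)
                    note F9 = frame_ints[OF s9(2)] frame_nums[OF s9(2)]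
                    have n9: "ints s9 ''n'' [] = n" "ints s9 ''t'' [] = length ms"
                      using n8 in6 by (simp_all add: F7 F8 F9)
                    have act9: "active n s9 = active n s7" by (simp add: active_def F8 F9)
                    have a9: "ints s9 ''a'' = ints s ''a''" using in6 by (simp add: F7 F8 F9)
                    show ?case
                    proof (rule wp_Seq, rule wp_mono[OF wp_select_terms[OF n9]], goal_cases)
                      case (1 k10 s10)
                      define kt where "kt q = ints s10 ''kt'' [q]" for q
                      define u where "u = ints s10 ''u'' []"
                      have s10: "k10 = 0" "frame {''u'', ''k'', ''x'', ''i'', ''kt''} {} s9 s10"
                        and kt: "bij_betw kt {..<u} {k. k < length ms \<and> (\<forall>i\<in>active n s7. ints s ''a'' [k, i] = 0)}"
                        using 1 by (simp_all add: act9 a9 kt_def[abs_def] u_def)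
                      note F10 = frame_ints[OF s10(2)] frame_nums[OF s10(2)]
                      have r10: "ints s10 ''r'' [] = r" by (simp add: F9 F10 r_def)
                      show ?case
                      proof (rule wp_Seq, rule wp_mono[OF wp_write_terms[OF u_def[symmetric] r10]], goal_cases)
                        case (1 k11 s11)
                        then have s11: "k11 = 0" "frame {''q'', ''j'', ''b''} {''g''} s10 s11"
                          and g: "\<And>q. q < u \<Longrightarrow> nums s11 ''g'' [q] = nums s ''c'' [kt q]"
                          and b: "\<And>q j. q < u \<Longrightarrow> j < r \<Longrightarrow> ints s11 ''b'' [q, j] = ints s ''a'' [kt q, \<pi> j]"
                          using in6 by (simp_all add: F7 F8 F9 F10 kt_def \<pi>_def)
                        note F11 = frame_ints[OF s11(2)] frame_nums[OF s11(2)]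
                        have kt_less: "kt q < length ms" if "q < u" for q
                          using bij_betw_apply[OF kt, of q] that by simp
                        have "inj_on (\<lambda>q. ms ! kt q) {..<u}"
                        proof (rule inj_onI)
                          fix p q assume "p \<in> {..<u}" "q \<in> {..<u}" "ms ! kt p = ms ! kt q"
                          moreover from this have "kt p = kt q"
                            using kt_less nth_eq_iff_index_eq[OF ms(1)] by simp
                          ultimately show "p = q" using inj_onD[OF bij_betw_imp_inj_on[OF kt]] by blast
                        qed
                        moreover have kept: "(\<lambda>q. ms ! kt q) ` {..<u} = kept_terms (active n s7) f"
                        proof -
                          have "(\<lambda>q. ms ! kt q) ` {..<u} =
                              (!) ms ` {k. k < length ms \<and> (\<forall>i\<in>active n s7. ints s ''a'' [k, i] = 0)}"
                            unfolding bij_betw_imp_surj_on[OF kt, symmetric] by (simp add: image_image)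
                          also have "{k. k < length ms \<and> (\<forall>i\<in>active n s7. ints s ''a'' [k, i] = 0)} =
                              {k. k < length ms \<and> Poly_Mapping.keys (ms ! k) \<inter> active n s7 = {}}"
                            using a by (auto simp: active_def in_keys_iff disjoint_iff)
                          also have "(!) ms ` \<dots> = kept_terms (active n s7) f"
                            unfolding kept_terms_def ms(2)[symmetric] by (auto simp: in_set_conv_nth)
                          finally show ?thesis .
                        qed
                        ultimately have inj: "inj_on (\<lambda>q. rename_monomial r \<pi> (ms ! kt q)) {..<u}"
                          using comp_inj_on[of "\<lambda>q. ms ! kt q" "{..<u}" "rename_monomial r \<pi>"] red.inj_on_rename
                          by (simp add: comp_def)
                        define ms' where "ms' = map (\<lambda>q. rename_monomial r \<pi> (ms ! kt q)) [0..<u]"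
                        have out11: "ints s11 ''u'' [] = u" "ints s11 ''r'' [] = r" "ints s11 ''n'' [] = n"
                          "\<And>i j. i < n \<Longrightarrow> j < n \<Longrightarrow> nums s11 ''P'' [i, j] = nums s7 ''Q'' [i, \<pi> j]"
                          using n9 r10 P by (simp_all add: F10 F11 u_def)
                        \<comment> \<open>The output flag is still to be set, which leaves the arrays of the polynomial alone.\<close>
                        have poly: "stores_poly r ''u'' ''b'' ''g'' red.g s12"
                          if "ints s12 ''u'' = ints s11 ''u''" "ints s12 ''b'' = ints s11 ''b''"
                            "nums s12 ''g'' = nums s11 ''g''" for s12
                          unfolding stores_poly_def
                        proof (intro exI[of _ ms'] conjI allI impI)
                          show "distinct ms'" using inj by (simp add: ms'_def distinct_map atLeast0LessThan)
                          have "set ms' = rename_monomial r \<pi> ` (\<lambda>q. ms ! kt q) ` {..<u}"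
                            by (auto simp: ms'_def)
                          then show "set ms' = Poly_Mapping.keys red.g" by (simp add: kept red.keys_g)
                          show "ints s12 ''u'' [] = length ms'" using out11 that by (simp add: ms'_def)
                        next
                          fix q assume "q < length ms'"
                          then have q: "q < u" by (simp add: ms'_def)
                          then have "ms ! kt q \<in> kept_terms (active n s7) f" using kept by blast
                          then show "nums s12 ''g'' [q] = Poly_Mapping.lookup red.g (ms' ! q)"
                            using q g c kt_less that by (simp add: ms'_def red.lookup_g)
                          show "ints s12 ''b'' [q, i] = Poly_Mapping.lookup (ms' ! q) i" if "i < r" for i
                            using q b a kt_less that red.\<pi>_less[of i] \<pi>(2) \<open>ints s12 ''b'' = _\<close>
                            by (simp add: ms'_def lookup_rename_monomial)
                        qed
                        have mat: "mat n n (\<lambda>(i, j). nums s11 ''P'' [i, j]) = red.subst_mat"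
                          using out11(4) by (intro eq_matI) (simp_all add: red.subst_mat_def)
                        let ?s12 = "set_int s11 (''nondegenerate'', []) (if r < n then 0 else 1)"
                        have poly12: "stores_poly r ''u'' ''b'' ''g'' red.g ?s12"
                          by (rule poly) (simp_all add: ints_set_int)
                        have flag: "stores_output n f ?s12"
                          unfolding stores_output_def Let_def
                        proof (intro conjI impI exI[of _ red.g])
                          show "ints ?s12 ''nondegenerate'' [] = (if nondegenerate n f then 1 else 0)"
                            using red.degenerate_iff by (simp add: ints_set_int)
                          show "stores_poly (ints ?s12 ''r'' []) ''u'' ''b'' ''g'' red.g ?s12"
                            using poly12 out11(2) by (simp add: ints_set_int)
                          show "reduces_to n f (ints ?s12 ''r'' []) (mat n n (\<lambda>(i, j). nums ?s12 ''P'' [i, j])) red.g"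
                            if "degenerate n f"
                            using that red.degenerate_iff red.reduces_to_g out11(2) by (simp add: ints_set_int mat)
                        qed
                        show ?case
                          using flag cost s1(1) s2(1) s3(1) s4(1) s5(1) s6(1) s8(1) s9(1) s10(1) s11(1) out11
                          by (intro wp_intros) auto
                      qed
                    qed
                  qed
                qed
              qed auto
            qed
          qed
        qed
      qed
    qed
  qed
qed

theorem proposition3p1:
  shows "\<exists>(prog :: com) (C :: nat). \<forall>(n :: nat) (d :: nat) (f :: cpoly) (s :: state).
    3 \<le> d \<longrightarrow> vars f \<subseteq> {..<n} \<longrightarrow> homogeneous d f \<longrightarrow> stores_input n d f s \<longrightarrow>
    (\<exists>k s'. exec prog s k s' \<and> k \<le> C * (n\<^sup>2 * num_terms f) \<and> stores_output n f s')"
  using wp_detect_and_reduce unfolding wp_def by blast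

end
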